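(* For each $d,r\in\mathbb{N}_+$ and each $\omega\in\mathbb{N}_+$ with $\omega\ge2$, there exist finite, interface-respecting instructive DP-cores, each with some cleaning function and equipped with witness actions, denoted $\mathsf{MaxDeg}_{\ge d}$, $\mathsf{Chrom}_{\le r}$, $\mathsf{SimpleClique}_{\ge\omega}$, $\mathsf{HasMultipleEdges}$, such that: 1. $\mathsf{MaxDeg}_{\ge d}$ has bit-length $O(k\log(d+1))$ and $\mathcal{P}(\mathsf{MaxDeg}_{\ge d})$ is the property of graphs with maximum degree at least $d$; 2. $\mathsf{Chrom}_{\le r}$ has bit-length $O(k\log(r+1))$ and $\mathcal{P}(\mathsf{Chrom}_{\le r})$ is the property of $r$-colorable graphs; 3. $\mathsf{SimpleClique}_{\ge\omega}$ has bit-length $O(k\log\omega)$ and $\mathcal{P}(\mathsf{SimpleClique}_{\ge\omega})\cap\mathcal{S}=\mathcal{C}_\omega\cap\mathcal{S}$, where $\mathcal{S}$ is the set of simple graphs (graphs with no multiple edges) and $\mathcal{C}_\omega$ is the property of graphs containing a clique of size $\omega$; 4. $\mathsf{HasMultipleEdges}$ has bit-length $O(k^2)$ and $\mathcal{P}(\mathsf{HasMultipleEdges})$ is the property of graphs having a multiple edge. Moreover, the cores in items 1, 2 and 4 are coherent.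
   Context: Graphs are triples $(V,E,\rho)$, $V,E$ finite subsets of $\mathbb{N}$, $\rho\subseteq E\times V$, each edge incident to exactly two distinct vertices; a multiple edge is a pair of distinct edges with the same endpoints; simple graphs have none. Graph properties are isomorphism-closed sets of graphs. The empty graph has maximum degree $0$; $r$-colorable means the vertex set has a partition into at most $r$ cells with the endpoints of every edge in distinct cells. Instructive decompositions: the $k$-instructive alphabet has $\mathtt{Leaf}$ (arity 0), $\mathtt{IntroVertex}_u,\mathtt{ForgetVertex}_u$ ($u\in[k+1]$), $\mathtt{IntroEdge}_{u,v}$ (distinct $u,v$) of arity 1 and $\mathtt{Join}$ of arity 2; $\mathcal{T}_k$ is the set of terms legal w.r.t. bags (Leaf: $\emptyset$; IntroVertex$_u$ needs $u\notin$ bag, adds it; ForgetVertex$_u$ needs $u\in$ bag, removes it; IntroEdge$_{u,v}$ needs $u,v\in$ bag; Join needs equal child bags). $G(\tau)$: Leaf gives the empty graph; IntroVertex$_u$ adds a fresh isolated vertex labeled $u$; ForgetVertex$_u$ drops label $u$; IntroEdge$_{u,v}$ adds a new edge between the vertices labeled $u,v$; Join is the disjoint union of children with vertices carrying the same bag label identified (edges never identified). An (instructive) DP-core $\mathsf{D}$ assigns to each $k\in\mathbb{N}$ a tuple $\mathsf{D}[k]$: a decidable set $\mathcal{W}_k\subseteq\{0,1\}^*$ of witnesses, $\mathtt{Final}_k:\mathcal{W}_k\to\{0,1\}$, a finite $\mathtt{Leaf}_k\subseteq\mathcal{W}_k$, transitions $\mathtt{IntroVertex}_u,\mathtt{ForgetVertex}_u,\mathtt{IntroEdge}_{u,v}:\mathcal{W}_k\to$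 finite subsets, $\mathtt{Join}:\mathcal{W}_k^2\to$ finite subsets (lifted to sets by union), a cleaning function $\mathtt{Clean}_k$ on finite subsets (and an invariant function, irrelevant here). $\mathrm{Dyn}_k(\tau)$ is $\mathtt{Leaf}_k$ at leaves and $\mathtt{Clean}_k$ of the lifted transition applied to children's dynamizations otherwise; $\mathsf{D}[k]$ accepts $\tau$ if $\mathrm{Dyn}_k(\tau)$ has a final witness; $\mathcal{P}(\mathsf{D})=\bigcup_k$ iso-closure of $\{G(\tau):\tau\in\mathcal{T}_k$ accepted by $\mathsf{D}[k]\}$. Finite: each $\mathcal{W}_k$ is finite. Bit-length $O(g(k))$: every witness of $\mathsf{D}[k]$ can be encoded with $O(g(k))$ bits. Coherent: for $\tau\in\mathcal{T}_k,\tau'\in\mathcal{T}_{k'}$ with $G(\tau)\cong G(\tau')$, $\mathsf{D}[k]$ accepts $\tau$ iff $\mathsf{D}[k']$ accepts $\tau'$. Labels: each witness $w$ has a label set $\mathrm{Lbl}_k(w)\subseteq[k+1]$, $\mathrm{Lbl}_k(S)=\bigcup_{w\in S}\mathrm{Lbl}_k(w)$. Interface-respecting: $\mathrm{Lbl}_k(\mathtt{Leaf}_k)=\emptyset$, and whenever $\mathrm{Lbl}_k(S),\mathrm{Lbl}_k(S')\subseteq b$: $\mathrm{Lbl}_k(\mathtt{IntroVertex}_u(S))\subseteq b\cup\{u\}$ ($u\notin b$), $\mathrm{Lbl}_k(\mathtt{ForgetVertex}_u(S))\subseteq b\setminus\{u\}$ ($u\in b$), $\mathrm{Lbl}_k(\mathtt{IntroEdge}_{u,v}(S))\subseteq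 b$ ($u,v\in b$), $\mathrm{Lbl}_k(\mathtt{Join}(S,S'))\subseteq b$, $\mathrm{Lbl}_k(\mathtt{Clean}_k(S))\subseteq b$. With $\mathcal{F}_k$ the set of injective $f:b\to[k+1]$ ($b\subseteq[k+1]$), a witness action for $\mathsf{D}[k]$ is a partial map $\rho(f,w)\in\mathcal{W}_k$ defined iff $\mathrm{Lbl}_k(w)\subseteq\mathrm{dom}(f)$ (pointwise on sets), preserving finality, with $\mathrm{Lbl}_k(\rho(f,w))=f(\mathrm{Lbl}_k(w))$, $\rho(f^{-1},\rho(f,w))=w$, $\rho(f\circ f',w)=\rho(f,\rho(f',w))$, $\rho(f',w)=\rho(f,w)$ if $f'$ extends $f$, and $\rho(f,\cdot)$ commuting with the transitions (relabeling the labels of the transitions by $f$). Equipped with witness actions: one for each $\mathsf{D}[k]$. *)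

theory Defs
  imports Complex_Main "HOL-Library.Disjoint_Sets"
begin

section \<open>Graphs\<close>

record graph =
  verts :: "nat set"
  edges :: "nat set"
  inc :: "(nat \<times> nat) set"

definition endpoints :: "graph \<Rightarrow> nat \<Rightarrow> nat set" where
  "endpoints G e = {v. (e, v) \<in> inc G}"

definition is_graph :: "graph \<Rightarrow> bool" where
  "is_graph G \<longleftrightarrow> finite (verts G) \<and> finite (edges G) \<and> inc G \<subseteq> edges G \<times> verts G \<and>
     (\<forall>e \<in> edges G. card (endpoints G e) = 2)"

definition graph_iso :: "graph \<Rightarrow> graph \<Rightarrow> bool" where
  "graph_iso G H \<longleftrightarrow>
     (\<exists>\<phi> \<psi>. bij_betw \<phi> (verts G) (verts H) \<and> bij_betw \<psi> (edges G) (edges H) \<and>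
        (\<forall>e \<in> edges G. \<forall>v \<in> verts G. (e, v) \<in> inc G \<longleftrightarrow> (\<psi> e, \<phi> v) \<in> inc H))"

definition degree :: "graph \<Rightarrow> nat \<Rightarrow> nat" where
  "degree G v = card {e \<in> edges G. (e, v) \<in> inc G}"

definition max_degree :: "graph \<Rightarrow> nat" where
  "max_degree G = (if verts G = {} then 0 else Max (degree G ` verts G))"

definition colorable :: "nat \<Rightarrow> graph \<Rightarrow> bool" where
  "colorable r G \<longleftrightarrow>
     (\<exists>P. partition_on (verts G) P \<and> card P \<le> r \<and>
        (\<forall>e \<in> edges G. \<forall>u \<in> endpoints G e. \<forall>v \<in> endpoints G e. u \<noteq> v \<longrightarrow>
           \<not> (\<exists>C \<in> P. u \<in> C \<and> v \<in> C)))"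

definition has_clique :: "nat \<Rightarrow> graph \<Rightarrow> bool" where
  "has_clique m G \<longleftrightarrow>
     (\<exists>K \<subseteq> verts G. card K = m \<and>
        (\<forall>u \<in> K. \<forall>v \<in> K. u \<noteq> v \<longrightarrow> (\<exists>e \<in> edges G. endpoints G e = {u, v})))"

definition has_multiple_edge :: "graph \<Rightarrow> bool" where
  "has_multiple_edge G \<longleftrightarrow>
     (\<exists>e \<in> edges G. \<exists>e' \<in> edges G. e \<noteq> e' \<and> endpoints G e = endpoints G e')"

definition simple_graphs :: "graph set" where
  "simple_graphs = {G. is_graph G \<and> \<not> has_multiple_edge G}"


section \<open>Instructive tree decompositions\<close>

datatype instr =
    Leaf
  | IntroVertex nat instr
  | ForgetVertex nat instr
  | IntroEdge nat nat instr
  | Join instr instr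

primrec bag :: "instr \<Rightarrow> nat set" where
  "bag Leaf = {}"
| "bag (IntroVertex u t) = insert u (bag t)"
| "bag (ForgetVertex u t) = bag t - {u}"
| "bag (IntroEdge u v t) = bag t"
| "bag (Join s t) = bag s"

primrec legal :: "nat \<Rightarrow> instr \<Rightarrow> bool" where
  "legal k Leaf \<longleftrightarrow> True"
| "legal k (IntroVertex u t) \<longleftrightarrow> legal k t \<and> u \<in> {1..k+1} \<and> u \<notin> bag t"
| "legal k (ForgetVertex u t) \<longleftrightarrow> legal k t \<and> u \<in> {1..k+1} \<and> u \<in> bag t"
| "legal k (IntroEdge u v t) \<longleftrightarrow>
     legal k t \<and> u \<in> {1..k+1} \<and> v \<in> {1..k+1} \<and> u \<noteq> v \<and> u \<in> bag t \<and> v \<in> bag t"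
| "legal k (Join s t) \<longleftrightarrow> legal k s \<and> legal k t \<and> bag s = bag t"

definition fresh :: "nat set \<Rightarrow> nat" where
  "fresh A = (if A = {} then 0 else Suc (Max A))"

text \<open>A labeled graph is a graph together with the partial map sending a label of the bag to
  the vertex that carries it. In a join, the disjoint union is realised by the even numbers (left
  child) and the odd numbers (right child); a labeled vertex of the right child is sent to the
  (even) copy of the vertex of the left child that carries the same label.\<close>

definition add_vertex :: "nat \<Rightarrow> graph \<times> (nat \<rightharpoonup> nat) \<Rightarrow> graph \<times> (nat \<rightharpoonup> nat)" where
  "add_vertex u = (\<lambda>(G, \<theta>). let x = fresh (verts G) in
     (G\<lparr>verts := insert x (verts G)\<rparr>, \<theta>(u \<mapsto> x)))"

definition drop_label :: "nat \<Rightarrow> graph \<times> (nat \<rightharpoonup> nat) \<Rightarrow> graph \<times> (nat \<rightharpoonup> nat)" where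
  "drop_label u = (\<lambda>(G, \<theta>). (G, \<theta>(u := None)))"

definition add_edge :: "nat \<Rightarrow> nat \<Rightarrow> graph \<times> (nat \<rightharpoonup> nat) \<Rightarrow> graph \<times> (nat \<rightharpoonup> nat)" where
  "add_edge u v = (\<lambda>(G, \<theta>). let e = fresh (edges G) in
     (G\<lparr>edges := insert e (edges G), inc := inc G \<union> {(e, the (\<theta> u)), (e, the (\<theta> v))}\<rparr>, \<theta>))"

definition glue :: "graph \<times> (nat \<rightharpoonup> nat) \<Rightarrow> graph \<times> (nat \<rightharpoonup> nat) \<Rightarrow> graph \<times> (nat \<rightharpoonup> nat)" where
  "glue = (\<lambda>(G, \<theta>) (G', \<theta>').
     let h = (\<lambda>x. if x \<in> ran \<theta>' then 2 * the (\<theta> (THE u. \<theta>' u = Some x)) else 2 * x + 1) in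
     (\<lparr>verts = (\<lambda>x. 2 * x) ` verts G \<union> h ` verts G',
       edges = (\<lambda>e. 2 * e) ` edges G \<union> (\<lambda>e. 2 * e + 1) ` edges G',
       inc = (\<lambda>(e, x). (2 * e, 2 * x)) ` inc G \<union> (\<lambda>(e, x). (2 * e + 1, h x)) ` inc G'\<rparr>,
      map_option (\<lambda>x. 2 * x) \<circ> \<theta>))"

primrec lgraph_of :: "instr \<Rightarrow> graph \<times> (nat \<rightharpoonup> nat)" where
  "lgraph_of Leaf = (\<lparr>verts = {}, edges = {}, inc = {}\<rparr>, Map.empty)"
| "lgraph_of (IntroVertex u t) = add_vertex u (lgraph_of t)"
| "lgraph_of (ForgetVertex u t) = drop_label u (lgraph_of t)"
| "lgraph_of (IntroEdge u v t) = add_edge u v (lgraph_of t)"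
| "lgraph_of (Join s t) = glue (lgraph_of s) (lgraph_of t)"

definition graph_of :: "instr \<Rightarrow> graph" where
  "graph_of t = fst (lgraph_of t)"


section \<open>Decidable languages\<close>

text \<open>Deterministic Turing machines with one two-way infinite tape over blank (\<open>None\<close>), 0 and 1.
  The control states are \<open>0, \<dots>, n - 1\<close> with start state \<open>0\<close>; the machine halts outside of
  them, accepting in \<open>n\<close> and rejecting in \<open>Suc n\<close>. Only the finitely many values of the
  transition table at states below \<open>n\<close> are ever used.\<close>

datatype tm_move = MoveLeft | MoveRight

type_synonym tm_table = "nat \<Rightarrow> bool option \<Rightarrow> nat \<times> bool option \<times> tm_move"
type_synonym tm_config = "nat \<times> int \<times> (int \<Rightarrow> bool option)"

definition tm_step :: "nat \<Rightarrow> tm_table \<Rightarrow> tm_config \<Rightarrow> tm_config" where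
  "tm_step n \<delta> = (\<lambda>(q, p, t).
     if q < n then
       (case \<delta> q (t p) of (q', a, m) \<Rightarrow>
          (q', case m of MoveLeft \<Rightarrow> p - 1 | MoveRight \<Rightarrow> p + 1, t(p := a)))
     else (q, p, t))"

definition tm_init :: "bool list \<Rightarrow> tm_config" where
  "tm_init w = (0, 0, \<lambda>i. if 0 \<le> i \<and> i < int (length w) then Some (w ! nat i) else None)"

definition decidable :: "bool list set \<Rightarrow> bool" where
  "decidable L \<longleftrightarrow>
     (\<exists>n \<delta>. \<forall>w. \<exists>s. fst ((tm_step n \<delta> ^^ s) (tm_init w)) = (if w \<in> L then n else Suc n))"


section \<open>Dynamic programming cores\<close>

record dp_tuple =
  Wit :: "bool list set"
  Final :: "bool list \<Rightarrow> bool"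
  LeafW :: "bool list set"
  IntroVertexW :: "nat \<Rightarrow> bool list \<Rightarrow> bool list set"
  ForgetVertexW :: "nat \<Rightarrow> bool list \<Rightarrow> bool list set"
  IntroEdgeW :: "nat \<Rightarrow> nat \<Rightarrow> bool list \<Rightarrow> bool list set"
  JoinW :: "bool list \<Rightarrow> bool list \<Rightarrow> bool list set"
  Clean :: "bool list set \<Rightarrow> bool list set"
  Inv :: "bool list set \<Rightarrow> bool list"
  Lbl :: "bool list \<Rightarrow> nat set"

type_synonym dp_core = "nat \<Rightarrow> dp_tuple"

definition fin_subsets :: "bool list set \<Rightarrow> bool list set set" where
  "fin_subsets W = {S. finite S \<and> S \<subseteq> W}"

definition is_dp_core :: "dp_core \<Rightarrow> bool" where
  "is_dp_core D \<longleftrightarrow> (\<forall>k.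
     decidable (Wit (D k)) \<and>
     LeafW (D k) \<in> fin_subsets (Wit (D k)) \<and>
     (\<forall>w \<in> Wit (D k). \<forall>u \<in> {1..k+1}.
        IntroVertexW (D k) u w \<in> fin_subsets (Wit (D k)) \<and>
        ForgetVertexW (D k) u w \<in> fin_subsets (Wit (D k))) \<and>
     (\<forall>w \<in> Wit (D k). \<forall>u \<in> {1..k+1}. \<forall>v \<in> {1..k+1}. u \<noteq> v \<longrightarrow>
        IntroEdgeW (D k) u v w \<in> fin_subsets (Wit (D k))) \<and>
     (\<forall>w \<in> Wit (D k). \<forall>w' \<in> Wit (D k). JoinW (D k) w w' \<in> fin_subsets (Wit (D k))) \<and>
     (\<forall>S \<in> fin_subsets (Wit (D k)). Clean (D k) S \<in> fin_subsets (Wit (D k))) \<and>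
     (\<forall>w \<in> Wit (D k). Lbl (D k) w \<subseteq> {1..k+1}))"

definition lift :: "(bool list \<Rightarrow> bool list set) \<Rightarrow> bool list set \<Rightarrow> bool list set" where
  "lift T S = (\<Union>w \<in> S. T w)"

definition lift2 ::
    "(bool list \<Rightarrow> bool list \<Rightarrow> bool list set) \<Rightarrow> bool list set \<Rightarrow> bool list set \<Rightarrow> bool list set" where
  "lift2 T S S' = (\<Union>w \<in> S. \<Union>w' \<in> S'. T w w')"

primrec dyn :: "dp_tuple \<Rightarrow> instr \<Rightarrow> bool list set" where
  "dyn A Leaf = LeafW A"
| "dyn A (IntroVertex u t) = Clean A (lift (IntroVertexW A u) (dyn A t))"
| "dyn A (ForgetVertex u t) = Clean A (lift (ForgetVertexW A u) (dyn A t))"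
| "dyn A (IntroEdge u v t) = Clean A (lift (IntroEdgeW A u v) (dyn A t))"
| "dyn A (Join s t) = Clean A (lift2 (JoinW A) (dyn A s) (dyn A t))"

definition accepts :: "dp_tuple \<Rightarrow> instr \<Rightarrow> bool" where
  "accepts A t \<longleftrightarrow> (\<exists>w \<in> dyn A t. Final A w)"

definition core_property :: "dp_core \<Rightarrow> graph set" where
  "core_property D =
     (\<Union>k. {H. is_graph H \<and> (\<exists>t. legal k t \<and> accepts (D k) t \<and> graph_iso (graph_of t) H)})"

definition finite_core :: "dp_core \<Rightarrow> bool" where
  "finite_core D \<longleftrightarrow> (\<forall>k. finite (Wit (D k)))"

definition coherent :: "dp_core \<Rightarrow> bool" where
  "coherent D \<longleftrightarrow>
     (\<forall>k k' t t'. legal k t \<longrightarrow> legal k' t' \<longrightarrow> graph_iso (graph_of t) (graph_of t') \<longrightarrow>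
        accepts (D k) t = accepts (D k') t')"

text \<open>Bounds of the form \<open>O(k \<cdot> c)\<close> vanish at \<open>k = 0\<close>, hence the restriction to positive \<open>k\<close>.\<close>

definition bit_length_le :: "dp_core \<Rightarrow> (nat \<Rightarrow> real) \<Rightarrow> bool" where
  "bit_length_le D g \<longleftrightarrow> (\<forall>k \<ge> 1. \<forall>w \<in> Wit (D k). real (length w) \<le> g k)"


section \<open>Labels and witness actions\<close>

definition lbl_set :: "dp_tuple \<Rightarrow> bool list set \<Rightarrow> nat set" where
  "lbl_set A S = (\<Union>w \<in> S. Lbl A w)"

definition interface_respecting :: "dp_core \<Rightarrow> bool" where
  "interface_respecting D \<longleftrightarrow> (\<forall>k.
     lbl_set (D k) (LeafW (D k)) = {} \<and>
     (\<forall>b \<subseteq> {1..k+1}. \<forall>S \<in> fin_subsets (Wit (D k)). lbl_set (D k) S \<subseteq> b \<longrightarrow>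
        (\<forall>u \<in> {1..k+1}. u \<notin> b \<longrightarrow>
           lbl_set (D k) (lift (IntroVertexW (D k) u) S) \<subseteq> b \<union> {u}) \<and>
        (\<forall>u \<in> b. lbl_set (D k) (lift (ForgetVertexW (D k) u) S) \<subseteq> b - {u}) \<and>
        (\<forall>u \<in> b. \<forall>v \<in> b. u \<noteq> v \<longrightarrow>
           lbl_set (D k) (lift (IntroEdgeW (D k) u v) S) \<subseteq> b) \<and>
        (\<forall>S' \<in> fin_subsets (Wit (D k)). lbl_set (D k) S' \<subseteq> b \<longrightarrow>
           lbl_set (D k) (lift2 (JoinW (D k)) S S') \<subseteq> b) \<and>
        lbl_set (D k) (Clean (D k) S) \<subseteq> b))"

definition partial_injections :: "nat \<Rightarrow> (nat \<rightharpoonup> nat) set" where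
  "partial_injections k = {f. dom f \<subseteq> {1..k+1} \<and> ran f \<subseteq> {1..k+1} \<and> inj_on f (dom f)}"

definition inv_map :: "(nat \<rightharpoonup> nat) \<Rightarrow> (nat \<rightharpoonup> nat)" where
  "inv_map f y = (if y \<in> ran f then Some (THE x. f x = Some y) else None)"

definition act_set ::
    "((nat \<rightharpoonup> nat) \<Rightarrow> bool list \<rightharpoonup> bool list) \<Rightarrow> (nat \<rightharpoonup> nat) \<Rightarrow> bool list set \<Rightarrow> bool list set" where
  "act_set \<rho> f S = {w'. \<exists>w \<in> S. \<rho> f w = Some w'}"

text \<open>Commutation with the operations of the core is required whenever both sides are defined,
  that is, whenever all labels involved lie in the domain of the relabeling.\<close>

definition action_commutes ::
    "dp_tuple \<Rightarrow> ((nat \<rightharpoonup> nat) \<Rightarrow> bool list \<rightharpoonup> bool list) \<Rightarrow> (nat \<rightharpoonup> nat) \<Rightarrow> bool" where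
  "action_commutes A \<rho> f \<longleftrightarrow>
     (\<forall>S \<in> fin_subsets (Wit A). lbl_set A S \<subseteq> dom f \<longrightarrow>
        (\<forall>u \<in> dom f. lbl_set A (lift (IntroVertexW A u) S) \<subseteq> dom f \<longrightarrow>
           act_set \<rho> f (lift (IntroVertexW A u) S) =
             lift (IntroVertexW A (the (f u))) (act_set \<rho> f S)) \<and>
        (\<forall>u \<in> dom f. lbl_set A (lift (ForgetVertexW A u) S) \<subseteq> dom f \<longrightarrow>
           act_set \<rho> f (lift (ForgetVertexW A u) S) =
             lift (ForgetVertexW A (the (f u))) (act_set \<rho> f S)) \<and>
        (\<forall>u \<in> dom f. \<forall>v \<in> dom f. u \<noteq> v \<longrightarrow>
           lbl_set A (lift (IntroEdgeW A u v) S) \<subseteq> dom f \<longrightarrow>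
           act_set \<rho> f (lift (IntroEdgeW A u v) S) =
             lift (IntroEdgeW A (the (f u)) (the (f v))) (act_set \<rho> f S)) \<and>
        (\<forall>S' \<in> fin_subsets (Wit A). lbl_set A S' \<subseteq> dom f \<longrightarrow>
           lbl_set A (lift2 (JoinW A) S S') \<subseteq> dom f \<longrightarrow>
           act_set \<rho> f (lift2 (JoinW A) S S') =
             lift2 (JoinW A) (act_set \<rho> f S) (act_set \<rho> f S')) \<and>
        (lbl_set A (Clean A S) \<subseteq> dom f \<longrightarrow>
           act_set \<rho> f (Clean A S) = Clean A (act_set \<rho> f S)))"

definition witness_action ::
    "nat \<Rightarrow> dp_tuple \<Rightarrow> ((nat \<rightharpoonup> nat) \<Rightarrow> bool list \<rightharpoonup> bool list) \<Rightarrow> bool" where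
  "witness_action k A \<rho> \<longleftrightarrow>
     (\<forall>f \<in> partial_injections k. \<forall>w \<in> Wit A. \<rho> f w \<noteq> None \<longleftrightarrow> Lbl A w \<subseteq> dom f) \<and>
     (\<forall>f \<in> partial_injections k. \<forall>w \<in> Wit A. \<forall>w'. \<rho> f w = Some w' \<longrightarrow>
        w' \<in> Wit A \<and> Final A w' = Final A w \<and>
        Lbl A w' = (\<lambda>u. the (f u)) ` Lbl A w \<and>
        \<rho> (inv_map f) w' = Some w) \<and>
     (\<forall>f \<in> partial_injections k. \<forall>f' \<in> partial_injections k. \<forall>w \<in> Wit A.
        \<rho> (f \<circ>\<^sub>m f') w = Option.bind (\<rho> f' w) (\<rho> f)) \<and>
     (\<forall>f \<in> partial_injections k. \<forall>f' \<in> partial_injections k. f \<subseteq>\<^sub>m f' \<longrightarrow>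
        (\<forall>w \<in> Wit A. Lbl A w \<subseteq> dom f \<longrightarrow> \<rho> f' w = \<rho> f w)) \<and>
     (\<forall>f \<in> partial_injections k. action_commutes A \<rho> f)"

definition has_witness_actions :: "dp_core \<Rightarrow> bool" where
  "has_witness_actions D \<longleftrightarrow> (\<forall>k. \<exists>\<rho>. witness_action k (D k) \<rho>)"

end

theory Submission
  imports Defs "HOL-Combinatorics.Permutations" "HOL-Library.FuncSet"
begin

text \<open>Each core is a finite-state system whose states carry a finite support of labels, on which the
  permutations of the labels act and whose transitions are equivariant. Such a system is turned into
  a core by encoding the states injectively as bit strings of length at most
  \<open>log 2 (card X) + 1\<close>; a partial injection acts through any permutation that extends it,
  the choice being irrelevant because only the values on the support matter. Decidability is
  automatic, since a finite language is recognised by a machine that walks down a trie. With the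
  identity as cleaning function, the states reached on a decomposition are exactly the states of
  partial solutions on its graph, which is shown by induction on the decomposition. Finally
  every graph is the graph of a decomposition that introduces all vertices and then all edges.\<close>

section \<open>Finite languages are decidable\<close>

text \<open>The bit budgets shape the states. Storing which bag vertices are adjacent takes on the
  order of \<open>k^2\<close> bits. The multiple-edge core pays this price, because a parallel edge
  can only be recognised from the pairs already joined. The clique core, with
  \<open>O(k log \<omega>)\<close> bits, cannot afford it: it guesses a vertex set and merely counts
  its vertices and inner edges, and the count certifies a clique only when no two edges are
  parallel. This is where the restriction to simple graphs comes from. Relabelings are partial,
  which makes direct equations between them awkward. Letting total bijections act on states turns
  commutation into unconditional equations, and whether a partial relabeling is defined becomes a
  condition on the support alone. Coherence has two sources: the transitions do not mention
  \<open>k\<close>, and acceptance is characterised by an isomorphism-invariant predicate of the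
  graph.\<close>

definition trie_index :: "bool list \<Rightarrow> nat" where
  "trie_index w = foldl (\<lambda>i b. 2 * i + 1 + of_bool b) 0 w"

lemma trie_index_Nil [simp]: "trie_index [] = 0"
  by (simp add: trie_index_def)

lemma trie_index_snoc [simp]: "trie_index (w @ [b]) = 2 * trie_index w + 1 + of_bool b"
  by (simp add: trie_index_def)

text \<open>Strings are numbered like the nodes of a binary heap: the root is \<open>0\<close> and
  the children of \<open>i\<close> are \<open>2 * i + 1\<close> and \<open>2 * i + 2\<close>. Parity
  recovers the last bit and halving recovers the parent, hence the induction from the right
  end.\<close>

lemma trie_index_inject: "trie_index v = trie_index w \<longleftrightarrow> v = w"
proof
  assume "trie_index v = trie_index w"
  then show "v = w"
  proof (induction v arbitrary: w rule: rev_induct)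
    case Nil
    then show ?case by (cases w rule: rev_cases) auto
  next
    case (snoc b v)
    show ?case
    proof (cases w rule: rev_cases)
      case Nil
      with snoc.prems show ?thesis by simp
    next
      case (snoc w' c)
      have eq: "2 * trie_index v + of_bool b = 2 * trie_index w' + (of_bool c :: nat)"
        using snoc.prems snoc by simp
      have "b = c"
      proof -
        have "even (2 * trie_index v + of_bool b) = even (2 * trie_index w' + (of_bool c :: nat))"
          using eq by simp
        then show ?thesis by (cases b; cases c) simp_all
      qed
      with eq snoc.IH[of w'] snoc show ?thesis by simp
    qed
  qed
qed simp

text \<open>Children have larger numbers than their parents. So the words numbered below a bound are
  closed under prefixes, which lets them serve as the control states of a machine.\<close>

lemma trie_index_take_mono: "i \<le> j \<Longrightarrow> trie_index (take i w) \<le> trie_index (take j w)"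
proof (induction j rule: dec_induct)
  case (step j)
  show ?case
  proof (cases "j < length w")
    case True
    then have "trie_index (take j w) \<le> trie_index (take (Suc j) w)"
      by (simp add: take_Suc_conv_app_nth)
    with step show ?thesis by linarith
  next
    case False
    with step show ?thesis by simp
  qed
qed simp

lemma finite_imp_decidable:
  assumes "finite L"
  shows "decidable L"
proof -
  \<comment> \<open>\<open>N > 0\<close> makes the start state \<open>0\<close>, the index of the
    empty word, a proper control state even when \<open>L\<close> is empty.\<close>
  obtain N where N: "N > 0" "\<And>w. w \<in> L \<Longrightarrow> trie_index w < N"
  proof -
    have "\<forall>w\<in>L. trie_index w < Suc (Max (trie_index ` L))"
      using assms by (simp add: less_Suc_eq_le)
    then show ?thesis using that[of "Suc (Max (trie_index ` L))"] by blast
  qed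
  \<comment> \<open>A bit leads to the child node, the blank decides membership of the node reached.
    A child numbered \<open>N\<close> or more lies outside of \<open>L\<close> together with all its
    descendants, so it is rejected at once. Every cell keeps its symbol.\<close>
  define \<delta> :: tm_table where "\<delta> = (\<lambda>q a. case a of
      None \<Rightarrow> (if q \<in> trie_index ` L then N else Suc N, None, MoveRight)
    | Some b \<Rightarrow> (if 2 * q + 1 + of_bool b < N then 2 * q + 1 + of_bool b else Suc N, a, MoveRight))"
  have "\<exists>s. fst ((tm_step N \<delta> ^^ s) (tm_init w)) = (if w \<in> L then N else Suc N)" for w
  proof -
    define t :: "int \<Rightarrow> bool option"
      where "t = (\<lambda>i. if 0 \<le> i \<and> i < int (length w) then Some (w ! nat i) else None)"
    have step: "tm_step N \<delta> (trie_index (take i w), int i, t) =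
        (if trie_index (take (Suc i) w) < N then trie_index (take (Suc i) w) else Suc N,
         int (Suc i), t)"
      if "i < length w" "trie_index (take i w) < N" for i
    proof -
      have "t (int i) = Some (w ! i)" using that by (simp add: t_def)
      moreover from this have "t(int i := Some (w ! i)) = t" by (metis fun_upd_triv)
      ultimately show ?thesis
        using that by (simp add: tm_step_def \<delta>_def take_Suc_conv_app_nth)
    qed
    have run: "(tm_step N \<delta> ^^ i) (tm_init w) = (trie_index (take i w), int i, t)"
      if "i \<le> length w" "trie_index (take i w) < N" for i
      using that
    proof (induction i)
      case 0
      then show ?case by (simp add: tm_init_def t_def)
    next
      case (Suc i)
      have "trie_index (take i w) < N"
        using Suc.prems trie_index_take_mono[of i "Suc i" w] by linarith
      with Suc show ?case by (simp add: step)
    qed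
    show ?thesis
    proof (cases "trie_index w < N")
      case True
      have "t (int (length w)) = None" by (simp add: t_def)
      with True run[of "length w"]
      have "fst ((tm_step N \<delta> ^^ Suc (length w)) (tm_init w)) =
          (if trie_index w \<in> trie_index ` L then N else Suc N)"
        by (simp add: tm_step_def \<delta>_def)
      also have "trie_index w \<in> trie_index ` L \<longleftrightarrow> w \<in> L"
        by (auto simp: trie_index_inject image_iff)
      finally show ?thesis by blast
    next
      case False
      then have "w \<notin> L" using N by blast
      define P where "P i \<longleftrightarrow> trie_index (take i w) \<ge> N" for i
      have "\<not> P 0" "P (length w)" using N False by (simp_all add: P_def)
      \<comment> \<open>The crossing point: the prefix of length \<open>i\<close> is still numbered
        below \<open>N\<close>, one more bit is too much, and this bit sends the machine to
        \<open>Suc N\<close>.\<close>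
      then obtain i where i: "i < length w" "\<not> P i" "P (Suc i)"
        using ex_least_nat_less[of P "length w"] by auto
      then have "fst ((tm_step N \<delta> ^^ Suc i) (tm_init w)) = Suc N"
        using run[of i] step[of i] by (simp add: P_def)
      with \<open>w \<notin> L\<close> show ?thesis by metis
    qed
  qed
  then show ?thesis unfolding decidable_def by blast
qed


section \<open>Dynamic programming cores from equivariant finite-state systems\<close>

text \<open>Strings of one fixed length, the rounded-up logarithm of the cardinality, are already
  numerous enough. Rounding up costs the \<open>+ 1\<close>.\<close>

lemma ex_short_encoding:
  assumes "finite X" "X \<noteq> {}"
  shows "\<exists>e :: 'a \<Rightarrow> bool list. inj_on e X \<and> (\<forall>s \<in> X. real (length (e s)) \<le> log 2 (real (card X)) + 1)"
proof -
  define n where "n = nat \<lceil>log 2 (real (card X))\<rceil>"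
  define Y where "Y = {w :: bool list. set w \<subseteq> UNIV \<and> length w = n}"
  have pos: "card X > 0" using assms by (simp add: card_gt_0_iff)
  then have log0: "log 2 (real (card X)) \<ge> 0" by simp
  have "real (card X) = 2 powr log 2 (real (card X))" using pos by simp
  also have "\<dots> \<le> 2 powr real n"
    unfolding n_def using log0 by (intro powr_mono) (auto simp: le_nat_iff)
  finally have "real (card X) \<le> real (2 ^ n)" by (simp add: powr_realpow)
  then have "card X \<le> card Y"
    unfolding Y_def of_nat_le_iff by (subst card_lists_length_eq) auto
  moreover have "finite Y" unfolding Y_def by (rule finite_lists_length_eq) simp
  ultimately obtain e where e: "inj_on e X" "e ` X \<subseteq> Y"
    using assms card_le_inj[of X Y] by blast
  have "real n \<le> log 2 (real (card X)) + 1"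
    unfolding n_def using log0 by linarith
  with e show ?thesis unfolding Y_def by blast
qed

text \<open>Domain and image of \<open>f\<close> have the same size, hence so have their complements
  in \<open>{1..k+1}\<close>; any bijection between the complements completes
  \<open>f\<close>.\<close>

lemma partial_injection_extends:
  assumes "f \<in> partial_injections k"
  shows "\<exists>\<pi>. \<pi> permutes {1..k+1} \<and> (\<forall>u \<in> dom f. f u = Some (\<pi> u))"
proof -
  define A where "A = {1..k+1}"
  define g where "g u = the (f u)" for u
  have dom: "dom f \<subseteq> A" and ran: "g ` dom f \<subseteq> A"
    using assms by (auto simp: partial_injections_def A_def g_def ran_def)
  have inj: "inj_on g (dom f)"
    using assms by (auto simp: partial_injections_def g_def inj_on_def dom_def)
  have fin: "finite A" "finite (dom f)" using dom by (auto simp: A_def intro: finite_subset)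
  have "card (A - dom f) = card (A - g ` dom f)"
    using dom ran fin by (simp add: card_Diff_subset card_image inj)
  then obtain h where h: "bij_betw h (A - dom f) (A - g ` dom f)"
    using fin finite_same_card_bij[of "A - dom f" "A - g ` dom f"] by blast
  define \<pi> where "\<pi> u = (if u \<in> dom f then g u else if u \<in> A then h u else u)" for u
  have "bij_betw \<pi> (dom f) (g ` dom f)"
    using inj by (auto simp: bij_betw_def \<pi>_def inj_on_def)
  moreover have "bij_betw \<pi> (A - dom f) (A - g ` dom f)"
    using h by (subst bij_betw_cong[of _ _ h]) (auto simp: \<pi>_def)
  ultimately have "bij_betw \<pi> (dom f \<union> (A - dom f)) (g ` dom f \<union> (A - g ` dom f))"
    by (rule bij_betw_combine) blast
  then have "bij_betw \<pi> A A" using dom ran by (simp add: Un_absorb1)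
  moreover have "\<pi> u = u" if "u \<notin> A" for u using that dom by (auto simp: \<pi>_def)
  ultimately have "\<pi> permutes A" by (rule bij_imp_permutes)
  then show ?thesis unfolding A_def by (intro exI[of _ \<pi>]) (auto simp: \<pi>_def g_def)
qed

lemma inv_map_Some:
  assumes "f \<in> partial_injections k" "f u = Some v"
  shows "inv_map f v = Some u"
proof -
  have "(THE x. f x = Some v) = u"
    using assms by (intro the_equality) (auto simp: partial_injections_def inj_on_def dom_def)
  with assms show ?thesis by (auto simp: inv_map_def ran_def)
qed

lemma inv_map_partial_injections:
  assumes "f \<in> partial_injections k"
  shows "inv_map f \<in> partial_injections k"
proof -
  have *: "\<exists>u. inv_map f v = Some u \<and> f u = Some v" if "v \<in> ran f" for v
    using that inv_map_Some[OF assms] by (auto simp: ran_def)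
  have dom: "dom (inv_map f) = ran f" by (auto simp: inv_map_def dom_def)
  have "ran (inv_map f) \<subseteq> dom f"
    using * dom by (force simp: ran_def)
  moreover have "inj_on (inv_map f) (dom (inv_map f))"
    unfolding dom using * by (metis inj_onI option.inject)
  ultimately show ?thesis using assms dom by (auto simp: partial_injections_def)
qed

lemma map_comp_partial_injections:
  assumes "f \<in> partial_injections k" "g \<in> partial_injections k"
  shows "f \<circ>\<^sub>m g \<in> partial_injections k"
proof -
  have *: "\<exists>y. g x = Some y \<and> f y = Some z" if "(f \<circ>\<^sub>m g) x = Some z" for x z
    using that by (auto simp: map_comp_def split: option.splits)
  have "dom (f \<circ>\<^sub>m g) \<subseteq> dom g" "ran (f \<circ>\<^sub>m g) \<subseteq> ran f"
    using * by (fastforce simp: ran_def dom_def)+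
  moreover have "inj_on (f \<circ>\<^sub>m g) (dom (f \<circ>\<^sub>m g))"
  proof (rule inj_onI)
    fix x x' assume "x \<in> dom (f \<circ>\<^sub>m g)" "(f \<circ>\<^sub>m g) x = (f \<circ>\<^sub>m g) x'"
    then obtain y y' z where "g x = Some y" "f y = Some z" "g x' = Some y'" "f y' = Some z"
      using * by (metis domD)
    then show "x = x'"
      using assms unfolding partial_injections_def inj_on_def
      by (metis (mono_tags, lifting) domI mem_Collect_eq)
  qed
  ultimately show ?thesis using assms unfolding partial_injections_def by blast
qed

text \<open>Only the state space depends on \<open>k\<close>; support, action, finality and
  transitions are uniform in it. The laws of the action are restricted to bijections because an
  action may be defined through inverses. \<open>act_cong\<close> expresses that a permutation
  matters only through its values on the support, which is what makes the action of a partial map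
  independent of how it is extended.\<close>

locale equivariant_system =
  fixes X :: "nat \<Rightarrow> 's set"
    and supp :: "'s \<Rightarrow> nat set"
    and act :: "(nat \<Rightarrow> nat) \<Rightarrow> 's \<Rightarrow> 's"
    and final :: "'s \<Rightarrow> bool"
    and leaf :: 's
    and introv forgetv :: "nat \<Rightarrow> 's \<Rightarrow> 's set"
    and introe :: "nat \<Rightarrow> nat \<Rightarrow> 's \<Rightarrow> 's set"
    and join :: "'s \<Rightarrow> 's \<Rightarrow> 's set"
  assumes finite_X: "finite (X k)"
    and leaf_X: "leaf \<in> X k"
    and introv_X: "s \<in> X k \<Longrightarrow> u \<in> {1..k+1} \<Longrightarrow> introv u s \<subseteq> X k"
    and forgetv_X: "s \<in> X k \<Longrightarrow> u \<in> {1..k+1} \<Longrightarrow> forgetv u s \<subseteq> X k"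
    and introe_X: "s \<in> X k \<Longrightarrow> u \<in> {1..k+1} \<Longrightarrow> v \<in> {1..k+1} \<Longrightarrow> u \<noteq> v \<Longrightarrow> introe u v s \<subseteq> X k"
    and join_X: "s \<in> X k \<Longrightarrow> s' \<in> X k \<Longrightarrow> join s s' \<subseteq> X k"
    and supp_X: "s \<in> X k \<Longrightarrow> supp s \<subseteq> {1..k+1}"
    and supp_leaf: "supp leaf = {}"
    and supp_introv: "s' \<in> introv u s \<Longrightarrow> supp s' \<subseteq> insert u (supp s)"
    and supp_forgetv: "s' \<in> forgetv u s \<Longrightarrow> supp s' \<subseteq> supp s - {u}"
    and supp_introe: "s' \<in> introe u v s \<Longrightarrow> supp s' \<subseteq> supp s \<union> {u, v}"
    and supp_join: "t \<in> join s s' \<Longrightarrow> supp t \<subseteq> supp s \<union> supp s'"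
    and act_X: "s \<in> X k \<Longrightarrow> \<pi> permutes {1..k+1} \<Longrightarrow> act \<pi> s \<in> X k"
    and act_id: "act id s = s"
    and act_comp: "bij \<pi> \<Longrightarrow> bij \<sigma> \<Longrightarrow> act (\<pi> \<circ> \<sigma>) s = act \<pi> (act \<sigma> s)"
    and act_cong: "bij \<pi> \<Longrightarrow> bij \<sigma> \<Longrightarrow> (\<And>u. u \<in> supp s \<Longrightarrow> \<pi> u = \<sigma> u) \<Longrightarrow> act \<pi> s = act \<sigma> s"
    and supp_act: "bij \<pi> \<Longrightarrow> supp (act \<pi> s) = \<pi> ` supp s"
    and final_act: "bij \<pi> \<Longrightarrow> final (act \<pi> s) = final s"
    and introv_act: "bij \<pi> \<Longrightarrow> introv (\<pi> u) (act \<pi> s) = act \<pi> ` introv u s"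
    and forgetv_act: "bij \<pi> \<Longrightarrow> forgetv (\<pi> u) (act \<pi> s) = act \<pi> ` forgetv u s"
    and introe_act: "bij \<pi> \<Longrightarrow> introe (\<pi> u) (\<pi> v) (act \<pi> s) = act \<pi> ` introe u v s"
    and join_act: "bij \<pi> \<Longrightarrow> join (act \<pi> s) (act \<pi> s') = act \<pi> ` join s s'"
begin

definition enc :: "nat \<Rightarrow> 's \<Rightarrow> bool list" where
  "enc k = (SOME e. inj_on e (X k) \<and>
     (\<forall>s \<in> X k. real (length (e s)) \<le> log 2 (real (card (X k))) + 1))"

definition dec :: "nat \<Rightarrow> bool list \<Rightarrow> 's" where
  "dec k = inv_into (X k) (enc k)"

definition core :: dp_core where
  "core k = \<lparr>Wit = enc k ` X k,
     Final = (\<lambda>w. final (dec k w)),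
     LeafW = {enc k leaf},
     IntroVertexW = (\<lambda>u w. enc k ` introv u (dec k w)),
     ForgetVertexW = (\<lambda>u w. enc k ` forgetv u (dec k w)),
     IntroEdgeW = (\<lambda>u v w. enc k ` introe u v (dec k w)),
     JoinW = (\<lambda>w w'. enc k ` join (dec k w) (dec k w')),
     Clean = (\<lambda>S. S),
     Inv = (\<lambda>S. []),
     Lbl = (\<lambda>w. supp (dec k w))\<rparr>"

text \<open>The dynamization before encoding. Neither bit strings nor \<open>k\<close> occur in it,
  so each system is analysed once for all widths.\<close>

primrec states :: "instr \<Rightarrow> 's set" where
  "states Leaf = {leaf}"
| "states (IntroVertex u t) = (\<Union>s \<in> states t. introv u s)"
| "states (ForgetVertex u t) = (\<Union>s \<in> states t. forgetv u s)"
| "states (IntroEdge u v t) = (\<Union>s \<in> states t. introe u v s)"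
| "states (Join t t') = (\<Union>s \<in> states t. \<Union>s' \<in> states t'. join s s')"

lemma enc: "inj_on (enc k) (X k)" "s \<in> X k \<Longrightarrow> real (length (enc k s)) \<le> log 2 (real (card (X k))) + 1"
proof -
  have "\<exists>e :: 's \<Rightarrow> bool list. inj_on e (X k) \<and>
      (\<forall>s \<in> X k. real (length (e s)) \<le> log 2 (real (card (X k))) + 1)"
    using finite_X leaf_X by (intro ex_short_encoding) auto
  from someI_ex[OF this] show "inj_on (enc k) (X k)"
    "s \<in> X k \<Longrightarrow> real (length (enc k s)) \<le> log 2 (real (card (X k))) + 1"
    unfolding enc_def by blast+
qed

lemma dec_enc [simp]: "s \<in> X k \<Longrightarrow> dec k (enc k s) = s"
  unfolding dec_def by (rule inv_into_f_f[OF enc(1)])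

lemma fin_subsets_Wit_core:
  "S \<in> fin_subsets (Wit (core k)) \<longleftrightarrow> (\<exists>T \<subseteq> X k. S = enc k ` T)"
  unfolding fin_subsets_def core_def
  by (auto simp: subset_image_iff intro: finite_subset[OF _ finite_X])

text \<open>Decoding inverts encoding only on \<open>X k\<close>, hence the inclusions. Under them,
  every lifted operation on an encoded set is the encoding of the operation on states, and arguments
  about witnesses can be moved to states.\<close>

lemma core_simps:
  assumes "T \<subseteq> X k"
  shows "lift (IntroVertexW (core k) u) (enc k ` T) = enc k ` (\<Union>s \<in> T. introv u s)"
    and "lift (ForgetVertexW (core k) u) (enc k ` T) = enc k ` (\<Union>s \<in> T. forgetv u s)"
    and "lift (IntroEdgeW (core k) u v) (enc k ` T) = enc k ` (\<Union>s \<in> T. introe u v s)"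
    and "T' \<subseteq> X k \<Longrightarrow> lift2 (JoinW (core k)) (enc k ` T) (enc k ` T') =
      enc k ` (\<Union>s \<in> T. \<Union>s' \<in> T'. join s s')"
    and "lbl_set (core k) (enc k ` T) = (\<Union>s \<in> T. supp s)"
  using assms by (simp_all add: lift_def lift2_def lbl_set_def core_def image_UN subset_iff)

lemma Clean_core [simp]: "Clean (core k) S = S"
  by (simp add: core_def)

lemma is_dp_core_core: "is_dp_core core"
  unfolding is_dp_core_def
proof (intro allI conjI ballI impI)
  fix k
  show "decidable (Wit (core k))"
    by (rule finite_imp_decidable) (simp add: core_def finite_X)
  show "LeafW (core k) \<in> fin_subsets (Wit (core k))"
    by (simp add: fin_subsets_def core_def leaf_X)
  fix w assume "w \<in> Wit (core k)"
  then obtain s where s: "s \<in> X k" "w = enc k s" by (auto simp: core_def)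
  show "Lbl (core k) w \<subseteq> {1..k+1}" using supp_X s by (simp add: core_def)
  fix u assume u: "u \<in> {1..k+1}"
  show "IntroVertexW (core k) u w \<in> fin_subsets (Wit (core k))"
    unfolding fin_subsets_Wit_core using introv_X[OF s(1) u] s by (auto simp: core_def)
  show "ForgetVertexW (core k) u w \<in> fin_subsets (Wit (core k))"
    unfolding fin_subsets_Wit_core using forgetv_X[OF s(1) u] s by (auto simp: core_def)
  fix v assume v: "v \<in> {1..k+1}" "u \<noteq> v"
  show "IntroEdgeW (core k) u v w \<in> fin_subsets (Wit (core k))"
    unfolding fin_subsets_Wit_core using introe_X[OF s(1) u v] s by (auto simp: core_def)
next
  fix k w w' assume "w \<in> Wit (core k)" "w' \<in> Wit (core k)"
  then obtain s s' where s: "s \<in> X k" "w = enc k s" "s' \<in> X k" "w' = enc k s'"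
    by (auto simp: core_def)
  show "JoinW (core k) w w' \<in> fin_subsets (Wit (core k))"
    unfolding fin_subsets_Wit_core using join_X[OF s(1) s(3)] s by (auto simp: core_def)
qed simp

lemma finite_core_core: "finite_core core"
  by (simp add: finite_core_def core_def finite_X)

lemma bit_length_core:
  assumes "\<And>k. k \<ge> 1 \<Longrightarrow> log 2 (real (card (X k))) + 1 \<le> g k"
  shows "bit_length_le core g"
  unfolding bit_length_le_def using assms enc(2) by (fastforce simp: core_def)

lemma states_closed:
  assumes "T \<subseteq> X k"
  shows "u \<in> {1..k+1} \<Longrightarrow> (\<Union>s \<in> T. introv u s) \<subseteq> X k"
    and "u \<in> {1..k+1} \<Longrightarrow> (\<Union>s \<in> T. forgetv u s) \<subseteq> X k"
    and "u \<in> {1..k+1} \<Longrightarrow> v \<in> {1..k+1} \<Longrightarrow> u \<noteq> v \<Longrightarrow> (\<Union>s \<in> T. introe u v s) \<subseteq> X k"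
    and "T' \<subseteq> X k \<Longrightarrow> (\<Union>s \<in> T. \<Union>s' \<in> T'. join s s') \<subseteq> X k"
proof -
  show "u \<in> {1..k+1} \<Longrightarrow> (\<Union>s \<in> T. introv u s) \<subseteq> X k"
    using introv_X assms by blast
  show "u \<in> {1..k+1} \<Longrightarrow> (\<Union>s \<in> T. forgetv u s) \<subseteq> X k"
    using forgetv_X assms by blast
  show "u \<in> {1..k+1} \<Longrightarrow> v \<in> {1..k+1} \<Longrightarrow> u \<noteq> v \<Longrightarrow> (\<Union>s \<in> T. introe u v s) \<subseteq> X k"
    using introe_X assms by blast
  show "T' \<subseteq> X k \<Longrightarrow> (\<Union>s \<in> T. \<Union>s' \<in> T'. join s s') \<subseteq> X k"
    using join_X assms by blast
qed

lemma interface_respecting_core: "interface_respecting core"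
  unfolding interface_respecting_def
proof (intro allI conjI impI ballI)
  fix k
  show "lbl_set (core k) (LeafW (core k)) = {}"
    by (simp add: lbl_set_def core_def leaf_X supp_leaf)
  fix b S assume b: "b \<subseteq> {1..k+1}" "S \<in> fin_subsets (Wit (core k))" "lbl_set (core k) S \<subseteq> b"
  then obtain T where T: "T \<subseteq> X k" "S = enc k ` T" by (auto simp: fin_subsets_Wit_core)
  then have suppT: "supp s \<subseteq> b" if "s \<in> T" for s
    using b that by (auto simp: core_simps(5))
  show "lbl_set (core k) (Clean (core k) S) \<subseteq> b" using b by simp
  show "lbl_set (core k) (lift (IntroVertexW (core k) u) S) \<subseteq> b \<union> {u}"
    if "u \<in> {1..k+1}" for u
    using T that suppT supp_introv
    by (simp add: core_simps states_closed del: One_nat_def UN_simps) blast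
  show "lbl_set (core k) (lift (ForgetVertexW (core k) u) S) \<subseteq> b - {u}" if "u \<in> b" for u
  proof -
    have "u \<in> {1..k+1}" using that b by blast
    with T suppT supp_forgetv show ?thesis
      by (simp add: core_simps states_closed del: One_nat_def UN_simps) blast
  qed
  show "lbl_set (core k) (lift (IntroEdgeW (core k) u v) S) \<subseteq> b"
    if "u \<in> b" "v \<in> b" "u \<noteq> v" for u v
  proof -
    have "u \<in> {1..k+1}" "v \<in> {1..k+1}" using that b by blast+
    with T suppT supp_introe that show ?thesis
      by (simp add: core_simps states_closed del: One_nat_def UN_simps) blast
  qed
  fix S' assume "S' \<in> fin_subsets (Wit (core k))" "lbl_set (core k) S' \<subseteq> b"
  then obtain T' where T': "T' \<subseteq> X k" "S' = enc k ` T'"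
    by (auto simp: fin_subsets_Wit_core)
  then have "supp s \<subseteq> b" if "s \<in> T'" for s
    using \<open>lbl_set (core k) S' \<subseteq> b\<close> that by (auto simp: core_simps(5))
  with T T' suppT supp_join show "lbl_set (core k) (lift2 (JoinW (core k)) S S') \<subseteq> b"
    by (simp add: core_simps states_closed del: One_nat_def UN_simps) blast
qed

text \<open>Inclusion and equation go through the induction together: rewriting the operation at the
  root requires the states of the subterms to lie in \<open>X k\<close>.\<close>

lemma states_X_dyn:
  assumes "legal k t"
  shows "states t \<subseteq> X k \<and> dyn (core k) t = enc k ` states t"
  using assms
proof (induction t)
  case Leaf
  then show ?case by (simp add: leaf_X) (simp add: core_def)
qed (simp_all add: core_simps states_closed del: One_nat_def UN_simps)

lemma accepts_core: "legal k t \<Longrightarrow> accepts (core k) t \<longleftrightarrow> (\<exists>s \<in> states t. final s)"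
  using states_X_dyn[of k t] by (auto simp: accepts_def) (auto simp: core_def subset_iff)

section \<open>The action of partial injections on witnesses\<close>

definition extension :: "nat \<Rightarrow> (nat \<rightharpoonup> nat) \<Rightarrow> nat \<Rightarrow> nat" where
  "extension k f = (SOME \<pi>. \<pi> permutes {1..k+1} \<and> (\<forall>u \<in> dom f. f u = Some (\<pi> u)))"

definition relabel :: "nat \<Rightarrow> (nat \<rightharpoonup> nat) \<Rightarrow> bool list \<rightharpoonup> bool list" where
  "relabel k f w =
     (if supp (dec k w) \<subseteq> dom f then Some (enc k (act (extension k f) (dec k w))) else None)"

lemma extension:
  assumes "f \<in> partial_injections k"
  shows "extension k f permutes {1..k+1}" "u \<in> dom f \<Longrightarrow> f u = Some (extension k f u)"
  using someI_ex[OF partial_injection_extends[OF assms]] unfolding extension_def by blast+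

text \<open>The arbitrary choice of an extension is eliminated here: any permutation that agrees
  with \<open>f\<close> on the support computes the relabeling. The laws for inverse, composition
  and extension then follow by exhibiting a convenient permutation.\<close>

lemma relabel_enc:
  assumes "f \<in> partial_injections k" "s \<in> X k" "\<pi> permutes {1..k+1}"
    and "\<And>u. u \<in> supp s \<Longrightarrow> f u = Some (\<pi> u)"
  shows "relabel k f (enc k s) = Some (enc k (act \<pi> s))"
proof -
  have "act (extension k f) s = act \<pi> s"
  proof (rule act_cong)
    fix u assume "u \<in> supp s"
    with assms(4) have "f u = Some (\<pi> u)" by blast
    then show "extension k f u = \<pi> u" using extension(2)[OF assms(1), of u] by (simp add: domI)
  qed (use assms extension permutes_bij in blast)+
  moreover have "supp s \<subseteq> dom f" using assms(4) by blast
  ultimately show ?thesis using assms by (simp add: relabel_def)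
qed

lemma act_set_relabel:
  assumes f: "f \<in> partial_injections k" and T: "T \<subseteq> X k" and "(\<Union>s \<in> T. supp s) \<subseteq> dom f"
  shows "act_set (relabel k) f (enc k ` T) = enc k ` act (extension k f) ` T"
proof -
  have "relabel k f (enc k s) = Some (enc k (act (extension k f) s))" if "s \<in> T" for s
    using assms that extension[OF f] by (intro relabel_enc) auto
  then show ?thesis by (auto simp: act_set_def)
qed

text \<open>A single permutation extending \<open>f\<close> relabels all arguments and all results,
  so each law is an equivariance equation applied elementwise. The condition on the labels of the
  result ensures that relabeling is defined on every element of it.\<close>

lemma action_commutes_relabel:
  assumes f: "f \<in> partial_injections k"
  shows "action_commutes (core k) (relabel k) f"
proof -
  define \<pi> where "\<pi> = extension k f"
  have \<pi>: "\<pi> permutes {1..k+1}" "\<And>u. u \<in> dom f \<Longrightarrow> f u = Some (\<pi> u)"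
    using extension[OF f] by (auto simp: \<pi>_def)
  have bij: "bij \<pi>" using \<pi> permutes_bij by blast
  have dom: "u \<in> {1..k+1}" if "u \<in> dom f" for u
    using that f unfolding partial_injections_def by blast
  have the: "the (f u) = \<pi> u" if "u \<in> dom f" for u using that \<pi> by simp
  have actX: "act \<pi> ` T \<subseteq> X k" if "T \<subseteq> X k" for T using act_X \<pi> that by blast
  note relabel = act_set_relabel[OF f, folded \<pi>_def]
  show ?thesis
    unfolding action_commutes_def
  proof (intro allI conjI impI ballI)
    fix S assume "S \<in> fin_subsets (Wit (core k))" and lS: "lbl_set (core k) S \<subseteq> dom f"
    then obtain T where T: "T \<subseteq> X k" "S = enc k ` T" by (auto simp: fin_subsets_Wit_core)
    have lT: "(\<Union>s \<in> T. supp s) \<subseteq> dom f" using lS T by (simp add: core_simps)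
    show "act_set (relabel k) f (Clean (core k) S) = Clean (core k) (act_set (relabel k) f S)"
      by simp
    show "act_set (relabel k) f (lift (IntroVertexW (core k) u) S) =
        lift (IntroVertexW (core k) (the (f u))) (act_set (relabel k) f S)"
      if u: "u \<in> dom f" and l: "lbl_set (core k) (lift (IntroVertexW (core k) u) S) \<subseteq> dom f" for u
    proof -
      have c: "(\<Union>s \<in> T. introv u s) \<subseteq> X k" using states_closed(1)[OF T(1) dom[OF u]] .
      from l have l': "(\<Union>s \<in> (\<Union>s \<in> T. introv u s). supp s) \<subseteq> dom f"
        unfolding T(2) core_simps(1)[OF T(1)] core_simps(5)[OF c] .
      show ?thesis
        unfolding T(2) core_simps(1)[OF T(1)] relabel[OF T(1) lT] relabel[OF c l'] the[OF u]
          core_simps(1)[OF actX[OF T(1)]]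
        by (simp add: introv_act bij image_UN)
    qed
    show "act_set (relabel k) f (lift (ForgetVertexW (core k) u) S) =
        lift (ForgetVertexW (core k) (the (f u))) (act_set (relabel k) f S)"
      if u: "u \<in> dom f" and l: "lbl_set (core k) (lift (ForgetVertexW (core k) u) S) \<subseteq> dom f" for u
    proof -
      have c: "(\<Union>s \<in> T. forgetv u s) \<subseteq> X k" using states_closed(2)[OF T(1) dom[OF u]] .
      from l have l': "(\<Union>s \<in> (\<Union>s \<in> T. forgetv u s). supp s) \<subseteq> dom f"
        unfolding T(2) core_simps(2)[OF T(1)] core_simps(5)[OF c] .
      show ?thesis
        unfolding T(2) core_simps(2)[OF T(1)] relabel[OF T(1) lT] relabel[OF c l'] the[OF u]
          core_simps(2)[OF actX[OF T(1)]]
        by (simp add: forgetv_act bij image_UN)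
    qed
    show "act_set (relabel k) f (lift (IntroEdgeW (core k) u v) S) =
        lift (IntroEdgeW (core k) (the (f u)) (the (f v))) (act_set (relabel k) f S)"
      if u: "u \<in> dom f" and v: "v \<in> dom f" "u \<noteq> v"
        and l: "lbl_set (core k) (lift (IntroEdgeW (core k) u v) S) \<subseteq> dom f" for u v
    proof -
      have c: "(\<Union>s \<in> T. introe u v s) \<subseteq> X k"
        using states_closed(3)[OF T(1) dom[OF u] dom[OF v(1)] v(2)] .
      from l have l': "(\<Union>s \<in> (\<Union>s \<in> T. introe u v s). supp s) \<subseteq> dom f"
        unfolding T(2) core_simps(3)[OF T(1)] core_simps(5)[OF c] .
      show ?thesis
        unfolding T(2) core_simps(3)[OF T(1)] relabel[OF T(1) lT] relabel[OF c l'] the[OF u]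
          the[OF v(1)] core_simps(3)[OF actX[OF T(1)]]
        by (simp add: introe_act bij image_UN)
    qed
    fix S' assume "S' \<in> fin_subsets (Wit (core k))" and lS': "lbl_set (core k) S' \<subseteq> dom f"
      and l: "lbl_set (core k) (lift2 (JoinW (core k)) S S') \<subseteq> dom f"
    then obtain T' where T': "T' \<subseteq> X k" "S' = enc k ` T'" by (auto simp: fin_subsets_Wit_core)
    have lT': "(\<Union>s \<in> T'. supp s) \<subseteq> dom f" using lS' T' by (simp add: core_simps)
    have c: "(\<Union>s \<in> T. \<Union>s' \<in> T'. join s s') \<subseteq> X k" using states_closed(4)[OF T(1) T'(1)] .
    from l have l': "(\<Union>s \<in> (\<Union>s \<in> T. \<Union>s' \<in> T'. join s s'). supp s) \<subseteq> dom f"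
      unfolding T(2) T'(2) core_simps(4)[OF T(1) T'(1)] core_simps(5)[OF c] .
    show "act_set (relabel k) f (lift2 (JoinW (core k)) S S') =
        lift2 (JoinW (core k)) (act_set (relabel k) f S) (act_set (relabel k) f S')"
      unfolding T(2) T'(2) core_simps(4)[OF T(1) T'(1)] relabel[OF T(1) lT] relabel[OF T'(1) lT']
        relabel[OF c l'] core_simps(4)[OF actX[OF T(1)] actX[OF T'(1)]]
      by (simp add: join_act bij image_UN)
  qed
qed

lemma witness_action_relabel: "witness_action k (core k) (relabel k)"
  unfolding witness_action_def
proof (intro conjI ballI allI impI)
  fix f w assume f: "f \<in> partial_injections k" and w: "w \<in> Wit (core k)"
  obtain s where s: "s \<in> X k" "w = enc k s" using w by (auto simp: core_def)
  define \<pi> where "\<pi> = extension k f"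
  have \<pi>: "\<pi> permutes {1..k+1}" "\<And>u. u \<in> dom f \<Longrightarrow> f u = Some (\<pi> u)"
    using extension[OF f] by (auto simp: \<pi>_def)
  have bij: "bij \<pi>" using \<pi> permutes_bij by blast
  show "relabel k f w \<noteq> None \<longleftrightarrow> Lbl (core k) w \<subseteq> dom f"
    by (simp add: relabel_def core_def)
  fix w' assume w': "relabel k f w = Some w'"
  then have dom: "supp s \<subseteq> dom f" and w': "w' = enc k (act \<pi> s)"
    using s by (auto simp: relabel_def \<pi>_def split: if_splits)
  have actX: "act \<pi> s \<in> X k" using act_X s \<pi> by blast
  with w' show "w' \<in> Wit (core k)" by (simp add: core_def)
  show "Final (core k) w' = Final (core k) w"
    using w' actX s by (simp add: core_def final_act bij)
  have "\<pi> u = the (f u)" if "u \<in> supp s" for u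
    using \<pi>(2)[of u] dom that by (metis option.sel subsetD)
  then have "\<pi> ` supp s = (\<lambda>u. the (f u)) ` supp s" by (intro image_cong) simp_all
  then show "Lbl (core k) w' = (\<lambda>u. the (f u)) ` Lbl (core k) w"
    using w' actX s by (simp add: core_def supp_act bij)
  \<comment> \<open>On the support of the relabeled state, \<open>inv_map f\<close> agrees with
    \<open>inv \<pi>\<close>.\<close>
  have "relabel k (inv_map f) w' = Some (enc k (act (inv \<pi>) (act \<pi> s)))"
    unfolding w'
  proof (rule relabel_enc)
    show "inv_map f \<in> partial_injections k" by (rule inv_map_partial_injections[OF f])
    show "inv \<pi> permutes {1..k+1}" using \<pi> by (simp add: permutes_inv)
    fix v assume "v \<in> supp (act \<pi> s)"
    then obtain u where u: "u \<in> supp s" "v = \<pi> u" by (auto simp: supp_act bij)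
    then have "inv_map f v = Some u" using dom \<pi>(2) by (intro inv_map_Some[OF f]) blast
    with u show "inv_map f v = Some (inv \<pi> v)" using bij by (simp add: bij_is_inj)
  qed (use actX in simp)
  also have "act (inv \<pi>) (act \<pi> s) = s"
    using bij by (simp flip: act_comp add: bij_imp_bij_inv bij_is_inj act_id)
  finally show "relabel k (inv_map f) w' = Some w" using s by simp
next
  fix f g w
  assume f: "f \<in> partial_injections k" and g: "g \<in> partial_injections k" and w: "w \<in> Wit (core k)"
  obtain s where s: "s \<in> X k" "w = enc k s" using w by (auto simp: core_def)
  define \<pi> \<sigma> where "\<pi> = extension k f" and "\<sigma> = extension k g"
  have \<pi>: "\<pi> permutes {1..k+1}" "\<And>u. u \<in> dom f \<Longrightarrow> f u = Some (\<pi> u)"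
    using extension[OF f] by (auto simp: \<pi>_def)
  have \<sigma>: "\<sigma> permutes {1..k+1}" "\<And>u. u \<in> dom g \<Longrightarrow> g u = Some (\<sigma> u)"
    using extension[OF g] by (auto simp: \<sigma>_def)
  have bij: "bij \<pi>" "bij \<sigma>" using \<pi> \<sigma> permutes_bij by blast+
  have actX: "act \<sigma> s \<in> X k" using act_X s \<sigma> by blast
  show "relabel k (f \<circ>\<^sub>m g) w = Option.bind (relabel k g w) (relabel k f)"
  proof (cases "supp s \<subseteq> dom (f \<circ>\<^sub>m g)")
    case True
    then have sg: "u \<in> dom g" "\<sigma> u \<in> dom f" if "u \<in> supp s" for u
    proof -
      have "u \<in> dom (f \<circ>\<^sub>m g)" using True that by blast
      then show "u \<in> dom g" by (auto simp: map_comp_def split: option.splits)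
      with \<open>u \<in> dom (f \<circ>\<^sub>m g)\<close> \<sigma>(2)[of u] show "\<sigma> u \<in> dom f"
        by (auto simp: map_comp_def dom_def)
    qed
    have "relabel k g w = Some (enc k (act \<sigma> s))"
      unfolding s(2) using g s sg \<sigma> by (intro relabel_enc) auto
    moreover have "relabel k f (enc k (act \<sigma> s)) = Some (enc k (act \<pi> (act \<sigma> s)))"
      using f actX \<pi> sg by (intro relabel_enc) (auto simp: supp_act bij)
    \<comment> \<open>The composite \<open>\<pi> \<circ> \<sigma>\<close> need not be the chosen
      extension of \<open>f \<circ>\<^sub>m g\<close>, but both agree on the support of
      \<open>s\<close>.\<close>
    moreover have "relabel k (f \<circ>\<^sub>m g) w = Some (enc k (act (\<pi> \<circ> \<sigma>) s))"
      unfolding s(2)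
    proof (rule relabel_enc)
      show "\<pi> \<circ> \<sigma> permutes {1..k+1}" using \<pi> \<sigma> by (simp add: permutes_compose)
      show "(f \<circ>\<^sub>m g) u = Some ((\<pi> \<circ> \<sigma>) u)" if "u \<in> supp s" for u
        using sg[OF that] \<pi> \<sigma> by (simp add: map_comp_def)
    qed (use s f g map_comp_partial_injections in auto)
    ultimately show ?thesis by (simp add: act_comp bij)
  next
    case False
    then have None: "relabel k (f \<circ>\<^sub>m g) w = None" using s by (simp add: relabel_def)
    show ?thesis
    \<comment> \<open>The composite is undefined either because a label already lies outside of
      \<open>dom g\<close>, or because the image of a label lies outside of \<open>dom f\<close>. On
      the other side the failure occurs in the inner or the outer relabeling, respectively.\<close>
    proof (cases "supp s \<subseteq> dom g")
      case True
      from False obtain u where u: "u \<in> supp s" "u \<notin> dom (f \<circ>\<^sub>m g)" by blast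
      then have "\<sigma> u \<notin> dom f" using True \<sigma>(2)[of u] by (auto simp: map_comp_def dom_def)
      then have "\<not> supp (act \<sigma> s) \<subseteq> dom f" using u by (auto simp: supp_act bij)
      then have "relabel k f (enc k (act \<sigma> s)) = None" using actX by (simp add: relabel_def)
      then show ?thesis using None True s by (simp add: relabel_def \<sigma>_def)
    qed (use None s in \<open>simp add: relabel_def\<close>)
  qed
next
  fix f g w
  assume f: "f \<in> partial_injections k" and g: "g \<in> partial_injections k" and le: "f \<subseteq>\<^sub>m g"
    and w: "w \<in> Wit (core k)" "Lbl (core k) w \<subseteq> dom f"
  obtain s where s: "s \<in> X k" "w = enc k s" using w by (auto simp: core_def)
  have "supp s \<subseteq> dom f" using w s by (simp add: core_def)
  then have fg: "f u = Some (extension k f u)" "g u = f u" if "u \<in> supp s" for u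
    using extension(2)[OF f] that le by (auto simp: map_le_def subset_eq)
  \<comment> \<open>The permutation chosen for the smaller map \<open>f\<close> also agrees with
    \<open>g\<close> on the support, so it computes both sides.\<close>
  have "relabel k g w = Some (enc k (act (extension k f) s))"
    unfolding s(2) using fg extension(1)[OF f] s g by (intro relabel_enc) auto
  moreover have "relabel k f w = Some (enc k (act (extension k f) s))"
    unfolding s(2) using fg extension(1)[OF f] s f by (intro relabel_enc) auto
  ultimately show "relabel k g w = relabel k f w" by simp
qed (rule action_commutes_relabel)

lemma has_witness_actions_core: "has_witness_actions core"
  unfolding has_witness_actions_def using witness_action_relabel by blast

end

section \<open>Graphs of instructive decompositions\<close>

text \<open>Total only for convenience: on labels outside of the bag the value is
  \<open>the None\<close>.\<close>

definition vtx :: "instr \<Rightarrow> nat \<Rightarrow> nat" where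
  "vtx t u = the (snd (lgraph_of t) u)"

lemma fresh_notin: "finite A \<Longrightarrow> fresh A \<notin> A"
  unfolding fresh_def by (metis Max_ge Suc_n_not_le_n empty_iff)

lemma endpoints_subset: "is_graph G \<Longrightarrow> endpoints G e \<subseteq> verts G"
  by (auto simp: is_graph_def endpoints_def)

lemma endpoints_outside: "is_graph G \<Longrightarrow> e \<notin> edges G \<Longrightarrow> endpoints G e = {}"
  by (auto simp: is_graph_def endpoints_def)

lemma inc_iff_endpoints: "(e, v) \<in> inc G \<longleftrightarrow> v \<in> endpoints G e"
  by (simp add: endpoints_def)

lemma is_graphI:
  assumes "finite (verts G)" "finite (edges G)"
    and "\<And>e. endpoints G e \<noteq> {} \<Longrightarrow> e \<in> edges G"
    and "\<And>e. e \<in> edges G \<Longrightarrow> endpoints G e \<subseteq> verts G"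
    and "\<And>e. e \<in> edges G \<Longrightarrow> card (endpoints G e) = 2"
  shows "is_graph G"
  unfolding is_graph_def
proof (intro conjI)
  show "inc G \<subseteq> edges G \<times> verts G"
    using assms(3,4) by (fastforce simp: inc_iff_endpoints)
qed (use assms in auto)

section \<open>Gluing two labeled graphs\<close>

definition glue_map :: "(nat \<rightharpoonup> nat) \<Rightarrow> (nat \<rightharpoonup> nat) \<Rightarrow> nat \<Rightarrow> nat" where
  "glue_map \<theta> \<theta>' x = (if x \<in> ran \<theta>' then 2 * the (\<theta> (THE u. \<theta>' u = Some x)) else 2 * x + 1)"

text \<open>Injectivity of the labeling makes the \<open>THE\<close> in \<open>glue_map\<close> well
  defined and keeps a join from merging two vertices of the same child.\<close>

definition wf_lgraph :: "graph \<times> (nat \<rightharpoonup> nat) \<Rightarrow> bool" where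
  "wf_lgraph = (\<lambda>(G, \<theta>). is_graph G \<and> ran \<theta> \<subseteq> verts G \<and> inj_on \<theta> (dom \<theta>))"

lemma glue_map_label:
  assumes "inj_on \<theta>' (dom \<theta>')" "\<theta>' u = Some y"
  shows "glue_map \<theta> \<theta>' y = 2 * the (\<theta> u)"
proof -
  have "(THE u. \<theta>' u = Some y) = u"
    using assms by (intro the_equality) (auto simp: inj_on_def dom_def)
  with assms show ?thesis by (auto simp: glue_map_def ran_def)
qed

text \<open>Unlabeled vertices of the right child are sent to odd numbers. A collision with the left
  child, whose vertices become even, therefore stems from a common label.\<close>

lemma glue_map_even:
  assumes "inj_on \<theta>' (dom \<theta>')" "dom \<theta> = dom \<theta>'" "glue_map \<theta> \<theta>' y = 2 * x"
  shows "\<exists>u. \<theta>' u = Some y \<and> \<theta> u = Some x"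
proof (cases "y \<in> ran \<theta>'")
  case True
  then obtain u where u: "\<theta>' u = Some y" by (auto simp: ran_def)
  then have "2 * the (\<theta> u) = 2 * x" using assms glue_map_label[of \<theta>' u y \<theta>] by simp
  moreover have "u \<in> dom \<theta>" using assms u by auto
  ultimately show ?thesis using u by auto
next
  case False
  with assms(3) have "2 * y + 1 = 2 * x" by (simp add: glue_map_def)
  then show ?thesis by presburger
qed

text \<open>An even value determines a left vertex, hence its label, hence the right vertex. An odd
  value is \<open>2 * x + 1\<close> and determines \<open>x\<close> directly.\<close>

lemma inj_glue_map:
  assumes "inj_on \<theta>' (dom \<theta>')" "inj_on \<theta> (dom \<theta>)" "dom \<theta> = dom \<theta>'"
  shows "inj (glue_map \<theta> \<theta>')"
proof (rule injI)
  fix x y assume eq: "glue_map \<theta> \<theta>' x = glue_map \<theta> \<theta>' y"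
  show "x = y"
  proof (cases "even (glue_map \<theta> \<theta>' x)")
    case True
    then obtain z where z: "glue_map \<theta> \<theta>' x = 2 * z" by blast
    then obtain u v where "\<theta>' u = Some x" "\<theta> u = Some z" "\<theta>' v = Some y" "\<theta> v = Some z"
      using glue_map_even[OF assms(1,3)] eq by metis
    then show ?thesis using assms(2) by (metis domI inj_onD option.inject)
  next
    case False
    then have "x \<notin> ran \<theta>'" by (auto simp: glue_map_def)
    moreover have "y \<notin> ran \<theta>'" using False unfolding eq by (auto simp: glue_map_def)
    ultimately show ?thesis using eq by (simp add: glue_map_def)
  qed
qed

lemma glue_simps:
  fixes G G' :: graph and \<theta> \<theta>' :: "nat \<rightharpoonup> nat"
  defines "H \<equiv> fst (glue (G, \<theta>) (G', \<theta>'))"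
  shows "verts H = (\<lambda>x. 2 * x) ` verts G \<union> glue_map \<theta> \<theta>' ` verts G'"
    and "edges H = (\<lambda>e. 2 * e) ` edges G \<union> (\<lambda>e. 2 * e + 1) ` edges G'"
    and "endpoints H (2 * e) = (\<lambda>x. 2 * x) ` endpoints G e"
    and "endpoints H (2 * e + 1) = glue_map \<theta> \<theta>' ` endpoints G' e"
    and "snd (glue (G, \<theta>) (G', \<theta>')) = map_option (\<lambda>x. 2 * x) \<circ> \<theta>"
proof -
  have H: "H = \<lparr>verts = (\<lambda>x. 2 * x) ` verts G \<union> glue_map \<theta> \<theta>' ` verts G',
       edges = (\<lambda>e. 2 * e) ` edges G \<union> (\<lambda>e. 2 * e + 1) ` edges G',
       inc = (\<lambda>(e, x). (2 * e, 2 * x)) ` inc G \<union> (\<lambda>(e, x). (2 * e + 1, glue_map \<theta> \<theta>' x)) ` inc G'\<rparr>"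
    by (simp add: H_def glue_def Let_def glue_map_def[abs_def])
  show "verts H = (\<lambda>x. 2 * x) ` verts G \<union> glue_map \<theta> \<theta>' ` verts G'"
    "edges H = (\<lambda>e. 2 * e) ` edges G \<union> (\<lambda>e. 2 * e + 1) ` edges G'"
    by (simp_all add: H)
  have parity: "2 * a \<noteq> Suc (2 * b)" "Suc (2 * b) \<noteq> 2 * a" for a b :: nat by presburger+
  show "endpoints H (2 * e) = (\<lambda>x. 2 * x) ` endpoints G e"
    by (force simp: H endpoints_def image_iff parity)
  show "endpoints H (2 * e + 1) = glue_map \<theta> \<theta>' ` endpoints G' e"
    by (force simp: H endpoints_def image_iff parity)
  show "snd (glue (G, \<theta>) (G', \<theta>')) = map_option (\<lambda>x. 2 * x) \<circ> \<theta>"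
    by (simp add: glue_def Let_def)
qed

lemma nat_even_odd_cases:
  obtains m where "(n::nat) = 2 * m" | m where "n = 2 * m + 1"
  by (metis evenE oddE)

lemma wf_glue:
  assumes "wf_lgraph (G, \<theta>)" "wf_lgraph (G', \<theta>')" "dom \<theta> = dom \<theta>'"
  shows "wf_lgraph (glue (G, \<theta>) (G', \<theta>'))"
proof -
  define H where "H = fst (glue (G, \<theta>) (G', \<theta>'))"
  note simps = glue_simps[of G \<theta> G' \<theta>', folded H_def]
  have wf: "is_graph G" "ran \<theta> \<subseteq> verts G" "inj_on \<theta> (dom \<theta>)"
    "is_graph G'" "ran \<theta>' \<subseteq> verts G'" "inj_on \<theta>' (dom \<theta>')"
    using assms by (simp_all add: wf_lgraph_def)
  have inj: "inj (glue_map \<theta> \<theta>')" using inj_glue_map wf assms(3) by blast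
  have "is_graph H"
  proof (rule is_graphI)
    show "finite (verts H)" "finite (edges H)"
      using wf by (auto simp: simps is_graph_def)
    fix e
    show "e \<in> edges H" if "endpoints H e \<noteq> {}"
    proof (cases e rule: nat_even_odd_cases)
      case (1 m)
      then have "m \<in> edges G" using that endpoints_outside[OF wf(1), of m] by (auto simp: simps)
      then show ?thesis using 1 by (simp add: simps)
    next
      case (2 m)
      then have "m \<in> edges G'"
        using that endpoints_outside[OF wf(4), of m] unfolding 2 simps by auto
      then show ?thesis using 2 by (simp add: simps)
    qed
    assume "e \<in> edges H"
    then consider f where "f \<in> edges G" "e = 2 * f" | f where "f \<in> edges G'" "e = 2 * f + 1"
      by (auto simp: simps)
    then show "card (endpoints H e) = 2"
    proof cases
      case 1
      then show ?thesis using wf by (simp add: simps card_image inj_on_def is_graph_def)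
    next
      case 2
      then show ?thesis using wf card_image[OF inj_on_subset[OF inj subset_UNIV]]
        unfolding 2 simps(4) by (simp add: is_graph_def)
    qed
    show "endpoints H e \<subseteq> verts H"
    proof (cases e rule: nat_even_odd_cases)
      case (1 m)
      then show ?thesis using endpoints_subset[OF wf(1), of m] unfolding 1 simps by blast
    next
      case (2 m)
      then show ?thesis using endpoints_subset[OF wf(4), of m] unfolding 2 simps by blast
    qed
  qed
  moreover have "ran (map_option (\<lambda>x. 2 * x) \<circ> \<theta>) \<subseteq> verts H"
    using wf by (auto simp: simps ran_def)
  moreover have "inj_on (map_option (\<lambda>x. 2 * x) \<circ> \<theta>) (dom (map_option (\<lambda>x. 2 * x) \<circ> \<theta>))"
    using wf(3) by (auto simp: inj_on_def dom_def)
  ultimately show ?thesis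
    by (simp add: wf_lgraph_def H_def case_prod_beta simps)
qed

lemma wf_lgraph_of:
  assumes "legal k t"
  shows "wf_lgraph (lgraph_of t) \<and> dom (snd (lgraph_of t)) = bag t"
  using assms
proof (induction t)
  case Leaf
  then show ?case by (simp add: wf_lgraph_def is_graph_def)
next
  case (IntroVertex u t)
  obtain G \<theta> where t: "lgraph_of t = (G, \<theta>)" by fastforce
  with IntroVertex have wf: "is_graph G" "ran \<theta> \<subseteq> verts G" "inj_on \<theta> (dom \<theta>)" "dom \<theta> = bag t"
    "u \<notin> bag t"
    by (auto simp: wf_lgraph_def)
  define x where "x = fresh (verts G)"
  have x: "x \<notin> verts G" unfolding x_def using wf by (intro fresh_notin) (simp add: is_graph_def)
  have "is_graph (G\<lparr>verts := insert x (verts G)\<rparr>)"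
    using wf by (auto simp: is_graph_def endpoints_def)
  moreover have "ran (\<theta>(u \<mapsto> x)) \<subseteq> insert x (verts G)" using wf by (auto simp: ran_def)
  moreover have "inj_on (\<theta>(u \<mapsto> x)) (insert u (dom \<theta>))"
  proof -
    have "\<theta> v \<noteq> Some x" for v using x wf by (auto simp: ran_def)
    then show ?thesis using wf(3) by (auto simp: inj_on_def)
  qed
  ultimately show ?case
    using wf by (simp add: t add_vertex_def wf_lgraph_def Let_def dom_fun_upd flip: x_def del: fun_upd_apply)
next
  case (ForgetVertex u t)
  obtain G \<theta> where t: "lgraph_of t = (G, \<theta>)" by fastforce
  with ForgetVertex have wf: "is_graph G" "ran \<theta> \<subseteq> verts G" "inj_on \<theta> (dom \<theta>)" "dom \<theta> = bag t"
    by (auto simp: wf_lgraph_def)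
  have "ran (\<theta>(u := None)) \<subseteq> verts G" using wf(2) by (auto simp: ran_def)
  moreover have "inj_on (\<theta>(u := None)) (dom \<theta> - {u})" using wf(3) by (auto simp: inj_on_def)
  ultimately show ?case
    using wf by (simp add: t wf_lgraph_def drop_label_def dom_fun_upd del: fun_upd_apply)
next
  case (IntroEdge u v t)
  obtain G \<theta> where t: "lgraph_of t = (G, \<theta>)" by fastforce
  with IntroEdge have wf: "is_graph G" "ran \<theta> \<subseteq> verts G" "inj_on \<theta> (dom \<theta>)" "dom \<theta> = bag t"
    "u \<in> bag t" "v \<in> bag t" "u \<noteq> v"
    by (auto simp: wf_lgraph_def)
  define e where "e = fresh (edges G)"
  have e: "e \<notin> edges G" unfolding e_def using wf by (intro fresh_notin) (simp add: is_graph_def)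
  obtain x y where xy: "\<theta> u = Some x" "\<theta> v = Some y" using wf(4-6) by blast
  then have "x \<in> verts G" "y \<in> verts G" "x \<noteq> y"
    using wf by (auto simp: ran_def inj_on_def dom_def)
  moreover define H where "H = G\<lparr>edges := insert e (edges G), inc := inc G \<union> {(e, x), (e, y)}\<rparr>"
  \<comment> \<open>No incidence mentions the new number \<open>e\<close> beforehand, because
    incidences of a graph only involve its edges; so the two added pairs are all of its
    endpoints.\<close>
  moreover have "endpoints H = (endpoints G)(e := {x, y})"
    using e endpoints_outside[OF wf(1) e] by (auto simp: H_def endpoints_def fun_eq_iff)
  ultimately have "is_graph H"
    using wf(1) endpoints_subset[OF wf(1)] endpoints_outside[OF wf(1)]
    by (intro is_graphI) (auto simp: is_graph_def split: if_splits)
  then show ?case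
    using wf by (simp add: t add_edge_def wf_lgraph_def Let_def xy H_def flip: e_def)
next
  case (Join s t)
  obtain G \<theta> G' \<theta>' where st: "lgraph_of s = (G, \<theta>)" "lgraph_of t = (G', \<theta>')" by fastforce
  with Join have wf: "wf_lgraph (glue (G, \<theta>) (G', \<theta>'))"
    by (intro wf_glue) auto
  have dom: "dom (map_option (\<lambda>x. 2 * x) \<circ> \<theta>) = dom \<theta>" by (auto simp: dom_def)
  have bag: "dom \<theta> = bag (Join s t)" using Join st by simp
  show ?case
    unfolding lgraph_of.simps st glue_simps(5) by (rule conjI[OF wf trans[OF dom bag]])
qed

lemma
  assumes "legal k t"
  shows is_graph_graph_of: "is_graph (graph_of t)"
    and inj_on_vtx: "inj_on (vtx t) (bag t)"
    and vtx_in_verts: "u \<in> bag t \<Longrightarrow> vtx t u \<in> verts (graph_of t)"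
proof -
  obtain G \<theta> where t: "lgraph_of t = (G, \<theta>)" by fastforce
  then have wf: "is_graph G" "ran \<theta> \<subseteq> verts G" "inj_on \<theta> (dom \<theta>)" "dom \<theta> = bag t"
    using wf_lgraph_of[OF assms] by (auto simp: wf_lgraph_def)
  show "is_graph (graph_of t)" using wf t by (simp add: graph_of_def)
  show "inj_on (vtx t) (bag t)"
  proof (rule inj_onI)
    fix u v assume uv: "u \<in> bag t" "v \<in> bag t" "vtx t u = vtx t v"
    obtain x y where "\<theta> u = Some x" "\<theta> v = Some y" using wf(4) uv by blast
    with uv have "\<theta> u = \<theta> v" by (simp add: vtx_def t)
    then show "u = v" using inj_onD[OF wf(3), of u v] uv wf(4) by simp
  qed
  assume "u \<in> bag t"
  then have "u \<in> dom \<theta>" using wf(4) by simp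
  then obtain x where "\<theta> u = Some x" by blast
  with wf(2) show "vtx t u \<in> verts (graph_of t)"
    by (auto simp: vtx_def t graph_of_def ran_def)
qed

lemma graph_of_Leaf [simp]: "verts (graph_of Leaf) = {}" "edges (graph_of Leaf) = {}"
  by (simp_all add: graph_of_def)

lemma graph_of_IntroVertex:
  assumes "legal k (IntroVertex u t)"
  obtains x where "x \<notin> verts (graph_of t)"
    and "verts (graph_of (IntroVertex u t)) = insert x (verts (graph_of t))"
    and "edges (graph_of (IntroVertex u t)) = edges (graph_of t)"
    and "endpoints (graph_of (IntroVertex u t)) = endpoints (graph_of t)"
    and "vtx (IntroVertex u t) = (vtx t)(u := x)"
proof -
  have "legal k t" using assms by simp
  then have fin: "finite (verts (graph_of t))" using is_graph_graph_of by (auto simp: is_graph_def)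
  show ?thesis
    by (rule that[of "fresh (verts (graph_of t))"])
      (use fresh_notin[OF fin] in \<open>auto simp: graph_of_def vtx_def add_vertex_def Let_def case_prod_beta
        endpoints_def fun_eq_iff\<close>)
qed

lemma graph_of_ForgetVertex [simp]: "graph_of (ForgetVertex u t) = graph_of t"
  by (simp add: graph_of_def drop_label_def case_prod_beta)

lemma vtx_ForgetVertex: "v \<noteq> u \<Longrightarrow> vtx (ForgetVertex u t) v = vtx t v"
  by (simp add: vtx_def drop_label_def case_prod_beta)

lemma graph_of_IntroEdge:
  assumes "legal k (IntroEdge u v t)"
  obtains e where "e \<notin> edges (graph_of t)"
    and "verts (graph_of (IntroEdge u v t)) = verts (graph_of t)"
    and "edges (graph_of (IntroEdge u v t)) = insert e (edges (graph_of t))"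
    and "endpoints (graph_of (IntroEdge u v t)) = (endpoints (graph_of t))(e := {vtx t u, vtx t v})"
    and "vtx (IntroEdge u v t) = vtx t"
proof -
  have "legal k t" using assms by simp
  then have G: "is_graph (graph_of t)" by (rule is_graph_graph_of)
  define e where "e = fresh (edges (graph_of t))"
  have e: "e \<notin> edges (graph_of t)"
    unfolding e_def using G by (intro fresh_notin) (simp add: is_graph_def)
  have "endpoints (graph_of t) e = {}" using endpoints_outside[OF G e] .
  then show ?thesis using e
    by (intro that[of e])
      (auto simp: graph_of_def vtx_def add_edge_def Let_def case_prod_beta
        endpoints_def fun_eq_iff e_def)
qed

text \<open>An interface that hides the parity encoding from all later arguments: vertices embed by
  \<open>i\<close> and \<open>h\<close>, edges by \<open>j\<close> and \<open>l\<close> with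
  disjoint ranges, and the two vertex embeddings meet exactly in vertices with a common label. The
  endpoint equations hold for all numbers \<open>e\<close>, which spares membership
  conditions.\<close>

lemma graph_of_Join:
  assumes "legal k (Join s t)"
  obtains i h j l :: "nat \<Rightarrow> nat" where "inj i" "inj h" "inj j" "inj l" "range j \<inter> range l = {}"
    and "verts (graph_of (Join s t)) = i ` verts (graph_of s) \<union> h ` verts (graph_of t)"
    and "edges (graph_of (Join s t)) = j ` edges (graph_of s) \<union> l ` edges (graph_of t)"
    and "\<And>e. endpoints (graph_of (Join s t)) (j e) = i ` endpoints (graph_of s) e"
    and "\<And>e. endpoints (graph_of (Join s t)) (l e) = h ` endpoints (graph_of t) e"
    and "\<And>u. u \<in> bag s \<Longrightarrow> vtx (Join s t) u = i (vtx s u)"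
    and "\<And>u. u \<in> bag s \<Longrightarrow> h (vtx t u) = i (vtx s u)"
    and "\<And>x y. i x = h y \<Longrightarrow> \<exists>u \<in> bag s. x = vtx s u \<and> y = vtx t u"
proof -
  obtain G \<theta> G' \<theta>' where st: "lgraph_of s = (G, \<theta>)" "lgraph_of t = (G', \<theta>')" by fastforce
  then have wf: "inj_on \<theta> (dom \<theta>)" "inj_on \<theta>' (dom \<theta>')" "dom \<theta> = bag s" "dom \<theta> = dom \<theta>'"
    using wf_lgraph_of[of k s] wf_lgraph_of[of k t] assms by (auto simp: wf_lgraph_def)
  note simps = glue_simps[of G \<theta> G' \<theta>']
  show ?thesis
  proof (rule that[of "\<lambda>x. 2 * x" "glue_map \<theta> \<theta>'" "\<lambda>e. 2 * e" "\<lambda>e. 2 * e + 1"])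
    show "inj (glue_map \<theta> \<theta>')" using wf by (intro inj_glue_map) auto
    show "range (\<lambda>e. 2 * e) \<inter> range (\<lambda>e. 2 * e + 1) = ({} :: nat set)"
      by (auto; presburger)
    show "vtx (Join s t) u = 2 * vtx s u" if "u \<in> bag s" for u
    proof -
      have "u \<in> dom \<theta>" using that wf(3) by simp
      then obtain x where "\<theta> u = Some x" by blast
      then show ?thesis by (simp add: vtx_def st simps)
    qed
    show "glue_map \<theta> \<theta>' (vtx t u) = 2 * vtx s u" if "u \<in> bag s" for u
    proof -
      have "u \<in> dom \<theta>'" using that wf by simp
      then obtain y where "\<theta>' u = Some y" by blast
      then show ?thesis using wf glue_map_label[of \<theta>' u y \<theta>] by (simp add: vtx_def st)
    qed
    show "\<exists>u \<in> bag s. x = vtx s u \<and> y = vtx t u" if eq: "2 * x = glue_map \<theta> \<theta>' y" for x y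
    proof -
      obtain u where "\<theta>' u = Some y" "\<theta> u = Some x"
        using glue_map_even[OF wf(2,4) eq[symmetric]] by blast
      then show ?thesis using wf by (intro bexI[of _ u]) (auto simp: vtx_def st)
    qed
  qed (auto simp: graph_of_def st simps simps(4)[simplified] inj_on_def)
qed


section \<open>Isomorphism\<close>

lemma graph_isoI:
  assumes "is_graph G" "is_graph H"
    and "bij_betw \<phi> (verts G) (verts H)" "bij_betw \<psi> (edges G) (edges H)"
    and ep: "\<And>e. e \<in> edges G \<Longrightarrow> endpoints H (\<psi> e) = \<phi> ` endpoints G e"
  shows "graph_iso G H"
proof -
  have "v \<in> endpoints G e \<longleftrightarrow> \<phi> v \<in> endpoints H (\<psi> e)" if "e \<in> edges G" "v \<in> verts G" for e v
    unfolding ep[OF that(1)]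
    using that endpoints_subset[OF assms(1), of e] assms(3)
    by (metis bij_betw_def inj_on_image_mem_iff)
  then show ?thesis
    unfolding graph_iso_def inc_iff_endpoints using assms by blast
qed

text \<open>Preservation of incidence speaks only about vertices of \<open>G\<close>. That
  \<open>\<psi> e\<close> has no further endpoints follows since endpoints in \<open>H\<close> are
  vertices of \<open>H\<close>, hence values of \<open>\<phi>\<close>.\<close>

lemma graph_isoE:
  assumes "is_graph G" "is_graph H" "graph_iso G H"
  obtains \<phi> \<psi> where "bij_betw \<phi> (verts G) (verts H)" "bij_betw \<psi> (edges G) (edges H)"
    and "\<And>e. e \<in> edges G \<Longrightarrow> endpoints H (\<psi> e) = \<phi> ` endpoints G e"
proof -
  obtain \<phi> \<psi> where iso: "bij_betw \<phi> (verts G) (verts H)" "bij_betw \<psi> (edges G) (edges H)"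
    and inc: "\<And>e v. e \<in> edges G \<Longrightarrow> v \<in> verts G \<Longrightarrow>
      v \<in> endpoints G e \<longleftrightarrow> \<phi> v \<in> endpoints H (\<psi> e)"
    using assms(3) unfolding graph_iso_def inc_iff_endpoints by blast
  have "endpoints H (\<psi> e) = \<phi> ` endpoints G e" if e: "e \<in> edges G" for e
  proof
    show "\<phi> ` endpoints G e \<subseteq> endpoints H (\<psi> e)"
      using inc[OF e] endpoints_subset[OF assms(1), of e] by blast
    show "endpoints H (\<psi> e) \<subseteq> \<phi> ` endpoints G e"
    proof
      fix y assume y: "y \<in> endpoints H (\<psi> e)"
      then have "y \<in> verts H" using endpoints_subset[OF assms(2)] by blast
      then obtain v where "v \<in> verts G" "y = \<phi> v" using iso(1) by (auto simp: bij_betw_def)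
      with inc[OF e] y show "y \<in> \<phi> ` endpoints G e" by blast
    qed
  qed
  with iso that show ?thesis by blast
qed

lemma graph_iso_sym:
  assumes "graph_iso G H"
  shows "graph_iso H G"
proof -
  obtain \<phi> \<psi> where iso: "bij_betw \<phi> (verts G) (verts H)" "bij_betw \<psi> (edges G) (edges H)"
    and inc: "\<And>e v. e \<in> edges G \<Longrightarrow> v \<in> verts G \<Longrightarrow> (e, v) \<in> inc G \<longleftrightarrow> (\<psi> e, \<phi> v) \<in> inc H"
    using assms unfolding graph_iso_def by blast
  show ?thesis
    unfolding graph_iso_def
  proof (rule exI[of _ "inv_into (verts G) \<phi>"], rule exI[of _ "inv_into (edges G) \<psi>"],
      intro conjI ballI)
    fix e v assume ev: "e \<in> edges H" "v \<in> verts H"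
    have "inv_into (edges G) \<psi> e \<in> edges G" "\<psi> (inv_into (edges G) \<psi> e) = e"
      "inv_into (verts G) \<phi> v \<in> verts G" "\<phi> (inv_into (verts G) \<phi> v) = v"
      using ev iso by (auto simp: bij_betw_def inv_into_into f_inv_into_f)
    then show "(e, v) \<in> inc H \<longleftrightarrow> (inv_into (edges G) \<psi> e, inv_into (verts G) \<phi> v) \<in> inc G"
      using inc by metis
  qed (use iso bij_betw_inv_into in blast)+
qed

definition iso_closed :: "(graph \<Rightarrow> bool) \<Rightarrow> bool" where
  "iso_closed P \<longleftrightarrow> (\<forall>G H. is_graph G \<longrightarrow> is_graph H \<longrightarrow> graph_iso G H \<longrightarrow> P G \<longrightarrow> P H)"

lemma iso_closed_iff:
  "iso_closed P \<Longrightarrow> is_graph G \<Longrightarrow> is_graph H \<Longrightarrow> graph_iso G H \<Longrightarrow> P G \<longleftrightarrow> P H"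
  unfolding iso_closed_def using graph_iso_sym by blast

section \<open>Every graph has a decomposition\<close>

lemma ex_edgeless_decomposition:
  assumes "m \<le> k + 1"
  shows "\<exists>t. legal k t \<and> bag t = {1..m} \<and> verts (graph_of t) = vtx t ` {1..m} \<and> edges (graph_of t) = {}"
  using assms
proof (induction m)
  case 0
  show ?case by (intro exI[of _ Leaf]) simp
next
  case (Suc m)
  then obtain t where t: "legal k t" "bag t = {1..m}" "verts (graph_of t) = vtx t ` {1..m}"
    "edges (graph_of t) = {}" by auto
  have legal: "legal k (IntroVertex (Suc m) t)" using t Suc.prems by auto
  from graph_of_IntroVertex[OF legal] obtain x where
    "verts (graph_of (IntroVertex (Suc m) t)) = insert x (verts (graph_of t))"
    "edges (graph_of (IntroVertex (Suc m) t)) = edges (graph_of t)"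
    "vtx (IntroVertex (Suc m) t) = (vtx t)(Suc m := x)" by metis
  with t legal show ?case
    by (intro exI[of _ "IntroVertex (Suc m) t"])
      (auto simp: atLeastAtMostSuc_conv simp del: legal.simps)
qed

text \<open>Nothing is ever forgotten. The parameter \<open>k\<close> is taken to be the number of
  vertices, so all vertices fit into the bag and any pair of them remains available for an
  edge.\<close>

lemma ex_decomposition:
  assumes H: "is_graph H"
  shows "\<exists>k t. legal k t \<and> graph_iso (graph_of t) H"
proof -
  define n where "n = card (verts H)"
  obtain \<mu> where \<mu>: "bij_betw \<mu> {1..n} (verts H)"
    using H ex_bij_betw_nat_finite_1[of "verts H"] by (auto simp: is_graph_def n_def)
  \<comment> \<open>The induction runs over the set \<open>F\<close> of edges of \<open>H\<close>
    already built. For each edge the invariant keeps a set \<open>B\<close> of labels that names its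
    endpoints on both sides, through \<open>vtx t\<close> and through \<open>\<mu>\<close>. Labels
    thus mediate between the two graphs, and no vertex map has to be carried along.\<close>
  have main: "\<exists>t \<psi>. legal n t \<and> bag t = {1..n} \<and> verts (graph_of t) = vtx t ` {1..n} \<and>
      bij_betw \<psi> (edges (graph_of t)) F \<and>
      (\<forall>e \<in> edges (graph_of t). \<exists>B \<subseteq> {1..n}.
        endpoints (graph_of t) e = vtx t ` B \<and> endpoints H (\<psi> e) = \<mu> ` B)"
    if "finite F" "F \<subseteq> edges H" for F
    using that
  proof (induction F rule: finite_induct)
    case empty
    obtain t where "legal n t" "bag t = {1..n}" "verts (graph_of t) = vtx t ` {1..n}"
      "edges (graph_of t) = {}"
      using ex_edgeless_decomposition[of n n] by auto
    then show ?case by (intro exI[of _ t]) (auto simp: bij_betw_def)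
  next
    case (insert f F)
    then obtain t \<psi> where t: "legal n t" "bag t = {1..n}" "verts (graph_of t) = vtx t ` {1..n}"
      "bij_betw \<psi> (edges (graph_of t)) F"
      and ep: "\<And>e. e \<in> edges (graph_of t) \<Longrightarrow> \<exists>B \<subseteq> {1..n}.
        endpoints (graph_of t) e = vtx t ` B \<and> endpoints H (\<psi> e) = \<mu> ` B"
      by auto
    have "card (endpoints H f) = 2" using H insert.prems by (auto simp: is_graph_def)
    then obtain x y where xy: "endpoints H f = {x, y}" "x \<noteq> y" by (auto simp: card_2_iff)
    have "x \<in> \<mu> ` {1..n}" "y \<in> \<mu> ` {1..n}"
      unfolding bij_betw_imp_surj_on[OF \<mu>] using xy endpoints_subset[OF H, of f] by auto
    then obtain u v where uv: "u \<in> {1..n}" "v \<in> {1..n}" "\<mu> u = x" "\<mu> v = y" by blast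
    with t xy have legal: "legal n (IntroEdge u v t)" by auto
    from graph_of_IntroEdge[OF legal] obtain e where e: "e \<notin> edges (graph_of t)"
      "verts (graph_of (IntroEdge u v t)) = verts (graph_of t)"
      "edges (graph_of (IntroEdge u v t)) = insert e (edges (graph_of t))"
      "endpoints (graph_of (IntroEdge u v t)) = (endpoints (graph_of t))(e := {vtx t u, vtx t v})"
      "vtx (IntroEdge u v t) = vtx t" by metis
    have bij: "bij_betw (\<psi>(e := f)) (insert e (edges (graph_of t))) (insert f F)"
      using t(4) e(1) insert.hyps(2) by (auto simp: bij_betw_def inj_on_def)
    have ep': "\<exists>B \<subseteq> {1..n}. endpoints (graph_of (IntroEdge u v t)) e' = vtx t ` B \<and>
        endpoints H ((\<psi>(e := f)) e') = \<mu> ` B" if "e' \<in> insert e (edges (graph_of t))" for e'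
    proof (cases "e' = e")
      case True
      then show ?thesis using uv xy e by (intro exI[of _ "{u, v}"]) auto
    next
      case False
      then show ?thesis using that ep[of e'] e by auto
    qed
    show ?case
    proof (rule exI[of _ "IntroEdge u v t"], rule exI[of _ "\<psi>(e := f)"], intro conjI ballI)
      show "bag (IntroEdge u v t) = {1..n}" using t by simp
      show "verts (graph_of (IntroEdge u v t)) = vtx (IntroEdge u v t) ` {1..n}" using t e by simp
      show "bij_betw (\<psi>(e := f)) (edges (graph_of (IntroEdge u v t))) (insert f F)"
        unfolding e(3) by (rule bij)
      fix e' assume "e' \<in> edges (graph_of (IntroEdge u v t))"
      then show "\<exists>B \<subseteq> {1..n}. endpoints (graph_of (IntroEdge u v t)) e' = vtx (IntroEdge u v t) ` B \<and>
          endpoints H ((\<psi>(e := f)) e') = \<mu> ` B"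
        unfolding e(3,5) by (rule ep')
    qed (rule legal)
  qed
  have "finite (edges H)" using H by (simp add: is_graph_def)
  from main[OF this subset_refl] obtain t \<psi> where t: "legal n t" "bag t = {1..n}"
    "verts (graph_of t) = vtx t ` {1..n}" "bij_betw \<psi> (edges (graph_of t)) (edges H)"
    and ep: "\<forall>e \<in> edges (graph_of t). \<exists>B \<subseteq> {1..n}.
        endpoints (graph_of t) e = vtx t ` B \<and> endpoints H (\<psi> e) = \<mu> ` B"
    by (elim exE conjE)
  have inj: "inj_on (vtx t) {1..n}" using inj_on_vtx[OF t(1)] t(2) by simp
  have "graph_iso (graph_of t) H"
  proof (rule graph_isoI[OF is_graph_graph_of[OF t(1)] H _ t(4)])
    \<comment> \<open>A vertex is sent to its label and the label to the vertex of \<open>H\<close>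
      that it numbers.\<close>
    show "bij_betw (\<mu> \<circ> inv_into {1..n} (vtx t)) (verts (graph_of t)) (verts H)"
      unfolding t(3) using \<mu> inj by (intro bij_betw_trans[OF bij_betw_inv_into] inj_on_imp_bij_betw)
    fix e assume "e \<in> edges (graph_of t)"
    from bspec[OF ep this] obtain B where B: "B \<subseteq> {1..n}" "endpoints (graph_of t) e = vtx t ` B"
      "endpoints H (\<psi> e) = \<mu> ` B" by (elim exE conjE)
    have "inv_into {1..n} (vtx t) ` vtx t ` B = B" using inj B(1) by (rule inv_into_image_cancel)
    then show "endpoints H (\<psi> e) = (\<mu> \<circ> inv_into {1..n} (vtx t)) ` endpoints (graph_of t) e"
      unfolding B image_comp[symmetric] by (rule arg_cong[symmetric])
  qed
  with t show ?thesis by blast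
qed

text \<open>\<open>Q\<close> allows for a core that is correct only on some graphs. Invariance of
  \<open>Q\<close> transports the restriction between a graph and its decomposition. The clique core
  takes simplicity for \<open>Q\<close>, the others the trivial predicate.\<close>

lemma core_property_eq:
  assumes acc: "\<And>k t. legal k t \<Longrightarrow> Q (graph_of t) \<Longrightarrow> accepts (D k) t \<longleftrightarrow> P (graph_of t)"
    and P: "iso_closed P" and Q: "iso_closed Q"
  shows "core_property D \<inter> {G. is_graph G \<and> Q G} = {G. is_graph G \<and> P G} \<inter> {G. is_graph G \<and> Q G}"
proof (intro equalityI subsetI)
  fix H assume "H \<in> core_property D \<inter> {G. is_graph G \<and> Q G}"
  then obtain k t where H: "is_graph H" "Q H" and t: "legal k t" "accepts (D k) t"
    and iso: "graph_iso (graph_of t) H"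
    by (auto simp: core_property_def)
  note G = is_graph_graph_of[OF t(1)]
  have "Q (graph_of t)" using iso_closed_iff[OF Q G H(1) iso] H by blast
  with acc t have "P (graph_of t)" by blast
  then show "H \<in> {G. is_graph G \<and> P G} \<inter> {G. is_graph G \<and> Q G}"
    using iso_closed_iff[OF P G H(1) iso] H by blast
next
  fix H assume H: "H \<in> {G. is_graph G \<and> P G} \<inter> {G. is_graph G \<and> Q G}"
  then obtain k t where t: "legal k t" and iso: "graph_iso (graph_of t) H"
    using ex_decomposition by blast
  note G = is_graph_graph_of[OF t(1)]
  have "Q (graph_of t)" "P (graph_of t)"
    using iso_closed_iff[OF Q G _ iso] iso_closed_iff[OF P G _ iso] H by blast+
  with acc t have "accepts (D k) t" by blast
  then show "H \<in> core_property D \<inter> {G. is_graph G \<and> Q G}"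
    using H t iso by (auto simp: core_property_def)
qed

lemma core_property_eq':
  assumes "\<And>k t. legal k t \<Longrightarrow> accepts (D k) t \<longleftrightarrow> P (graph_of t)" and "iso_closed P"
  shows "core_property D = {G. is_graph G \<and> P G}"
  using core_property_eq[of "\<lambda>_. True" D P] assms
  by (auto simp: iso_closed_def core_property_def)

text \<open>The criterion \<open>P\<close> depends on the graph alone, so isomorphic graphs get the
  same verdict for all parameters and all terms.\<close>

lemma coherentI:
  assumes "\<And>k t. legal k t \<Longrightarrow> accepts (D k) t \<longleftrightarrow> P (graph_of t)" and P: "iso_closed P"
  shows "coherent D"
  unfolding coherent_def
  using assms(1) iso_closed_iff[OF P is_graph_graph_of is_graph_graph_of] by blast

section \<open>Isomorphism invariance of the four properties\<close>

lemma degree_endpoints: "degree G v = card {e \<in> edges G. v \<in> endpoints G e}"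
  by (simp add: degree_def inc_iff_endpoints)

text \<open>\<open>d \<ge> 1\<close> settles the empty graph, whose maximum degree is set to
  \<open>0\<close>.\<close>

lemma max_degree_ge_iff:
  assumes "is_graph G" "d \<ge> 1"
  shows "max_degree G \<ge> d \<longleftrightarrow> (\<exists>v \<in> verts G. degree G v \<ge> d)"
  using assms by (auto simp: max_degree_def is_graph_def Max_ge_iff)

lemma iso_closed_max_degree: "d \<ge> 1 \<Longrightarrow> iso_closed (\<lambda>G. max_degree G \<ge> d)"
  unfolding iso_closed_def
proof (intro allI impI)
  fix G H assume d: "d \<ge> 1" and G: "is_graph G" and H: "is_graph H" and iso: "graph_iso G H"
    and "max_degree G \<ge> d"
  then obtain v where v: "v \<in> verts G" "degree G v \<ge> d" using max_degree_ge_iff by blast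
  obtain \<phi> \<psi> where \<phi>: "bij_betw \<phi> (verts G) (verts H)" and \<psi>: "bij_betw \<psi> (edges G) (edges H)"
    and ep: "\<And>e. e \<in> edges G \<Longrightarrow> endpoints H (\<psi> e) = \<phi> ` endpoints G e"
    using graph_isoE[OF G H iso] by metis
  have "degree G v = card (\<psi> ` {e \<in> edges G. v \<in> endpoints G e})"
    unfolding degree_endpoints using \<psi>
    by (intro card_image[symmetric]) (auto simp: bij_betw_def inj_on_def)
  also have "\<dots> \<le> degree H (\<phi> v)"
    unfolding degree_endpoints
  proof (rule card_mono)
    show "\<psi> ` {e \<in> edges G. v \<in> endpoints G e} \<subseteq> {e \<in> edges H. \<phi> v \<in> endpoints H e}"
      using \<psi> ep by (auto simp: bij_betw_def)
  qed (use H in \<open>simp add: is_graph_def\<close>)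
  finally have "degree H (\<phi> v) \<ge> d" using v by simp
  moreover have "\<phi> v \<in> verts H" using \<phi> v by (auto simp: bij_betw_def)
  ultimately show "max_degree H \<ge> d" using max_degree_ge_iff[OF H d] by blast
qed

text \<open>Numbering the cells turns a partition into a coloring, and the nonempty fibres of a
  coloring form a partition. Injectivity on the endpoint set says that the two ends of an edge
  differ in color. Colors start at \<open>1\<close>, which leaves \<open>0\<close> free as a marker
  for absent labels.\<close>

lemma colorable_iff:
  assumes G: "is_graph G"
  shows "colorable r G \<longleftrightarrow>
    (\<exists>\<chi>. \<chi> ` verts G \<subseteq> {1..r} \<and> (\<forall>e \<in> edges G. inj_on \<chi> (endpoints G e)))"
proof
  assume "colorable r G"
  then obtain P where P: "partition_on (verts G) P" "card P \<le> r"
    and proper: "\<forall>e \<in> edges G. \<forall>u \<in> endpoints G e. \<forall>v \<in> endpoints G e. u \<noteq> v \<longrightarrow>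
      \<not> (\<exists>C \<in> P. u \<in> C \<and> v \<in> C)"
    unfolding colorable_def by (elim exE conjE)
  have "finite P" using P G finite_elements by (auto simp: is_graph_def)
  then obtain f where f: "inj_on f P" "f ` P \<subseteq> {1..r}"
    using card_le_inj[of P "{1..r}"] P by auto
  define cell where "cell v = (SOME C. C \<in> P \<and> v \<in> C)" for v
  have cell: "cell v \<in> P" "v \<in> cell v" if "v \<in> verts G" for v
  proof -
    have "\<exists>C. C \<in> P \<and> v \<in> C" using that P(1) by (auto simp: partition_on_def)
    from someI_ex[OF this] show "cell v \<in> P" "v \<in> cell v" unfolding cell_def by blast+
  qed
  show "\<exists>\<chi>. \<chi> ` verts G \<subseteq> {1..r} \<and> (\<forall>e \<in> edges G. inj_on \<chi> (endpoints G e))"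
  proof (intro exI[of _ "f \<circ> cell"] conjI ballI inj_onI)
    show "(f \<circ> cell) ` verts G \<subseteq> {1..r}" using f cell by force
    fix e u v assume e: "e \<in> edges G" "u \<in> endpoints G e" "v \<in> endpoints G e"
      and eq: "(f \<circ> cell) u = (f \<circ> cell) v"
    have uv: "u \<in> verts G" "v \<in> verts G" using e endpoints_subset[OF G] by blast+
    then have "cell u = cell v" using eq f cell by (auto simp: inj_on_def)
    then have "\<exists>C \<in> P. u \<in> C \<and> v \<in> C" using cell uv by metis
    with proper e show "u = v" by blast
  qed
next
  assume "\<exists>\<chi>. \<chi> ` verts G \<subseteq> {1..r} \<and> (\<forall>e \<in> edges G. inj_on \<chi> (endpoints G e))"
  then obtain \<chi> where \<chi>: "\<chi> ` verts G \<subseteq> {1..r}" "\<And>e. e \<in> edges G \<Longrightarrow> inj_on \<chi> (endpoints G e)"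
    by blast
  \<comment> \<open>Ranging over the colors that occur, and not over all of \<open>{1..r}\<close>,
    keeps empty cells out of the partition.\<close>
  define P where "P = (\<lambda>c. {v \<in> verts G. \<chi> v = c}) ` \<chi> ` verts G"
  have "partition_on (verts G) P"
    by (intro partition_onI) (auto simp: P_def disjnt_def)
  moreover have "card P \<le> r"
  proof -
    have "card P \<le> card (\<chi> ` verts G)"
      unfolding P_def using G by (intro card_image_le) (simp add: is_graph_def)
    also have "\<dots> \<le> r" using card_mono[OF _ \<chi>(1)] by simp
    finally show ?thesis .
  qed
  ultimately show "colorable r G"
    unfolding colorable_def using \<chi>(2)
    by (intro exI[of _ P]) (fastforce simp: P_def inj_on_def)
qed

lemma iso_closed_colorable: "iso_closed (colorable r)"
  unfolding iso_closed_def
proof (intro allI impI)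
  fix G H assume G: "is_graph G" and H: "is_graph H" and iso: "graph_iso G H" and "colorable r G"
  from this(4) obtain \<chi> where \<chi>: "\<chi> ` verts G \<subseteq> {1..r}"
      "\<And>e. e \<in> edges G \<Longrightarrow> inj_on \<chi> (endpoints G e)"
    unfolding colorable_iff[OF G] by blast
  obtain \<phi> \<psi> where \<phi>: "bij_betw \<phi> (verts H) (verts G)" and \<psi>: "bij_betw \<psi> (edges H) (edges G)"
    and ep: "\<And>e. e \<in> edges H \<Longrightarrow> endpoints G (\<psi> e) = \<phi> ` endpoints H e"
    using graph_isoE[OF H G graph_iso_sym[OF iso]] by metis
  have "inj_on (\<chi> \<circ> \<phi>) (endpoints H e)" if "e \<in> edges H" for e
  proof (rule comp_inj_on)
    show "inj_on \<phi> (endpoints H e)"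
      using \<phi> endpoints_subset[OF H] by (metis bij_betw_def inj_on_subset)
    show "inj_on \<chi> (\<phi> ` endpoints H e)"
      using \<chi>(2)[of "\<psi> e"] ep[OF that] \<psi> that by (auto simp: bij_betw_def)
  qed
  moreover have "(\<chi> \<circ> \<phi>) ` verts H \<subseteq> {1..r}" using \<chi>(1) \<phi> by (auto simp: bij_betw_def)
  ultimately show "colorable r H" using colorable_iff[OF H] by blast
qed

lemma iso_closed_has_clique: "iso_closed (has_clique m)"
  unfolding iso_closed_def
proof (intro allI impI)
  fix G H assume G: "is_graph G" and H: "is_graph H" and iso: "graph_iso G H" and "has_clique m G"
  then obtain K where K: "K \<subseteq> verts G" "card K = m"
    and clique: "\<And>u v. u \<in> K \<Longrightarrow> v \<in> K \<Longrightarrow> u \<noteq> v \<Longrightarrow> \<exists>e \<in> edges G. endpoints G e = {u, v}"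
    unfolding has_clique_def by blast
  obtain \<phi> \<psi> where \<phi>: "bij_betw \<phi> (verts G) (verts H)" and \<psi>: "bij_betw \<psi> (edges G) (edges H)"
    and ep: "\<And>e. e \<in> edges G \<Longrightarrow> endpoints H (\<psi> e) = \<phi> ` endpoints G e"
    using graph_isoE[OF G H iso] by metis
  have "card (\<phi> ` K) = m" using K \<phi> by (metis bij_betw_def card_image inj_on_subset)
  moreover have "\<phi> ` K \<subseteq> verts H" using K \<phi> by (auto simp: bij_betw_def)
  moreover have "\<exists>e \<in> edges H. endpoints H e = {\<phi> u, \<phi> v}"
    if uv: "u \<in> K" "v \<in> K" "\<phi> u \<noteq> \<phi> v" for u v
  proof -
    have "u \<noteq> v" using that by blast
    then obtain e where "e \<in> edges G" "endpoints G e = {u, v}" using clique uv by blast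
    then show ?thesis using ep \<psi> by (intro bexI[of _ "\<psi> e"]) (auto simp: bij_betw_def)
  qed
  ultimately show "has_clique m H" unfolding has_clique_def by blast
qed

lemma iso_closed_has_multiple_edge: "iso_closed has_multiple_edge"
  unfolding iso_closed_def
proof (intro allI impI)
  fix G H assume G: "is_graph G" and H: "is_graph H" and iso: "graph_iso G H"
    and "has_multiple_edge G"
  then obtain e e' where e: "e \<in> edges G" "e' \<in> edges G" "e \<noteq> e'" "endpoints G e = endpoints G e'"
    unfolding has_multiple_edge_def by blast
  obtain \<phi> \<psi> where \<psi>: "bij_betw \<psi> (edges G) (edges H)"
    and ep: "\<And>e. e \<in> edges G \<Longrightarrow> endpoints H (\<psi> e) = \<phi> ` endpoints G e"
    using graph_isoE[OF G H iso] by metis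
  have "\<psi> e \<in> edges H" "\<psi> e' \<in> edges H" "\<psi> e \<noteq> \<psi> e'"
    using \<psi> e by (auto simp: bij_betw_def inj_on_def)
  moreover have "endpoints H (\<psi> e) = endpoints H (\<psi> e')" using e ep by simp
  ultimately show "has_multiple_edge H" unfolding has_multiple_edge_def by blast
qed

section \<open>Renaming finitely supported functions\<close>

definition support :: "(nat \<Rightarrow> nat) \<Rightarrow> nat set" where
  "support g = {x. g x \<noteq> 0}"

text \<open>The push-forward along \<open>\<pi>\<close>: the value at \<open>u\<close> moves to
  \<open>\<pi> u\<close>. Precomposing with the inverse makes this a left action.\<close>

definition rename :: "(nat \<Rightarrow> nat) \<Rightarrow> (nat \<Rightarrow> nat) \<Rightarrow> nat \<Rightarrow> nat" where
  "rename \<pi> g = g \<circ> inv \<pi>"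

lemma rename_upd: "bij \<pi> \<Longrightarrow> (rename \<pi> g)(\<pi> u := c) = rename \<pi> (g(u := c))"
  by (auto simp: rename_def fun_eq_iff bij_is_inj bij_is_surj surj_f_inv_f)

lemma rename_apply: "bij \<pi> \<Longrightarrow> rename \<pi> g (\<pi> u) = g u"
  by (simp add: rename_def bij_is_inj)

lemma rename_id: "rename id g = g"
  by (simp add: rename_def)

lemma rename_comp: "bij \<pi> \<Longrightarrow> bij \<sigma> \<Longrightarrow> rename (\<pi> \<circ> \<sigma>) g = rename \<pi> (rename \<sigma> g)"
  by (simp add: rename_def o_inv_distrib comp_assoc)

lemma support_rename:
  assumes "bij \<pi>"
  shows "support (rename \<pi> g) = \<pi> ` support g"
proof (intro equalityI subsetI)
  fix x assume "x \<in> support (rename \<pi> g)"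
  then have "g (inv \<pi> x) \<noteq> 0" "x = \<pi> (inv \<pi> x)"
    using assms by (simp_all add: support_def rename_def bij_is_surj surj_f_inv_f)
  then show "x \<in> \<pi> ` support g" unfolding support_def by blast
qed (use assms in \<open>auto simp: support_def rename_apply\<close>)

text \<open>At a point \<open>y\<close>, a nonzero value on one side comes from a preimage in the
  support, where the two bijections agree, so the other side reads the same value. Otherwise both
  values are \<open>0\<close>.\<close>

lemma rename_cong:
  assumes "bij \<pi>" "bij \<sigma>" "\<And>u. u \<in> support g \<Longrightarrow> \<pi> u = \<sigma> u"
  shows "rename \<pi> g = rename \<sigma> g"
proof
  fix y
  have "\<pi> (inv \<pi> y) = y" "\<sigma> (inv \<sigma> y) = y" using assms by (simp_all add: bij_is_surj surj_f_inv_f)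
  moreover have "g u = 0 \<or> \<pi> u = \<sigma> u" for u using assms(3) by (auto simp: support_def)
  ultimately show "rename \<pi> g y = rename \<sigma> g y"
    using assms(1,2) by (metis bij_inv_eq_iff comp_apply rename_def)
qed

lemma rename_inject: "bij \<pi> \<Longrightarrow> rename \<pi> g = rename \<pi> g' \<longleftrightarrow> g = g'"
  by (metis rename_apply ext)

lemma support_upd_0: "support (g(u := 0)) = support g - {u}"
  by (auto simp: support_def)

lemma support_upd: "support (g(u := c)) \<subseteq> insert u (support g)"
  by (auto simp: support_def)

definition bounded_funs :: "nat \<Rightarrow> nat \<Rightarrow> (nat \<Rightarrow> nat) set" where
  "bounded_funs m k = {g. \<forall>u. g u \<le> m \<and> (u \<notin> {1..k+1} \<longrightarrow> g u = 0)}"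

text \<open>Outside of the \<open>k + 1\<close> labels the functions vanish, so they are determined
  by their restrictions, with \<open>m + 1\<close> possible values per label.\<close>

lemma bounded_funs_card: "finite (bounded_funs m k)" "card (bounded_funs m k) \<le> (m + 1) ^ (k + 1)"
proof -
  let ?A = "{1..k+1}"
  let ?F = "\<lambda>g. restrict g ?A"
  have inj: "inj_on ?F (bounded_funs m k)"
  proof (rule inj_onI, rule ext)
    fix g h x assume gh: "g \<in> bounded_funs m k" "h \<in> bounded_funs m k" "?F g = ?F h"
    show "g x = h x"
    proof (cases "x \<in> ?A")
      case True
      then show ?thesis using fun_cong[OF gh(3), of x] by simp
    next
      case False
      then show ?thesis using gh(1,2) by (simp add: bounded_funs_def)
    qed
  qed
  have sub: "?F ` bounded_funs m k \<subseteq> ?A \<rightarrow>\<^sub>E {..m}"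
    by (auto simp: bounded_funs_def)
  have fin: "finite (?A \<rightarrow>\<^sub>E {..m})" by (intro finite_PiE) auto
  show "finite (bounded_funs m k)" using inj sub fin by (metis finite_imageD finite_subset)
  have "card (bounded_funs m k) \<le> card (?A \<rightarrow>\<^sub>E {..m})"
    using card_inj_on_le[OF inj sub fin] .
  also have "\<dots> = (m + 1) ^ (k + 1)" by (simp add: card_PiE)
  finally show "card (bounded_funs m k) \<le> (m + 1) ^ (k + 1)" .
qed

lemma bounded_funs_rename:
  assumes "g \<in> bounded_funs m k" "\<pi> permutes {1..k+1}"
  shows "rename \<pi> g \<in> bounded_funs m k"
proof -
  have "inv \<pi> u \<in> {1..k+1} \<longleftrightarrow> u \<in> {1..k+1}" for u
    using assms(2) by (intro permutes_in_image permutes_inv)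
  moreover have "g v \<le> m" "v \<notin> {1..k+1} \<Longrightarrow> g v = 0" for v
    using assms(1) unfolding bounded_funs_def by blast+
  ultimately show ?thesis unfolding bounded_funs_def rename_def comp_apply by blast
qed

lemma bounded_funs_upd:
  "g \<in> bounded_funs m k \<Longrightarrow> u \<in> {1..k+1} \<Longrightarrow> c \<le> m \<Longrightarrow> g(u := c) \<in> bounded_funs m k"
  unfolding bounded_funs_def by simp

lemma zero_bounded_funs: "(\<lambda>_. 0) \<in> bounded_funs m k"
  by (simp add: bounded_funs_def)

lemma support_bounded_funs: "g \<in> bounded_funs m k \<Longrightarrow> support g \<subseteq> {1..k+1}"
proof
  fix x assume "g \<in> bounded_funs m k" "x \<in> support g"
  then have "x \<notin> {1..k+1} \<longrightarrow> g x = 0" "g x \<noteq> 0" by (simp_all add: bounded_funs_def support_def)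
  then show "x \<in> {1..k+1}" by blast
qed

lemma log_card_le:
  assumes "card X \<le> N" "X \<noteq> {}" "finite X"
  shows "log 2 (real (card X)) \<le> log 2 (real N)"
proof -
  have "card X > 0" using assms by (simp add: card_gt_0_iff)
  with assms show ?thesis by simp
qed

section \<open>Maximum degree\<close>

text \<open>A state records the degrees of the bag vertices, truncated at \<open>d\<close>, and whether some vertex
  has reached degree \<open>d\<close>. Isolated bag vertices are not part of the support.\<close>

type_synonym deg_state = "(nat \<Rightarrow> nat) \<times> bool"

definition deg_states :: "nat \<Rightarrow> nat \<Rightarrow> deg_state set" where
  "deg_states d k = bounded_funs d k \<times> UNIV"

definition deg_introe :: "nat \<Rightarrow> nat \<Rightarrow> nat \<Rightarrow> deg_state \<Rightarrow> deg_state set" where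
  "deg_introe d u v = (\<lambda>(g, b). {(g(u := min d (g u + 1), v := min d (g v + 1)),
     b \<or> d \<le> g u + 1 \<or> d \<le> g v + 1)})"

text \<open>Truncation commutes with adding: cutting off both summands at \<open>d\<close> changes
  neither the truncated sum nor whether it reaches \<open>d\<close>. The last disjunct catches bag
  vertices that attain degree \<open>d\<close> only by combining both sides.\<close>

definition deg_join :: "nat \<Rightarrow> deg_state \<Rightarrow> deg_state \<Rightarrow> deg_state set" where
  "deg_join d = (\<lambda>(g, b) (g', b'). {(\<lambda>x. min d (g x + g' x), b \<or> b' \<or> (\<exists>x. d \<le> g x + g' x))})"

definition deg_supp :: "deg_state \<Rightarrow> nat set" where
  "deg_supp s = support (fst s)"

definition deg_act :: "(nat \<Rightarrow> nat) \<Rightarrow> deg_state \<Rightarrow> deg_state" where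
  "deg_act \<pi> s = (rename \<pi> (fst s), snd s)"

definition deg_leaf :: deg_state where
  "deg_leaf = (\<lambda>_. 0, False)"

definition deg_introv :: "nat \<Rightarrow> deg_state \<Rightarrow> deg_state set" where
  "deg_introv u s = {s}"

definition deg_forgetv :: "nat \<Rightarrow> deg_state \<Rightarrow> deg_state set" where
  "deg_forgetv u s = {((fst s)(u := 0), snd s)}"

lemmas deg_defs = deg_states_def deg_supp_def deg_act_def deg_leaf_def deg_introv_def
  deg_forgetv_def deg_introe_def deg_join_def

interpretation deg: equivariant_system "deg_states d" deg_supp deg_act snd deg_leaf deg_introv
  deg_forgetv "deg_introe d" "deg_join d" for d
proof
  fix \<pi> :: "nat \<Rightarrow> nat" and u v :: nat and s s' :: deg_state assume \<pi>: "bij \<pi>"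
  obtain g b g' b' where s: "s = (g, b)" "s' = (g', b')" by fastforce
  \<comment> \<open>A bijection of the labels merely permutes the candidates of the existential
    quantifier.\<close>
  have "(\<exists>x. d \<le> rename \<pi> g x + rename \<pi> g' x) \<longleftrightarrow> (\<exists>x. d \<le> g x + g' x)"
    using \<pi> by (metis comp_apply rename_def rename_apply)
  then show "deg_join d (deg_act \<pi> s) (deg_act \<pi> s') = deg_act \<pi> ` deg_join d s s'"
    by (simp add: s deg_defs) (simp add: rename_def comp_def)
  show "deg_introe d (\<pi> u) (\<pi> v) (deg_act \<pi> s) = deg_act \<pi> ` deg_introe d u v s"
    by (simp add: s deg_defs rename_apply[OF \<pi>] rename_upd[OF \<pi>] del: fun_upd_apply)
  show "deg_forgetv (\<pi> u) (deg_act \<pi> s) = deg_act \<pi> ` deg_forgetv u s"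
    by (simp add: deg_defs rename_upd[OF \<pi>] del: fun_upd_apply)
  show "deg_introv (\<pi> u) (deg_act \<pi> s) = deg_act \<pi> ` deg_introv u s"
    by (simp add: deg_defs)
  show "deg_supp (deg_act \<pi> s) = \<pi> ` deg_supp s"
    by (simp add: deg_defs support_rename[OF \<pi>])
next
  fix \<pi> \<sigma> :: "nat \<Rightarrow> nat" and s :: deg_state
  assume "bij \<pi>" "bij \<sigma>" "\<And>u. u \<in> deg_supp s \<Longrightarrow> \<pi> u = \<sigma> u"
  then show "deg_act \<pi> s = deg_act \<sigma> s"
    using rename_cong[of \<pi> \<sigma> "fst s"] by (simp add: deg_defs)
next
  fix s s' :: deg_state and k assume "s \<in> deg_states d k" "s' \<in> deg_states d k"
  then show "deg_join d s s' \<subseteq> deg_states d k"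
    by (auto simp: deg_join_def deg_states_def bounded_funs_def)
next
  fix s :: deg_state and k assume "s \<in> deg_states d k"
  then show "deg_supp s \<subseteq> {1..k+1}"
    unfolding deg_states_def deg_supp_def mem_Times_iff by (intro support_bounded_funs) blast
next
  fix u v and s s' :: deg_state assume "s' \<in> deg_introe d u v s"
  then show "deg_supp s' \<subseteq> deg_supp s \<union> {u, v}"
    by (auto simp: deg_introe_def deg_supp_def support_def split: if_splits)
next
  fix s s' t :: deg_state assume "t \<in> deg_join d s s'"
  then show "deg_supp t \<subseteq> deg_supp s \<union> deg_supp s'"
    by (auto simp: deg_join_def deg_supp_def support_def case_prod_beta)
qed (auto simp: deg_defs bounded_funs_card bounded_funs_rename bounded_funs_upd zero_bounded_funs
    rename_id rename_comp support_upd_0 simp del: fun_upd_apply dest: support_bounded_funs,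
    auto simp: support_def)

text \<open>Edges are never identified, so those of the join are two disjoint families, and the
  degree is the sum of their contributions. Stating this for an arbitrary \<open>w\<close> covers
  shared vertices and vertices of one side alike.\<close>

lemma degree_Join:
  assumes legal: "legal k (Join s t)"
    and J: "inj i" "inj h" "inj j" "inj l" "range j \<inter> range l = {}"
      "edges (graph_of (Join s t)) = j ` edges (graph_of s) \<union> l ` edges (graph_of t)"
      "\<And>e. endpoints (graph_of (Join s t)) (j e) = i ` endpoints (graph_of s) e"
      "\<And>e. endpoints (graph_of (Join s t)) (l e) = h ` endpoints (graph_of t) e"
  shows "degree (graph_of (Join s t)) w =
    card {e \<in> edges (graph_of s). w \<in> i ` endpoints (graph_of s) e} +
    card {e \<in> edges (graph_of t). w \<in> h ` endpoints (graph_of t) e}"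
proof -
  have "{e \<in> edges (graph_of (Join s t)). w \<in> endpoints (graph_of (Join s t)) e} =
      j ` {e \<in> edges (graph_of s). w \<in> i ` endpoints (graph_of s) e} \<union>
      l ` {e \<in> edges (graph_of t). w \<in> h ` endpoints (graph_of t) e}" (is "_ = j ` ?A \<union> l ` ?B")
    using J by auto
  moreover have "finite ?A" "finite ?B"
    using is_graph_graph_of[of k s] is_graph_graph_of[of k t] legal by (auto simp: is_graph_def)
  moreover have "j ` ?A \<inter> l ` ?B = {}" using J(5) by auto
  moreover have "card (j ` ?A) = card ?A" "card (l ` ?B) = card ?B"
    using J by (auto intro!: card_image inj_on_subset[OF _ subset_UNIV])
  ultimately show ?thesis by (simp add: degree_endpoints card_Un_disjoint)
qed

section \<open>Correctness of the degree states\<close>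

definition bag_degree :: "nat \<Rightarrow> instr \<Rightarrow> nat \<Rightarrow> nat" where
  "bag_degree d t u = (if u \<in> bag t then min d (degree (graph_of t) (vtx t u)) else 0)"

definition reaches_degree :: "nat \<Rightarrow> graph \<Rightarrow> bool" where
  "reaches_degree d G \<longleftrightarrow> (\<exists>v \<in> verts G. d \<le> degree G v)"

text \<open>Nothing is guessed, so exactly one state is reached. A vertex can be forgotten safely:
  its degree is final from then on, and the flag remembers whether it reached
  \<open>d\<close>.\<close>

lemma states_deg:
  assumes "legal k t" "d \<ge> 1"
  shows "deg.states d t = {(bag_degree d t, reaches_degree d (graph_of t))}"
  using assms(1)
proof (induction t)
  case Leaf
  then show ?case unfolding deg.states.simps unfolding deg_leaf_def
    by (simp add: bag_degree_def reaches_degree_def fun_eq_iff)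
next
  case (IntroVertex u t)
  have legal: "legal k t" "u \<notin> bag t" using IntroVertex.prems by auto
  obtain x where x: "x \<notin> verts (graph_of t)"
    "verts (graph_of (IntroVertex u t)) = insert x (verts (graph_of t))"
    "edges (graph_of (IntroVertex u t)) = edges (graph_of t)"
    "endpoints (graph_of (IntroVertex u t)) = endpoints (graph_of t)"
    "vtx (IntroVertex u t) = (vtx t)(u := x)"
    using graph_of_IntroVertex[OF IntroVertex.prems] by metis
  have deg: "degree (graph_of (IntroVertex u t)) = degree (graph_of t)"
    by (simp add: fun_eq_iff degree_endpoints x)
  \<comment> \<open>The new vertex is isolated. Its entry \<open>0\<close> coincides with the
    default for absent labels, and by \<open>d \<ge> 1\<close> the flag does not change; this is why
    the state stays as it was.\<close>
  have "{e \<in> edges (graph_of t). x \<in> endpoints (graph_of t) e} = {}"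
    using x(1) endpoints_subset[OF is_graph_graph_of[OF legal(1)]] by blast
  then have 0: "degree (graph_of t) x = 0" unfolding degree_endpoints by (simp only: card.empty)
  have "bag_degree d (IntroVertex u t) = bag_degree d t"
    using legal by (auto simp: fun_eq_iff bag_degree_def deg x(5) 0)
  moreover have "reaches_degree d (graph_of (IntroVertex u t)) = reaches_degree d (graph_of t)"
    using assms(2) by (simp add: reaches_degree_def deg x(2) 0)
  ultimately show ?case
    unfolding deg.states.simps IntroVertex.IH[OF legal(1)] by (simp add: deg_introv_def)
next
  case (ForgetVertex u t)
  have "bag_degree d (ForgetVertex u t) = (bag_degree d t)(u := 0)"
    by (auto simp: fun_eq_iff bag_degree_def vtx_ForgetVertex)
  moreover have "legal k t" using ForgetVertex.prems by simp
  ultimately show ?case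
    unfolding deg.states.simps ForgetVertex.IH[OF \<open>legal k t\<close>]
    by (simp add: deg_forgetv_def del: fun_upd_apply)
next
  case (IntroEdge u v t)
  have legal: "legal k t" "u \<in> bag t" "v \<in> bag t" "u \<noteq> v" using IntroEdge.prems by auto
  note G = is_graph_graph_of[OF legal(1)]
  obtain e where e: "e \<notin> edges (graph_of t)"
    "verts (graph_of (IntroEdge u v t)) = verts (graph_of t)"
    "edges (graph_of (IntroEdge u v t)) = insert e (edges (graph_of t))"
    "endpoints (graph_of (IntroEdge u v t)) = (endpoints (graph_of t))(e := {vtx t u, vtx t v})"
    "vtx (IntroEdge u v t) = vtx t"
    using graph_of_IntroEdge[OF IntroEdge.prems] by metis
  have deg: "degree (graph_of (IntroEdge u v t)) x =
      degree (graph_of t) x + (if x = vtx t u \<or> x = vtx t v then 1 else 0)" for x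
  proof -
    have "{f \<in> edges (graph_of (IntroEdge u v t)). x \<in> endpoints (graph_of (IntroEdge u v t)) f} =
        {f \<in> edges (graph_of t). x \<in> endpoints (graph_of t) f} \<union>
        (if x = vtx t u \<or> x = vtx t v then {e} else {})"
      using e(1) by (auto simp: e(2-))
    then show ?thesis using e(1) G by (simp add: degree_endpoints is_graph_def)
  qed
  have V: "vtx t u \<in> verts (graph_of t)" "vtx t v \<in> verts (graph_of t)"
    using vtx_in_verts[OF legal(1)] legal by auto
  have eq: "vtx t x = vtx t y \<longleftrightarrow> x = y" if "x \<in> bag t" "y \<in> bag t" for x y
    using inj_on_vtx[OF legal(1)] that by (auto simp: inj_on_def)
  have "reaches_degree d (graph_of (IntroEdge u v t)) \<longleftrightarrow> reaches_degree d (graph_of t) \<or>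
      d \<le> bag_degree d t u + 1 \<or> d \<le> bag_degree d t v + 1"
  proof -
    have "degree (graph_of t) x \<le> degree (graph_of (IntroEdge u v t)) x"
      "x \<noteq> vtx t u \<Longrightarrow> x \<noteq> vtx t v \<Longrightarrow>
        degree (graph_of (IntroEdge u v t)) x = degree (graph_of t) x" for x
      by (simp_all add: deg)
    \<comment> \<open>Truncating at \<open>d\<close> does not affect the test whether one more edge
      reaches \<open>d\<close>.\<close>
    moreover have "d \<le> bag_degree d t w + 1 \<longleftrightarrow> d \<le> degree (graph_of (IntroEdge u v t)) (vtx t w)"
      if "w = u \<or> w = v" for w
      using that legal by (auto simp: bag_degree_def deg)
    ultimately show ?thesis
      unfolding reaches_degree_def e(2) using V by (metis le_trans)
  qed
  moreover have "bag_degree d (IntroEdge u v t) = (bag_degree d t)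
      (u := min d (bag_degree d t u + 1), v := min d (bag_degree d t v + 1))"
    using legal by (auto simp: fun_eq_iff bag_degree_def deg e(5) eq)
  ultimately show ?case
    unfolding deg.states.simps IntroEdge.IH[OF legal(1)]
    by (simp add: deg_introe_def del: fun_upd_apply)
next
  case (Join s t)
  have legal: "legal k s" "legal k t" "bag t = bag s" using Join.prems by auto
  obtain i h j l where inj: "inj i" "inj h" "inj j" "inj l" "range j \<inter> range l = {}"
    and J: "verts (graph_of (Join s t)) = i ` verts (graph_of s) \<union> h ` verts (graph_of t)"
      "edges (graph_of (Join s t)) = j ` edges (graph_of s) \<union> l ` edges (graph_of t)"
      "\<And>e. endpoints (graph_of (Join s t)) (j e) = i ` endpoints (graph_of s) e"
      "\<And>e. endpoints (graph_of (Join s t)) (l e) = h ` endpoints (graph_of t) e"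
      "\<And>u. u \<in> bag s \<Longrightarrow> vtx (Join s t) u = i (vtx s u)"
      "\<And>u. u \<in> bag s \<Longrightarrow> h (vtx t u) = i (vtx s u)"
      "\<And>x y. i x = h y \<Longrightarrow> \<exists>u \<in> bag s. x = vtx s u \<and> y = vtx t u"
    by (rule graph_of_Join[OF Join.prems]) (rule that; assumption)
  define S T H where "S = degree (graph_of s)" and "T = degree (graph_of t)"
    and "H = degree (graph_of (Join s t))"
  note deg = degree_Join[OF Join.prems inj J(2-4), folded H_def]
  \<comment> \<open>A vertex keeps its degree on its own side and gains the edges of the other side
    at its image. The gain is the full degree there for a shared vertex and zero for any
    other.\<close>
  have deg_i: "H (i x) = S x + card {e \<in> edges (graph_of t). i x \<in> h ` endpoints (graph_of t) e}" for x
    using inj(1) by (simp add: deg S_def degree_endpoints inj_image_mem_iff)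
  have deg_h: "H (h y) = card {e \<in> edges (graph_of s). h y \<in> i ` endpoints (graph_of s) e} + T y" for y
    using inj(2) by (simp add: deg T_def degree_endpoints inj_image_mem_iff)
  have deg_u: "H (i (vtx s u)) = S (vtx s u) + T (vtx t u)" if "u \<in> bag s" for u
    using deg_i[of "vtx s u"] inj(2) J(6)[OF that, symmetric]
    by (simp add: T_def degree_endpoints inj_image_mem_iff)
  have deg_x: "H (i x) = S x" if "x \<notin> vtx s ` bag s" for x
  proof -
    have "{e \<in> edges (graph_of t). i x \<in> h ` endpoints (graph_of t) e} = {}" using that J(7) by blast
    then show ?thesis unfolding deg_i by (simp only: card.empty)
  qed
  have deg_y: "H (h y) = T y" if y: "y \<notin> vtx t ` bag s" for y
  proof -
    have "h y \<notin> i ` A" for A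
    proof
      assume "h y \<in> i ` A"
      then obtain x where "i x = h y" by auto
      with J(7) y show False by blast
    qed
    then have "{e \<in> edges (graph_of s). h y \<in> i ` endpoints (graph_of s) e} = {}" by blast
    then show ?thesis unfolding deg_h by (simp only: card.empty)
  qed
  define g where "g = bag_degree d s"
  define g' where "g' = bag_degree d t"
  have g: "g u = (if u \<in> bag s then min d (S (vtx s u)) else 0)"
    "g' u = (if u \<in> bag s then min d (T (vtx t u)) else 0)" for u
    using legal(3) by (simp_all add: g_def g'_def bag_degree_def S_def T_def)
  have flag: "(\<exists>w \<in> verts (graph_of (Join s t)). d \<le> H w) \<longleftrightarrow>
      (\<exists>x \<in> verts (graph_of s). d \<le> S x) \<or> (\<exists>y \<in> verts (graph_of t). d \<le> T y) \<or>
      (\<exists>u. d \<le> g u + g' u)" (is "?L \<longleftrightarrow> ?R")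
  proof
    assume ?L
    then obtain w where w: "w \<in> verts (graph_of (Join s t))" "d \<le> H w" by blast
    show ?R
    proof (cases "w \<in> i ` vtx s ` bag s")
      case True
      then obtain u where "u \<in> bag s" "w = i (vtx s u)" by blast
      with w have "d \<le> g u + g' u" by (auto simp: deg_u g)
      then show ?thesis by blast
    next
      case False
      from w consider x where "x \<in> verts (graph_of s)" "w = i x"
        | y where "y \<in> verts (graph_of t)" "w = h y" using J(1) by blast
      then show ?thesis
      proof cases
        case 1
        then have "x \<notin> vtx s ` bag s" using False by blast
        then show ?thesis using deg_x w 1 by auto
      next
        case 2
        then have "y \<notin> vtx t ` bag s" using False J(6) by fastforce
        then show ?thesis using deg_y w 2 by auto
      qed
    qed
  next
    assume ?R
    then consider x where "x \<in> verts (graph_of s)" "d \<le> S x"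
      | y where "y \<in> verts (graph_of t)" "d \<le> T y" | u where "d \<le> g u + g' u" by blast
    then show ?L
    proof cases
      case 1
      then have "d \<le> H (i x)" using deg_i[of x] by simp
      then show ?thesis using 1 J(1) by blast
    next
      case 2
      then have "d \<le> H (h y)" using deg_h[of y] by simp
      then show ?thesis using 2 J(1) by blast
    next
      case 3
      \<comment> \<open>Off the bag both entries are \<open>0\<close>, which cannot add up to
        \<open>d \<ge> 1\<close>.\<close>
      then have u: "u \<in> bag s" using assms(2) by (auto simp: g split: if_splits)
      with 3 have "d \<le> H (i (vtx s u))" by (simp add: deg_u g)
      then show ?thesis using vtx_in_verts[OF legal(1) u] J(1) by blast
    qed
  qed
  have "reaches_degree d (graph_of (Join s t)) \<longleftrightarrow> reaches_degree d (graph_of s) \<or>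
      reaches_degree d (graph_of t) \<or> (\<exists>u. d \<le> g u + g' u)"
    using flag by (simp add: reaches_degree_def S_def T_def H_def)
  moreover have "bag_degree d (Join s t) = (\<lambda>u. min d (g u + g' u))"
    by (auto simp: fun_eq_iff bag_degree_def g J(5) deg_u simp flip: H_def)
  ultimately show ?case
    unfolding deg.states.simps Join.IH(1)[OF legal(1)] Join.IH(2)[OF legal(2)]
    by (simp add: deg_join_def g_def g'_def)
qed

lemma accepts_deg:
  assumes "d \<ge> 1" "legal k t"
  shows "accepts (deg.core d k) t \<longleftrightarrow> d \<le> max_degree (graph_of t)"
  using assms by (simp add: deg.accepts_core states_deg reaches_degree_def max_degree_ge_iff is_graph_graph_of)

text \<open>Besides the table there is one bit for the flag and one for rounding. As
  \<open>k \<ge> 1\<close> and the logarithm is at least \<open>1\<close>, the additive terms are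
  absorbed into the product.\<close>

lemma bit_length_deg:
  assumes "d \<ge> 1"
  shows "bit_length_le (deg.core d) (\<lambda>k. 8 * (real k * log 2 (real d + 1)))"
proof (rule deg.bit_length_core)
  fix k :: nat assume k: "k \<ge> 1"
  define L where "L = log 2 (real d + 1)"
  have L: "L \<ge> 1" using assms by (simp add: L_def)
  have "card (deg_states d k) \<le> (d + 1) ^ (k + 1) * 2"
    unfolding deg_states_def card_cartesian_product using bounded_funs_card[of d k] by simp
  then have "log 2 (real (card (deg_states d k))) \<le> log 2 (real ((d + 1) ^ (k + 1) * 2))"
    using deg.leaf_X[of d k] deg.finite_X by (intro log_card_le) blast+
  also have "\<dots> = log 2 ((real d + 1) ^ (k + 1) * 2)"
    by (simp only: of_nat_mult of_nat_power of_nat_add of_nat_1 of_nat_numeral)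
  also have "\<dots> = (real k + 1) * L + 1"
    unfolding L_def by (subst log_mult) (auto simp: log_nat_power simp del: power_Suc)
  finally have "log 2 (real (card (deg_states d k))) + 1 \<le> real k * L + L + 2"
    by (simp add: algebra_simps)
  moreover have "real k * L \<ge> L" "real k * L \<ge> 1"
    using k L mult_mono[of 1 "real k" 1 L] mult_right_mono[of 1 "real k" L] by auto
  ultimately show "log 2 (real (card (deg_states d k))) + 1 \<le> 8 * (real k * log 2 (real d + 1))"
    unfolding L_def[symmetric] by linarith
qed

section \<open>Colorability\<close>

text \<open>A state is a coloring of the bag with the colors \<open>1, \<dots>, r\<close>; the value 0 marks labels outside
  of the bag.\<close>

definition col_final :: "(nat \<Rightarrow> nat) \<Rightarrow> bool" where
  "col_final g \<longleftrightarrow> True"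

definition col_leaf :: "nat \<Rightarrow> nat" where
  "col_leaf = (\<lambda>_. 0)"

definition col_introv :: "nat \<Rightarrow> nat \<Rightarrow> (nat \<Rightarrow> nat) \<Rightarrow> (nat \<Rightarrow> nat) set" where
  "col_introv r u g = (\<lambda>c. g(u := c)) ` {1..r}"

definition col_forgetv :: "nat \<Rightarrow> (nat \<Rightarrow> nat) \<Rightarrow> (nat \<Rightarrow> nat) set" where
  "col_forgetv u g = {g(u := 0)}"

definition col_introe :: "nat \<Rightarrow> nat \<Rightarrow> (nat \<Rightarrow> nat) \<Rightarrow> (nat \<Rightarrow> nat) set" where
  "col_introe u v g = (if g u = g v then {} else {g})"

definition col_join :: "(nat \<Rightarrow> nat) \<Rightarrow> (nat \<Rightarrow> nat) \<Rightarrow> (nat \<Rightarrow> nat) set" where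
  "col_join g g' = (if g = g' then {g} else {})"

lemmas col_defs = col_final_def col_leaf_def col_introv_def col_forgetv_def col_introe_def
  col_join_def

interpretation col: equivariant_system "bounded_funs r" support rename col_final col_leaf
  "col_introv r" col_forgetv col_introe col_join for r
proof
  fix \<pi> :: "nat \<Rightarrow> nat" and u v :: nat and g g' :: "nat \<Rightarrow> nat" assume \<pi>: "bij \<pi>"
  show "col_join (rename \<pi> g) (rename \<pi> g') = rename \<pi> ` col_join g g'"
    by (simp add: col_join_def rename_inject[OF \<pi>])
  show "col_introe (\<pi> u) (\<pi> v) (rename \<pi> g) = rename \<pi> ` col_introe u v g"
    by (simp add: col_introe_def rename_apply[OF \<pi>])
  show "col_forgetv (\<pi> u) (rename \<pi> g) = rename \<pi> ` col_forgetv u g"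
    by (simp add: col_forgetv_def rename_upd[OF \<pi>])
  show "col_introv r (\<pi> u) (rename \<pi> g) = rename \<pi> ` col_introv r u g"
    by (simp add: col_introv_def rename_upd[OF \<pi>] image_image)
next
  fix u and g g' :: "nat \<Rightarrow> nat" assume "g' \<in> col_introv r u g"
  then show "support g' \<subseteq> insert u (support g)"
    using support_upd by (fastforce simp: col_introv_def)
next
  fix g :: "nat \<Rightarrow> nat" and k assume "g \<in> bounded_funs r k"
  then show "support g \<subseteq> {1..k+1}" by (rule support_bounded_funs)
qed (auto simp: col_defs bounded_funs_card bounded_funs_rename bounded_funs_upd zero_bounded_funs
    rename_id rename_comp support_rename support_upd_0
    simp del: fun_upd_apply split: if_splits dest: support_bounded_funs intro: rename_cong,
    auto simp: support_def)

section \<open>Correctness of the coloring states\<close>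

definition proper_coloring :: "nat \<Rightarrow> graph \<Rightarrow> (nat \<Rightarrow> nat) \<Rightarrow> bool" where
  "proper_coloring r G \<chi> \<longleftrightarrow> \<chi> ` verts G \<subseteq> {1..r} \<and> (\<forall>e \<in> edges G. inj_on \<chi> (endpoints G e))"

definition bag_coloring :: "instr \<Rightarrow> (nat \<Rightarrow> nat) \<Rightarrow> nat \<Rightarrow> nat" where
  "bag_coloring t \<chi> u = (if u \<in> bag t then \<chi> (vtx t u) else 0)"

text \<open>The states are the traces on the bag of proper colorings of the whole graph. The trace
  suffices, since a forgotten vertex receives no further edges and is never identified with another
  vertex.\<close>

lemma states_col:
  assumes "legal k t"
  shows "col.states r t = {bag_coloring t \<chi> | \<chi>. proper_coloring r (graph_of t) \<chi>}"
  using assms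
proof (induction t)
  case Leaf
  then show ?case
    unfolding col.states.simps unfolding col_leaf_def by (auto simp: proper_coloring_def bag_coloring_def fun_eq_iff)
next
  case (IntroVertex u t)
  have legal: "legal k t" "u \<notin> bag t" using IntroVertex.prems by auto
  obtain x where x: "x \<notin> verts (graph_of t)"
    "verts (graph_of (IntroVertex u t)) = insert x (verts (graph_of t))"
    "edges (graph_of (IntroVertex u t)) = edges (graph_of t)"
    "endpoints (graph_of (IntroVertex u t)) = endpoints (graph_of t)"
    "vtx (IntroVertex u t) = (vtx t)(u := x)"
    using graph_of_IntroVertex[OF IntroVertex.prems] by metis
  have sub: "endpoints (graph_of t) e \<subseteq> verts (graph_of t)" for e
    using endpoints_subset[OF is_graph_graph_of[OF legal(1)]] .
  \<comment> \<open>The new vertex is isolated, so its color is free. The converse inclusion uses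
    that any coloring is its own update at \<open>x\<close> with
    \<open>c = \<chi> x\<close>.\<close>
  have proper: "proper_coloring r (graph_of (IntroVertex u t)) (\<chi>(x := c)) \<longleftrightarrow>
      proper_coloring r (graph_of t) \<chi> \<and> c \<in> {1..r}" for \<chi> c
  proof -
    have "inj_on (\<chi>(x := c)) (endpoints (graph_of t) e) \<longleftrightarrow> inj_on \<chi> (endpoints (graph_of t) e)" for e
      using x(1) sub[of e] by (intro inj_on_cong) auto
    moreover have "(\<chi>(x := c)) ` insert x (verts (graph_of t)) = insert c (\<chi> ` verts (graph_of t))"
      using x(1) by auto
    ultimately show ?thesis unfolding proper_coloring_def x by auto
  qed
  have bag: "bag_coloring (IntroVertex u t) (\<chi>(x := c)) = (bag_coloring t \<chi>)(u := c)" for \<chi> c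
    using x vtx_in_verts[OF legal(1)] by (auto simp: bag_coloring_def fun_eq_iff)
  show ?case
  proof (intro equalityI subsetI)
    fix g assume "g \<in> col.states r (IntroVertex u t)"
    then obtain \<chi> c where "proper_coloring r (graph_of t) \<chi>" "c \<in> {1..r}"
      "g = (bag_coloring t \<chi>)(u := c)"
      unfolding col.states.simps IntroVertex.IH[OF legal(1)] unfolding col_introv_def by blast
    then have "g = bag_coloring (IntroVertex u t) (\<chi>(x := c))"
      "proper_coloring r (graph_of (IntroVertex u t)) (\<chi>(x := c))"
      by (simp_all only: proper bag simp_thms)
    then show "g \<in> {bag_coloring (IntroVertex u t) \<chi> | \<chi>.
        proper_coloring r (graph_of (IntroVertex u t)) \<chi>}" by blast
  next
    fix g assume "g \<in> {bag_coloring (IntroVertex u t) \<chi> | \<chi>.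
        proper_coloring r (graph_of (IntroVertex u t)) \<chi>}"
    then obtain \<chi> where \<chi>: "proper_coloring r (graph_of (IntroVertex u t)) \<chi>"
      "g = bag_coloring (IntroVertex u t) \<chi>" by blast
    then have "proper_coloring r (graph_of t) \<chi>" "\<chi> x \<in> {1..r}" "g = (bag_coloring t \<chi>)(u := \<chi> x)"
      using proper[of \<chi> "\<chi> x"] bag[of \<chi> "\<chi> x"] by auto
    then show "g \<in> col.states r (IntroVertex u t)"
      unfolding col.states.simps IntroVertex.IH[OF legal(1)] unfolding col_introv_def by blast
  qed
next
  case (ForgetVertex u t)
  have bag: "bag_coloring (ForgetVertex u t) \<chi> = (bag_coloring t \<chi>)(u := 0)" for \<chi>
    by (auto simp: bag_coloring_def fun_eq_iff vtx_ForgetVertex)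
  have "legal k t" using ForgetVertex.prems by simp
  show ?case
    unfolding col.states.simps ForgetVertex.IH[OF \<open>legal k t\<close>]
    unfolding col_forgetv_def bag graph_of_ForgetVertex by blast
next
  case (IntroEdge u v t)
  have legal: "legal k t" "u \<in> bag t" "v \<in> bag t" "u \<noteq> v" using IntroEdge.prems by auto
  obtain e where e: "e \<notin> edges (graph_of t)"
    "verts (graph_of (IntroEdge u v t)) = verts (graph_of t)"
    "edges (graph_of (IntroEdge u v t)) = insert e (edges (graph_of t))"
    "endpoints (graph_of (IntroEdge u v t)) = (endpoints (graph_of t))(e := {vtx t u, vtx t v})"
    "vtx (IntroEdge u v t) = vtx t"
    using graph_of_IntroEdge[OF IntroEdge.prems] by metis
  have "vtx t u \<noteq> vtx t v" using inj_on_vtx[OF legal(1)] legal by (auto simp: inj_on_def)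
  then have proper: "proper_coloring r (graph_of (IntroEdge u v t)) \<chi> \<longleftrightarrow>
      proper_coloring r (graph_of t) \<chi> \<and> bag_coloring t \<chi> u \<noteq> bag_coloring t \<chi> v" for \<chi>
    unfolding proper_coloring_def e(2-) using e(1) legal by (auto simp: bag_coloring_def)
  have "bag_coloring (IntroEdge u v t) = bag_coloring t"
    by (simp add: bag_coloring_def fun_eq_iff e)
  then show ?case
    unfolding col.states.simps IntroEdge.IH[OF legal(1)] unfolding col_introe_def proper
    by (auto split: if_splits)
next
  case (Join s t)
  have legal: "legal k s" "legal k t" "bag t = bag s" using Join.prems by auto
  obtain i h j l where inj: "inj i" "inj h" "inj j" "inj l" "range j \<inter> range l = {}"
    and J: "verts (graph_of (Join s t)) = i ` verts (graph_of s) \<union> h ` verts (graph_of t)"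
      "edges (graph_of (Join s t)) = j ` edges (graph_of s) \<union> l ` edges (graph_of t)"
      "\<And>e. endpoints (graph_of (Join s t)) (j e) = i ` endpoints (graph_of s) e"
      "\<And>e. endpoints (graph_of (Join s t)) (l e) = h ` endpoints (graph_of t) e"
      "\<And>u. u \<in> bag s \<Longrightarrow> vtx (Join s t) u = i (vtx s u)"
      "\<And>u. u \<in> bag s \<Longrightarrow> h (vtx t u) = i (vtx s u)"
      "\<And>x y. i x = h y \<Longrightarrow> \<exists>u \<in> bag s. x = vtx s u \<and> y = vtx t u"
    by (rule graph_of_Join[OF Join.prems]) (rule that; assumption)
  have inj_on: "inj_on (\<chi> \<circ> i) A \<longleftrightarrow> inj_on \<chi> (i ` A)" "inj_on (\<chi> \<circ> h) A \<longleftrightarrow> inj_on \<chi> (h ` A)"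
    for \<chi> :: "nat \<Rightarrow> nat" and A
    using inj by (metis comp_inj_on_iff inj_on_subset subset_UNIV)+
  \<comment> \<open>Every edge of the join comes from one side, so properness splits into conditions
    on the two pulled-back colorings.\<close>
  have proper: "proper_coloring r (graph_of (Join s t)) \<chi> \<longleftrightarrow>
      proper_coloring r (graph_of s) (\<chi> \<circ> i) \<and> proper_coloring r (graph_of t) (\<chi> \<circ> h)" for \<chi>
    unfolding proper_coloring_def inj_on J(1,2) ball_Un ball_simps(9) J(3,4)
    by (auto simp: image_Un image_comp)
  have bag: "bag_coloring (Join s t) \<chi> = bag_coloring s (\<chi> \<circ> i)"
    "bag_coloring (Join s t) \<chi> = bag_coloring t (\<chi> \<circ> h)" for \<chi>
    using J(5,6) legal(3) by (auto simp: bag_coloring_def fun_eq_iff)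
  show ?case
  proof (intro equalityI subsetI)
    fix g assume "g \<in> col.states r (Join s t)"
    then have g: "g \<in> col.states r s" "g \<in> col.states r t"
      unfolding col.states.simps unfolding col_join_def by (auto split: if_splits)
    obtain \<chi>1 where 1: "proper_coloring r (graph_of s) \<chi>1" "g = bag_coloring s \<chi>1"
      using g(1) Join.IH(1)[OF legal(1)] by auto
    obtain \<chi>2 where 2: "proper_coloring r (graph_of t) \<chi>2" "g = bag_coloring t \<chi>2"
      using g(2) Join.IH(2)[OF legal(2)] by auto
    \<comment> \<open>The amalgam of the two colorings. On the overlap of the copies the left one is
      used; it agrees with the right one there because overlapping vertices carry a common label and
      both colorings have the trace \<open>g\<close>.\<close>
    define \<chi> where "\<chi> w = (if w \<in> range i then \<chi>1 (inv i w) else \<chi>2 (inv h w))" for w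
    have "\<chi> \<circ> i = \<chi>1" using inj by (auto simp: fun_eq_iff \<chi>_def)
    moreover have "\<chi> (h y) = \<chi>2 y" for y
    proof (cases "h y \<in> range i")
      case True
      then obtain x where x: "h y = i x" by blast
      then obtain u where u: "u \<in> bag s" "x = vtx s u" "y = vtx t u" using J(7) by metis
      then have "\<chi>1 x = bag_coloring s \<chi>1 u" "\<chi>2 y = bag_coloring t \<chi>2 u"
        using legal(3) by (simp_all add: bag_coloring_def)
      then have "\<chi>1 x = \<chi>2 y" using 1(2) 2(2) by simp
      then show ?thesis using x inj by (simp add: \<chi>_def)
    next
      case False
      then show ?thesis using inj by (simp add: \<chi>_def)
    qed
    then have "\<chi> \<circ> h = \<chi>2" by (simp add: fun_eq_iff)
    ultimately have "proper_coloring r (graph_of (Join s t)) \<chi>" "g = bag_coloring (Join s t) \<chi>"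
      using 1 2 proper bag by simp_all
    then show "g \<in> {bag_coloring (Join s t) \<chi> | \<chi>. proper_coloring r (graph_of (Join s t)) \<chi>}"
      by blast
  next
    fix g assume "g \<in> {bag_coloring (Join s t) \<chi> | \<chi>. proper_coloring r (graph_of (Join s t)) \<chi>}"
    then obtain \<chi> where "proper_coloring r (graph_of (Join s t)) \<chi>" "g = bag_coloring (Join s t) \<chi>"
      by blast
    then have "g \<in> col.states r s" "g \<in> col.states r t"
      unfolding Join.IH(1)[OF legal(1)] Join.IH(2)[OF legal(2)] proper using bag by blast+
    then show "g \<in> col.states r (Join s t)" 
      unfolding col.states.simps unfolding col_join_def by auto
  qed
qed

lemma accepts_col:
  assumes "legal k t"
  shows "accepts (col.core r k) t \<longleftrightarrow> colorable r (graph_of t)"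
  unfolding col.accepts_core[OF assms] states_col[OF assms] colorable_iff[OF is_graph_graph_of[OF assms]]
  by (auto simp: col_final_def proper_coloring_def)

lemma bit_length_col:
  assumes "r \<ge> 1"
  shows "bit_length_le (col.core r) (\<lambda>k. 8 * (real k * log 2 (real r + 1)))"
proof (rule col.bit_length_core)
  fix k :: nat assume k: "k \<ge> 1"
  define L where "L = log 2 (real r + 1)"
  have L: "L \<ge> 1" using assms by (simp add: L_def)
  have "log 2 (real (card (bounded_funs r k))) \<le> log 2 (real ((r + 1) ^ (k + 1)))"
    using bounded_funs_card zero_bounded_funs[of r k] by (intro log_card_le) blast+
  also have "\<dots> = log 2 ((real r + 1) ^ (k + 1))"
    by (simp only: of_nat_power of_nat_add of_nat_1)
  also have "\<dots> = (real k + 1) * L"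
    unfolding L_def by (subst log_nat_power) auto
  finally have "log 2 (real (card (bounded_funs r k))) + 1 \<le> real k * L + L + 1"
    by (simp add: algebra_simps)
  moreover have "real k * L \<ge> L" "real k * L \<ge> 1"
    using k L mult_mono[of 1 "real k" 1 L] mult_right_mono[of 1 "real k" L] by auto
  ultimately show "log 2 (real (card (bounded_funs r k))) + 1 \<le> 8 * (real k * log 2 (real r + 1))"
    unfolding L_def[symmetric] by linarith
qed

section \<open>Cliques in simple graphs\<close>

text \<open>The state of a vertex set \<open>K\<close> consists of the labels of the bag vertices in \<open>K\<close>, the size of
  \<open>K\<close> and the number of edges inside \<open>K\<close>. In a simple graph, \<open>K\<close> is a clique if and only if this
  number is \<open>card K choose 2\<close>.\<close>

type_synonym clique_state = "nat set \<times> nat \<times> nat"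

definition clique_states :: "nat \<Rightarrow> nat \<Rightarrow> clique_state set" where
  "clique_states \<omega> k = Pow {1..k+1} \<times> {..\<omega>} \<times> {..\<omega> choose 2}"

definition clique_act :: "(nat \<Rightarrow> nat) \<Rightarrow> clique_state \<Rightarrow> clique_state" where
  "clique_act \<pi> s = (\<pi> ` fst s, snd s)"

definition clique_final :: "nat \<Rightarrow> clique_state \<Rightarrow> bool" where
  "clique_final \<omega> s \<longleftrightarrow> snd s = (\<omega>, \<omega> choose 2)"

definition clique_leaf :: clique_state where
  "clique_leaf = ({}, 0, 0)"

text \<open>The choice is whether the new vertex enters the guessed set.\<close>

definition clique_introv :: "nat \<Rightarrow> nat \<Rightarrow> clique_state \<Rightarrow> clique_state set" where
  "clique_introv \<omega> u = (\<lambda>(B, n, m). {(B, n, m)} \<union> (if n < \<omega> then {(insert u B, Suc n, m)} else {}))"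

definition clique_forgetv :: "nat \<Rightarrow> clique_state \<Rightarrow> clique_state set" where
  "clique_forgetv u s = {(fst s - {u}, snd s)}"

definition clique_introe :: "nat \<Rightarrow> nat \<Rightarrow> nat \<Rightarrow> clique_state \<Rightarrow> clique_state set" where
  "clique_introe \<omega> u v = (\<lambda>(B, n, m).
     if u \<in> B \<and> v \<in> B then if m < \<omega> choose 2 then {(B, n, Suc m)} else {} else {(B, n, m)})"

text \<open>Selected bag vertices are counted on both sides, hence \<open>card B\<close> is
  subtracted; edges are never identified, hence their numbers simply add up.\<close>

definition clique_join :: "nat \<Rightarrow> clique_state \<Rightarrow> clique_state \<Rightarrow> clique_state set" where
  "clique_join \<omega> = (\<lambda>(B, n, m) (B', n', m').
     if B = B' \<and> n + n' - card B \<le> \<omega> \<and> m + m' \<le> \<omega> choose 2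
     then {(B, n + n' - card B, m + m')} else {})"

lemmas clique_defs = clique_states_def clique_act_def clique_final_def clique_leaf_def
  clique_introv_def clique_forgetv_def clique_introe_def clique_join_def

interpretation clique: equivariant_system "clique_states \<omega>" fst clique_act "clique_final \<omega>" clique_leaf
  "clique_introv \<omega>" clique_forgetv "clique_introe \<omega>" "clique_join \<omega>" for \<omega>
proof
  fix \<pi> :: "nat \<Rightarrow> nat" and u v :: nat and s s' :: clique_state assume \<pi>: "bij \<pi>"
  obtain B n m B' n' m' where s: "s = (B, n, m)" "s' = (B', n', m')" by (metis surj_pair)
  have inj: "inj \<pi>" using \<pi> by (rule bij_is_inj)
  have card: "card (\<pi> ` A) = card A" for A using inj by (intro card_image) (rule inj_on_subset, auto)
  show "clique_join \<omega> (clique_act \<pi> s) (clique_act \<pi> s') = clique_act \<pi> ` clique_join \<omega> s s'"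
    by (auto simp: s clique_defs inj_image_eq_iff[OF inj] card)
  show "clique_introe \<omega> (\<pi> u) (\<pi> v) (clique_act \<pi> s) = clique_act \<pi> ` clique_introe \<omega> u v s"
    by (simp add: s clique_defs inj_image_mem_iff[OF inj])
  show "clique_forgetv (\<pi> u) (clique_act \<pi> s) = clique_act \<pi> ` clique_forgetv u s"
    by (simp add: clique_defs image_set_diff[OF inj])
  show "clique_introv \<omega> (\<pi> u) (clique_act \<pi> s) = clique_act \<pi> ` clique_introv \<omega> u s"
    by (auto simp: s clique_defs)
next
  fix s :: clique_state and \<pi> :: "nat \<Rightarrow> nat" and k
  assume "s \<in> clique_states \<omega> k" and \<pi>: "\<pi> permutes {1..k+1}"
  moreover have "\<pi> ` B \<subseteq> {1..k+1}" if "B \<subseteq> {1..k+1}" for B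
    using that permutes_image[OF \<pi>] by blast
  ultimately show "clique_act \<pi> s \<in> clique_states \<omega> k"
    unfolding clique_states_def clique_act_def mem_Times_iff fst_conv snd_conv Pow_iff by blast
next
  fix \<pi> \<sigma> :: "nat \<Rightarrow> nat" and s :: clique_state
  assume "\<And>u. u \<in> fst s \<Longrightarrow> \<pi> u = \<sigma> u"
  then show "clique_act \<pi> s = clique_act \<sigma> s" by (simp add: clique_act_def)
next
  fix \<pi> \<sigma> :: "nat \<Rightarrow> nat" and s :: clique_state
  show "clique_act (\<pi> \<circ> \<sigma>) s = clique_act \<pi> (clique_act \<sigma> s)" by (simp add: clique_act_def image_comp)
qed (auto simp: clique_defs split: if_splits)

section \<open>Correctness of the clique states\<close>

definition clique_state_of :: "instr \<Rightarrow> nat set \<Rightarrow> clique_state" where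
  "clique_state_of t K = ({u \<in> bag t. vtx t u \<in> K}, card K,
     card {e \<in> edges (graph_of t). endpoints (graph_of t) e \<subseteq> K})"

text \<open>Both counts can only grow along a decomposition. Dropping states beyond the targets
  therefore loses no set that could end with the accepting counts.\<close>

definition small_state :: "nat \<Rightarrow> clique_state \<Rightarrow> bool" where
  "small_state \<omega> s \<longleftrightarrow> fst (snd s) \<le> \<omega> \<and> snd (snd s) \<le> \<omega> choose 2"

lemma states_clique:
  assumes "legal k t"
  shows "clique.states \<omega> t =
    {clique_state_of t K | K. K \<subseteq> verts (graph_of t) \<and> small_state \<omega> (clique_state_of t K)}"
  using assms
proof (induction t)
  case Leaf
  then show ?case
    unfolding clique.states.simps unfolding clique_leaf_def by (auto simp: clique_state_of_def small_state_def)
next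
  case (IntroVertex u t)
  have legal: "legal k t" "u \<notin> bag t" using IntroVertex.prems by auto
  obtain x where x: "x \<notin> verts (graph_of t)"
    "verts (graph_of (IntroVertex u t)) = insert x (verts (graph_of t))"
    "edges (graph_of (IntroVertex u t)) = edges (graph_of t)"
    "endpoints (graph_of (IntroVertex u t)) = endpoints (graph_of t)"
    "vtx (IntroVertex u t) = (vtx t)(u := x)"
    using graph_of_IntroVertex[OF IntroVertex.prems] by metis
  note G = is_graph_graph_of[OF legal(1)]
  have old: "clique_state_of (IntroVertex u t) K = clique_state_of t K"
    if "K \<subseteq> verts (graph_of t)" for K
    using that x legal by (auto simp: clique_state_of_def)
  have new: "clique_state_of (IntroVertex u t) (insert x K) =
      (insert u (fst (clique_state_of t K)), Suc (card K), snd (snd (clique_state_of t K)))"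
    if K: "K \<subseteq> verts (graph_of t)" for K
  proof -
    have "finite K" "x \<notin> K" using K x(1) G finite_subset by (auto simp: is_graph_def)
    moreover have "endpoints (graph_of t) e \<subseteq> insert x K \<longleftrightarrow> endpoints (graph_of t) e \<subseteq> K" for e
      using x(1) endpoints_subset[OF G, of e] by blast
    moreover have "{w \<in> insert u (bag t). ((vtx t)(u := x)) w \<in> insert x K} =
        insert u {w \<in> bag t. vtx t w \<in> K}"
      using x(1) vtx_in_verts[OF legal(1)] legal(2) by auto
    ultimately show ?thesis by (simp add: clique_state_of_def x(3-) del: fun_upd_apply)
  qed
  show ?case
  proof (intro equalityI subsetI)
    fix s assume "s \<in> clique.states \<omega> (IntroVertex u t)"
    then obtain K where K: "K \<subseteq> verts (graph_of t)" "small_state \<omega> (clique_state_of t K)"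
      "s \<in> clique_introv \<omega> u (clique_state_of t K)"
      unfolding clique.states.simps IntroVertex.IH[OF legal(1)] by blast
    then consider "s = clique_state_of t K"
      | "s = (insert u (fst (clique_state_of t K)), Suc (card K), snd (snd (clique_state_of t K)))"
        "card K < \<omega>"
      by (auto simp: clique_introv_def clique_state_of_def split: if_splits)
    then show "s \<in> {clique_state_of (IntroVertex u t) K | K.
        K \<subseteq> verts (graph_of (IntroVertex u t)) \<and> small_state \<omega> (clique_state_of (IntroVertex u t) K)}"
    proof cases
      case 1
      then have "s = clique_state_of (IntroVertex u t) K" using old K by simp
      moreover have "small_state \<omega> s" using 1 K by simp
      ultimately show ?thesis using K x(2) by blast
    next
      case 2
      then have "s = clique_state_of (IntroVertex u t) (insert x K)" using new K by simp
      moreover have "small_state \<omega> s" using 2 K by (simp add: small_state_def)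
      moreover have "insert x K \<subseteq> verts (graph_of (IntroVertex u t))" using K x(2) by blast
      ultimately show ?thesis by blast
    qed
  next
    fix s assume "s \<in> {clique_state_of (IntroVertex u t) K | K.
        K \<subseteq> verts (graph_of (IntroVertex u t)) \<and> small_state \<omega> (clique_state_of (IntroVertex u t) K)}"
    then obtain K where K: "K \<subseteq> insert x (verts (graph_of t))" "small_state \<omega> s"
      "s = clique_state_of (IntroVertex u t) K" unfolding x(2) by blast
    have "\<exists>K' \<subseteq> verts (graph_of t). small_state \<omega> (clique_state_of t K') \<and>
        s \<in> clique_introv \<omega> u (clique_state_of t K')"
    proof (cases "x \<in> K")
      case True
      define K' where "K' = K - {x}"
      have K': "K' \<subseteq> verts (graph_of t)" "K = insert x K'" using K True by (auto simp: K'_def)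
      have s: "s = (insert u (fst (clique_state_of t K')), Suc (card K'), snd (snd (clique_state_of t K')))"
        using K(3) new[OF K'(1)] K'(2) by simp
      have "small_state \<omega> (clique_state_of t K')" "s \<in> clique_introv \<omega> u (clique_state_of t K')"
        using s K(2) by (auto simp: small_state_def clique_introv_def clique_state_of_def)
      with K' show ?thesis by blast
    next
      case False
      then have K': "K \<subseteq> verts (graph_of t)" using K by blast
      then have "s = clique_state_of t K" using old K by simp
      with K K' show ?thesis by (auto simp: clique_introv_def)
    qed
    then show "s \<in> clique.states \<omega> (IntroVertex u t)"
      unfolding clique.states.simps IntroVertex.IH[OF legal(1)] by blast
  qed
next
  case (ForgetVertex u t)
  have "clique_state_of (ForgetVertex u t) K =
      (fst (clique_state_of t K) - {u}, snd (clique_state_of t K))" for K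
    by (auto simp: clique_state_of_def vtx_ForgetVertex)
  moreover have "legal k t" using ForgetVertex.prems by simp
  ultimately show ?case
    unfolding clique.states.simps ForgetVertex.IH[OF \<open>legal k t\<close>] unfolding clique_forgetv_def small_state_def
      graph_of_ForgetVertex by auto
next
  case (IntroEdge u v t)
  have legal: "legal k t" "u \<in> bag t" "v \<in> bag t" using IntroEdge.prems by auto
  obtain e where e: "e \<notin> edges (graph_of t)"
    "verts (graph_of (IntroEdge u v t)) = verts (graph_of t)"
    "edges (graph_of (IntroEdge u v t)) = insert e (edges (graph_of t))"
    "endpoints (graph_of (IntroEdge u v t)) = (endpoints (graph_of t))(e := {vtx t u, vtx t v})"
    "vtx (IntroEdge u v t) = vtx t"
    using graph_of_IntroEdge[OF IntroEdge.prems] by metis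
  have fin: "finite (edges (graph_of t))" using is_graph_graph_of[OF legal(1)] by (simp add: is_graph_def)
  have state: "clique_state_of (IntroEdge u v t) K =
      (if vtx t u \<in> K \<and> vtx t v \<in> K
       then (fst (clique_state_of t K), card K, Suc (snd (snd (clique_state_of t K))))
       else clique_state_of t K)" for K
  proof -
    have "{f \<in> edges (graph_of (IntroEdge u v t)). endpoints (graph_of (IntroEdge u v t)) f \<subseteq> K} =
        {f \<in> edges (graph_of t). endpoints (graph_of t) f \<subseteq> K} \<union>
        (if vtx t u \<in> K \<and> vtx t v \<in> K then {e} else {})"
      using e(1) by (auto simp: e(2-))
    then show ?thesis using e(1) fin by (simp add: clique_state_of_def e(5))
  qed
  have "q \<in> clique_introe \<omega> u v (clique_state_of t K) \<longleftrightarrow>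
      q = clique_state_of (IntroEdge u v t) K \<and> small_state \<omega> (clique_state_of (IntroEdge u v t) K)"
    if "small_state \<omega> (clique_state_of t K)" for q K
    using that legal unfolding state by (auto simp: clique_introe_def small_state_def clique_state_of_def)
  \<comment> \<open>Monotonicity of the counts: a set within the bounds after the new edge was
    within them before, so its state was not dropped earlier.\<close>
  moreover have "small_state \<omega> (clique_state_of t K)" if "small_state \<omega> (clique_state_of (IntroEdge u v t) K)" for K
    using that unfolding state by (auto simp: small_state_def clique_state_of_def split: if_splits)
  ultimately show ?case
    unfolding clique.states.simps IntroEdge.IH[OF legal(1)] e(2) by blast
next
  case (Join s t)
  have legal: "legal k s" "legal k t" "bag t = bag s" using Join.prems by auto
  obtain i h j l where inj: "inj i" "inj h" "inj j" "inj l" "range j \<inter> range l = {}"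
    and J: "verts (graph_of (Join s t)) = i ` verts (graph_of s) \<union> h ` verts (graph_of t)"
      "edges (graph_of (Join s t)) = j ` edges (graph_of s) \<union> l ` edges (graph_of t)"
      "\<And>e. endpoints (graph_of (Join s t)) (j e) = i ` endpoints (graph_of s) e"
      "\<And>e. endpoints (graph_of (Join s t)) (l e) = h ` endpoints (graph_of t) e"
      "\<And>u. u \<in> bag s \<Longrightarrow> vtx (Join s t) u = i (vtx s u)"
      "\<And>u. u \<in> bag s \<Longrightarrow> h (vtx t u) = i (vtx s u)"
      "\<And>x y. i x = h y \<Longrightarrow> \<exists>u \<in> bag s. x = vtx s u \<and> y = vtx t u"
    by (rule graph_of_Join[OF Join.prems]) (rule that; assumption)
  note Gs = is_graph_graph_of[OF legal(1)] and Gt = is_graph_graph_of[OF legal(2)]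
  \<comment> \<open>Inclusion-exclusion: two sets that select the same labels overlap after gluing
    exactly in the selected bag vertices.\<close>
  have state: "clique_state_of (Join s t) (i ` K \<union> h ` L) =
      (fst (clique_state_of s K), card K + card L - card (fst (clique_state_of s K)),
       snd (snd (clique_state_of s K)) + snd (snd (clique_state_of t L)))"
    and le: "card (fst (clique_state_of s K)) \<le> card K" "card (fst (clique_state_of s K)) \<le> card L"
    if K: "K \<subseteq> verts (graph_of s)" and L: "L \<subseteq> verts (graph_of t)"
      and eq: "fst (clique_state_of s K) = fst (clique_state_of t L)" for K L
  proof -
    define B where "B = {u \<in> bag s. vtx s u \<in> K}"
    have B: "fst (clique_state_of s K) = B" by (simp add: clique_state_of_def B_def)
    have mem: "vtx s u \<in> K \<longleftrightarrow> vtx t u \<in> L" if "u \<in> bag s" for u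
      using eq that legal(3) by (auto simp: clique_state_of_def set_eq_iff)
    have fin: "finite K" "finite L" using K L Gs Gt finite_subset by (auto simp: is_graph_def)
    \<comment> \<open>Agreement of \<open>K\<close> and \<open>L\<close> on the bag prevents the
      right set from adding vertices to the left copy, so the edges counted on the left remain the
      same.\<close>
    have iK: "i x \<in> i ` K \<union> h ` L \<longleftrightarrow> x \<in> K" for x
    proof
      assume "i x \<in> i ` K \<union> h ` L"
      then consider "x \<in> K" | y where "y \<in> L" "i x = h y" using inj(1) by (auto dest: injD)
      then show "x \<in> K" using J(7) mem by cases blast+
    qed blast
    have hL: "h y \<in> i ` K \<union> h ` L \<longleftrightarrow> y \<in> L" for y
    proof
      assume "h y \<in> i ` K \<union> h ` L"
      then consider "y \<in> L" | x where "x \<in> K" "i x = h y" using inj(2) by (auto dest: injD)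
      then show "y \<in> L" using J(7) mem by cases blast+
    qed blast
    have int: "i ` K \<inter> h ` L = i ` vtx s ` B"
    proof (intro equalityI subsetI)
      fix w assume "w \<in> i ` K \<inter> h ` L"
      then obtain x y where xy: "w = i x" "i x = h y" "x \<in> K" by auto
      then obtain u where "u \<in> bag s" "x = vtx s u" using J(7) by blast
      then show "w \<in> i ` vtx s ` B" using xy(1,3) unfolding B_def by blast
    next
      fix w assume "w \<in> i ` vtx s ` B"
      then obtain u where u: "u \<in> bag s" "vtx s u \<in> K" "w = i (vtx s u)" by (auto simp: B_def)
      then have "w = h (vtx t u)" "vtx t u \<in> L" using J(6) mem by auto
      with u show "w \<in> i ` K \<inter> h ` L" by blast
    qed
    have injB: "inj_on (vtx s) B" using inj_on_vtx[OF legal(1)] by (auto simp: B_def inj_on_def)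
    have card_i: "card (i ` A) = card A" and card_h: "card (h ` A) = card A"
      and card_j: "card (j ` A) = card A" and card_l: "card (l ` A) = card A" for A
      using inj by (auto intro!: card_image inj_on_subset[OF _ subset_UNIV])
    have cB: "card (i ` K \<inter> h ` L) = card B" unfolding int card_i by (rule card_image[OF injB])
    \<comment> \<open>These bounds make the natural-number subtraction exact, and they show that
      neither \<open>K\<close> nor \<open>L\<close> exceeds the size of the union, so the bound on
      the union passes to both children.\<close>
    have leK: "card B \<le> card K" and leL: "card B \<le> card L"
      using card_mono[of "i ` K" "i ` K \<inter> h ` L"] card_mono[of "h ` L" "i ` K \<inter> h ` L"] fin cB
      by (auto simp: card_i card_h)
    then show "card (fst (clique_state_of s K)) \<le> card K" "card (fst (clique_state_of s K)) \<le> card L"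
      using B by simp_all
    have "card (i ` K \<union> h ` L) = card K + card L - card B"
      using card_Un_Int[of "i ` K" "h ` L"] fin cB by (simp add: card_i card_h)
    moreover have "{u \<in> bag (Join s t). vtx (Join s t) u \<in> i ` K \<union> h ` L} = B"
    proof -
      have "vtx (Join s t) u \<in> i ` K \<union> h ` L \<longleftrightarrow> vtx s u \<in> K" if "u \<in> bag s" for u
        unfolding J(5)[OF that] by (rule iK)
      then show ?thesis unfolding B_def bag.simps by blast
    qed
    moreover have "card {e \<in> edges (graph_of (Join s t)).
        endpoints (graph_of (Join s t)) e \<subseteq> i ` K \<union> h ` L} =
      card {e \<in> edges (graph_of s). endpoints (graph_of s) e \<subseteq> K} +
      card {e \<in> edges (graph_of t). endpoints (graph_of t) e \<subseteq> L}"
    proof -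
      have sub: "i ` A \<subseteq> i ` K \<union> h ` L \<longleftrightarrow> A \<subseteq> K" "h ` A \<subseteq> i ` K \<union> h ` L \<longleftrightarrow> A \<subseteq> L" for A
        unfolding image_subset_iff iK hL by blast+
      have "{e \<in> edges (graph_of (Join s t)).
          endpoints (graph_of (Join s t)) e \<subseteq> i ` K \<union> h ` L} =
          j ` {e \<in> edges (graph_of s). endpoints (graph_of (Join s t)) (j e) \<subseteq> i ` K \<union> h ` L} \<union>
          l ` {e \<in> edges (graph_of t). endpoints (graph_of (Join s t)) (l e) \<subseteq> i ` K \<union> h ` L}"
        unfolding J(2) by blast
      then have "{e \<in> edges (graph_of (Join s t)).
          endpoints (graph_of (Join s t)) e \<subseteq> i ` K \<union> h ` L} =
          j ` {e \<in> edges (graph_of s). endpoints (graph_of s) e \<subseteq> K} \<union>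
          l ` {e \<in> edges (graph_of t). endpoints (graph_of t) e \<subseteq> L}" (is "_ = j ` ?A \<union> l ` ?B")
        unfolding J(3,4) sub .
      moreover have "j ` ?A \<inter> l ` ?B = {}" using inj(5) by auto
      moreover have "finite ?A" "finite ?B" using Gs Gt by (auto simp: is_graph_def)
      ultimately show ?thesis by (simp add: card_Un_disjoint card_j card_l)
    qed
    ultimately show "clique_state_of (Join s t) (i ` K \<union> h ` L) =
      (fst (clique_state_of s K), card K + card L - card (fst (clique_state_of s K)),
       snd (snd (clique_state_of s K)) + snd (snd (clique_state_of t L)))"
      unfolding B by (simp add: clique_state_of_def)
  qed
  show ?case
  proof (intro equalityI subsetI)
    fix q assume "q \<in> clique.states \<omega> (Join s t)"
    then obtain K L where K: "K \<subseteq> verts (graph_of s)" and L: "L \<subseteq> verts (graph_of t)"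
      and q: "q \<in> clique_join \<omega> (clique_state_of s K) (clique_state_of t L)"
      unfolding clique.states.simps Join.IH(1)[OF legal(1)] Join.IH(2)[OF legal(2)] by blast
    then have eq: "fst (clique_state_of s K) = fst (clique_state_of t L)"
      by (auto simp: clique_join_def clique_state_of_def split: if_splits)
    have "q = clique_state_of (Join s t) (i ` K \<union> h ` L)" "small_state \<omega> q"
      unfolding state[OF K L eq] using q
      by (auto simp: clique_join_def clique_state_of_def small_state_def split: if_splits)
    moreover have "i ` K \<union> h ` L \<subseteq> verts (graph_of (Join s t))" using K L J(1) by blast
    ultimately show "q \<in> {clique_state_of (Join s t) K | K.
        K \<subseteq> verts (graph_of (Join s t)) \<and> small_state \<omega> (clique_state_of (Join s t) K)}" by blast
  next
    fix q assume "q \<in> {clique_state_of (Join s t) K | K.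
        K \<subseteq> verts (graph_of (Join s t)) \<and> small_state \<omega> (clique_state_of (Join s t) K)}"
    then obtain M where M: "M \<subseteq> verts (graph_of (Join s t))" "small_state \<omega> q"
      "q = clique_state_of (Join s t) M" by blast
    \<comment> \<open>A set of the join splits into its preimages on the two sides. These select the
      same labels because a shared vertex has the same image from both.\<close>
    define K where "K = {x \<in> verts (graph_of s). i x \<in> M}"
    define L where "L = {y \<in> verts (graph_of t). h y \<in> M}"
    have K: "K \<subseteq> verts (graph_of s)" and L: "L \<subseteq> verts (graph_of t)" by (auto simp: K_def L_def)
    have M': "M = i ` K \<union> h ` L" using M(1) J(1) by (auto simp: K_def L_def)
    have eq: "fst (clique_state_of s K) = fst (clique_state_of t L)"
      using J(6) legal(3) vtx_in_verts[OF legal(1)] vtx_in_verts[OF legal(2)]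
      by (auto simp: clique_state_of_def K_def L_def)
    note q = M(3)[unfolded M' state[OF K L eq]]
    have wK: "small_state \<omega> (clique_state_of s K)" and wL: "small_state \<omega> (clique_state_of t L)"
      using M(2) le[OF K L eq] unfolding q by (auto simp: small_state_def clique_state_of_def)
    have "q \<in> clique_join \<omega> (clique_state_of s K) (clique_state_of t L)"
      using M(2) eq unfolding q by (auto simp: clique_join_def clique_state_of_def small_state_def)
    then show "q \<in> clique.states \<omega> (Join s t)"
      unfolding clique.states.simps Join.IH(1)[OF legal(1)] Join.IH(2)[OF legal(2)]
      using K L wK wL by blast
  qed
qed

text \<open>Without parallel edges, \<open>endpoints\<close> maps the edges inside \<open>K\<close>
  injectively into the two-element subsets of \<open>K\<close>. Equal cardinality then means that
  every pair is hit.\<close>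

lemma has_clique_iff_card_edges:
  assumes G: "is_graph G" and simple: "\<not> has_multiple_edge G"
  shows "has_clique \<omega> G \<longleftrightarrow>
    (\<exists>K \<subseteq> verts G. card K = \<omega> \<and> card {e \<in> edges G. endpoints G e \<subseteq> K} = \<omega> choose 2)"
proof -
  have "(\<forall>u \<in> K. \<forall>v \<in> K. u \<noteq> v \<longrightarrow> (\<exists>e \<in> edges G. endpoints G e = {u, v})) \<longleftrightarrow>
      card {e \<in> edges G. endpoints G e \<subseteq> K} = \<omega> choose 2"
    if K: "K \<subseteq> verts G" "card K = \<omega>" for K
  proof -
    define E where "E = {e \<in> edges G. endpoints G e \<subseteq> K}"
    define P where "P = {A. A \<subseteq> K \<and> card A = 2}"
    have fin: "finite K" using K G finite_subset by (auto simp: is_graph_def)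
    then have P: "finite P" "card P = \<omega> choose 2"
      using K n_subsets[OF fin, of 2] by (auto simp: P_def)
    have sub: "endpoints G ` E \<subseteq> P" using G by (auto simp: E_def P_def is_graph_def)
    have "inj_on (endpoints G) E"
      using simple by (auto simp: E_def has_multiple_edge_def inj_on_def)
    then have "card E = card (endpoints G ` E)" by (simp add: card_image)
    then have "card E = \<omega> choose 2 \<longleftrightarrow> endpoints G ` E = P"
      using P sub card_subset_eq[OF P(1) sub] by auto
    also have "\<dots> \<longleftrightarrow> (\<forall>u \<in> K. \<forall>v \<in> K. u \<noteq> v \<longrightarrow> (\<exists>e \<in> edges G. endpoints G e = {u, v}))"
    proof
      assume eq: "endpoints G ` E = P"
      show "\<forall>u \<in> K. \<forall>v \<in> K. u \<noteq> v \<longrightarrow> (\<exists>e \<in> edges G. endpoints G e = {u, v})"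
      proof (intro ballI impI)
        fix u v assume "u \<in> K" "v \<in> K" "u \<noteq> v"
        then have "{u, v} \<in> endpoints G ` E" unfolding eq by (simp add: P_def)
        then obtain e where "e \<in> E" "{u, v} = endpoints G e" by (elim imageE)
        then show "\<exists>e \<in> edges G. endpoints G e = {u, v}" by (auto simp: E_def)
      qed
    next
      assume clique: "\<forall>u \<in> K. \<forall>v \<in> K. u \<noteq> v \<longrightarrow> (\<exists>e \<in> edges G. endpoints G e = {u, v})"
      have "A \<in> endpoints G ` E" if A: "A \<in> P" for A
      proof -
        from A obtain u v where uv: "A = {u, v}" "u \<noteq> v" by (auto simp: P_def card_2_iff)
        with A have "u \<in> K" "v \<in> K" by (auto simp: P_def)
        with clique uv obtain e where "e \<in> edges G" "endpoints G e = A" by metis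
        then show ?thesis using A by (intro image_eqI[of _ _ e]) (auto simp: E_def P_def)
      qed
      with sub show "endpoints G ` E = P" by blast
    qed
    finally show ?thesis unfolding E_def by blast
  qed
  then show ?thesis unfolding has_clique_def by blast
qed

lemma accepts_clique:
  assumes "legal k t" "\<not> has_multiple_edge (graph_of t)"
  shows "accepts (clique.core \<omega> k) t \<longleftrightarrow> has_clique \<omega> (graph_of t)"
  unfolding clique.accepts_core[OF assms(1)] states_clique[OF assms(1)]
    has_clique_iff_card_edges[OF is_graph_graph_of[OF assms(1)] assms(2)]
  by (auto simp: clique_final_def clique_state_of_def small_state_def)

text \<open>For \<open>\<omega> \<ge> 2\<close> each of the two counters has at most
  \<open>\<omega> ^ 2\<close> values, which gives four logarithms, while the set of labels takes
  \<open>k + 1\<close> bits. With rounding the total is at most seven times \<open>k\<close> times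
  \<open>log 2 \<omega>\<close>.\<close>

lemma bit_length_clique:
  assumes "\<omega> \<ge> 2"
  shows "bit_length_le (clique.core \<omega>) (\<lambda>k. 8 * (real k * log 2 (real \<omega>)))"
proof (rule clique.bit_length_core)
  fix k :: nat assume k: "k \<ge> 1"
  define L where "L = log 2 (real \<omega>)"
  have L: "L \<ge> 1" using assms by (simp add: L_def)
  have "\<omega> + 1 \<le> \<omega> ^ 2"
  proof -
    have "2 * \<omega> \<le> \<omega> ^ 2" using assms by (simp add: power2_eq_square)
    then show ?thesis using assms by linarith
  qed
  moreover have "(\<omega> choose 2) + 1 \<le> \<omega> ^ 2"
  proof -
    have "\<omega> choose 2 \<le> \<omega> * (\<omega> - 1)" by (simp add: choose_two)
    moreover have "\<omega> * (\<omega> - 1) + \<omega> = \<omega> ^ 2" by (cases \<omega>) (simp_all add: power2_eq_square)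
    ultimately show ?thesis using assms by linarith
  qed
  ultimately have "(\<omega> + 1) * ((\<omega> choose 2) + 1) \<le> \<omega> ^ 2 * \<omega> ^ 2" by (rule mult_le_mono)
  also have "\<omega> ^ 2 * \<omega> ^ 2 = \<omega> ^ 4" by (simp flip: power_add)
  finally have "2 ^ (k + 1) * ((\<omega> + 1) * ((\<omega> choose 2) + 1)) \<le> 2 ^ (k + 1) * \<omega> ^ 4"
    by (rule mult_le_mono2)
  moreover have "card (clique_states \<omega> k) = 2 ^ (k + 1) * ((\<omega> + 1) * ((\<omega> choose 2) + 1))"
    unfolding clique_states_def card_cartesian_product by (simp add: card_Pow)
  ultimately have "card (clique_states \<omega> k) \<le> 2 ^ (k + 1) * \<omega> ^ 4" by simp
  then have "log 2 (real (card (clique_states \<omega> k))) \<le> log 2 (real (2 ^ (k + 1) * \<omega> ^ 4))"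
    using clique.leaf_X[of \<omega> k] clique.finite_X by (intro log_card_le) blast+
  also have "\<dots> = log 2 (2 ^ (k + 1) * real \<omega> ^ 4)"
    by (simp only: of_nat_mult of_nat_power of_nat_numeral)
  also have "\<dots> = real k + 1 + 4 * L"
    unfolding L_def using assms
    by (subst log_mult) (auto simp: log_nat_power simp del: power_Suc)
  finally have "log 2 (real (card (clique_states \<omega> k))) + 1 \<le> real k + 2 + 4 * L" by simp
  moreover have "real k * L \<ge> L" "real k * L \<ge> 1" "real k * L \<ge> real k"
    using k L mult_mono[of 1 "real k" 1 L] mult_right_mono[of 1 "real k" L]
      mult_left_mono[of 1 L "real k"] by auto
  ultimately show "log 2 (real (card (clique_states \<omega> k))) + 1 \<le> 8 * (real k * log 2 (real \<omega>))"
    unfolding L_def[symmetric] by linarith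
qed

section \<open>Multiple edges\<close>

text \<open>A state records the pairs of labels whose vertices are adjacent, and whether a multiple edge
  has been created.\<close>

type_synonym mult_state = "nat set set \<times> bool"

definition mult_states :: "nat \<Rightarrow> mult_state set" where
  "mult_states k = Pow {B. B \<subseteq> {1..k+1} \<and> card B = 2} \<times> UNIV"

definition mult_supp :: "mult_state \<Rightarrow> nat set" where
  "mult_supp s = \<Union> (fst s)"

definition mult_act :: "(nat \<Rightarrow> nat) \<Rightarrow> mult_state \<Rightarrow> mult_state" where
  "mult_act \<pi> s = ((`) \<pi> ` fst s, snd s)"

definition mult_leaf :: mult_state where
  "mult_leaf = ({}, False)"

definition mult_introv :: "nat \<Rightarrow> mult_state \<Rightarrow> mult_state set" where
  "mult_introv u s = {s}"

definition mult_forgetv :: "nat \<Rightarrow> mult_state \<Rightarrow> mult_state set" where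
  "mult_forgetv u s = {({B \<in> fst s. u \<notin> B}, snd s)}"

definition mult_introe :: "nat \<Rightarrow> nat \<Rightarrow> mult_state \<Rightarrow> mult_state set" where
  "mult_introe u v s = {(insert {u, v} (fst s), snd s \<or> {u, v} \<in> fst s)}"

text \<open>Edges are not identified in a join, so a pair adjacent on both sides yields two parallel
  edges.\<close>

definition mult_join :: "mult_state \<Rightarrow> mult_state \<Rightarrow> mult_state set" where
  "mult_join s s' = {(fst s \<union> fst s', snd s \<or> snd s' \<or> fst s \<inter> fst s' \<noteq> {})}"

lemmas mult_defs = mult_states_def mult_supp_def mult_act_def mult_leaf_def mult_introv_def
  mult_forgetv_def mult_introe_def mult_join_def

interpretation mult: equivariant_system mult_states mult_supp mult_act snd mult_leaf mult_introv
  mult_forgetv mult_introe mult_join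
proof
  fix \<pi> :: "nat \<Rightarrow> nat" and u v :: nat and s s' :: mult_state assume \<pi>: "bij \<pi>"
  have inj: "inj \<pi>" using \<pi> by (rule bij_is_inj)
  \<comment> \<open>Injectivity passes to the action on pairs, so the action commutes with
    intersections and reflects membership, as the flags require.\<close>
  then have inj': "inj ((`) \<pi>)" by (simp add: inj_on_def inj_image_eq_iff)
  have "(`) \<pi> ` fst s \<inter> (`) \<pi> ` fst s' = (`) \<pi> ` (fst s \<inter> fst s')"
    using image_Int[OF inj'] by blast
  then show "mult_join (mult_act \<pi> s) (mult_act \<pi> s') = mult_act \<pi> ` mult_join s s'"
    by (simp add: mult_join_def mult_act_def image_Un)
  have "{\<pi> u, \<pi> v} \<in> (`) \<pi> ` fst s \<longleftrightarrow> {u, v} \<in> fst s"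
    using inj_image_mem_iff[OF inj', of "{u, v}"] by simp
  then show "mult_introe (\<pi> u) (\<pi> v) (mult_act \<pi> s) = mult_act \<pi> ` mult_introe u v s"
    by (simp add: mult_introe_def mult_act_def)
  have "{B \<in> (`) \<pi> ` fst s. \<pi> u \<notin> B} = (`) \<pi> ` {B \<in> fst s. u \<notin> B}"
    by (auto simp: inj_eq[OF inj])
  then show "mult_forgetv (\<pi> u) (mult_act \<pi> s) = mult_act \<pi> ` mult_forgetv u s"
    by (simp add: mult_forgetv_def mult_act_def)
next
  fix s :: mult_state and \<pi> :: "nat \<Rightarrow> nat" and k
  assume s: "s \<in> mult_states k" and \<pi>: "\<pi> permutes {1..k+1}"
  have "\<pi> ` B \<subseteq> {1..k+1} \<and> card (\<pi> ` B) = 2" if "B \<subseteq> {1..k+1}" "card B = 2" for B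
  proof
    show "\<pi> ` B \<subseteq> {1..k+1}" using that permutes_image[OF \<pi>] by blast
    show "card (\<pi> ` B) = 2"
      using that card_image[OF inj_on_subset[OF permutes_inj[OF \<pi>] subset_UNIV]] by simp
  qed
  with s show "mult_act \<pi> s \<in> mult_states k"
    unfolding mult_states_def mult_act_def mem_Times_iff fst_conv snd_conv by blast
next
  fix \<pi> \<sigma> :: "nat \<Rightarrow> nat" and s :: mult_state
  assume eq: "\<And>u. u \<in> mult_supp s \<Longrightarrow> \<pi> u = \<sigma> u"
  have "\<pi> ` B = \<sigma> ` B" if "B \<in> fst s" for B
    using that eq by (intro image_cong) (auto simp: mult_supp_def)
  then have "(`) \<pi> ` fst s = (`) \<sigma> ` fst s" by (rule image_cong[OF refl])
  then show "mult_act \<pi> s = mult_act \<sigma> s" by (simp add: mult_act_def)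
next
  fix \<pi> \<sigma> :: "nat \<Rightarrow> nat" and s :: mult_state
  show "mult_act (\<pi> \<circ> \<sigma>) s = mult_act \<pi> (mult_act \<sigma> s)"
    by (simp add: mult_act_def image_image image_comp)
next
  fix s :: mult_state and k u v
  assume "s \<in> mult_states k" "u \<in> {1..k+1}" "v \<in> {1..k+1}" "u \<noteq> v"
  then show "mult_introe u v s \<subseteq> mult_states k"
    by (auto simp: mult_introe_def mult_states_def)
qed (auto simp: mult_defs)

section \<open>Correctness of the adjacency states\<close>

definition adjacent_labels :: "instr \<Rightarrow> nat set set" where
  "adjacent_labels t =
     {B. B \<subseteq> bag t \<and> (\<exists>e \<in> edges (graph_of t). endpoints (graph_of t) e = vtx t ` B)}"

text \<open>Adjacencies at forgotten vertices may be discarded: new edges join bag vertices, and a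
  join identifies only labeled vertices, so any parallel pair created later has both ends in the
  bag.\<close>

lemma states_mult:
  assumes "legal k t"
  shows "mult.states t = {(adjacent_labels t, has_multiple_edge (graph_of t))}"
  using assms
proof (induction t)
  case Leaf
  then show ?case
    unfolding mult.states.simps unfolding mult_leaf_def
    by (simp add: adjacent_labels_def has_multiple_edge_def)
next
  case (IntroVertex u t)
  have legal: "legal k t" "u \<notin> bag t" using IntroVertex.prems by auto
  obtain x where x: "x \<notin> verts (graph_of t)"
    "verts (graph_of (IntroVertex u t)) = insert x (verts (graph_of t))"
    "edges (graph_of (IntroVertex u t)) = edges (graph_of t)"
    "endpoints (graph_of (IntroVertex u t)) = endpoints (graph_of t)"
    "vtx (IntroVertex u t) = (vtx t)(u := x)"
    using graph_of_IntroVertex[OF IntroVertex.prems] by metis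
  have sub: "endpoints (graph_of t) e \<subseteq> verts (graph_of t)" for e
    using endpoints_subset[OF is_graph_graph_of[OF legal(1)]] .
  have "has_multiple_edge (graph_of (IntroVertex u t)) = has_multiple_edge (graph_of t)"
    by (simp add: has_multiple_edge_def x)
  moreover have "B \<in> adjacent_labels (IntroVertex u t) \<longleftrightarrow> B \<in> adjacent_labels t" for B
  proof (cases "u \<in> B")
    case True
    \<comment> \<open>The new vertex is isolated, so no pair that contains its label is
      adjacent.\<close>
    then have "x \<in> vtx (IntroVertex u t) ` B" by (force simp: x)
    then have "endpoints (graph_of t) e \<noteq> vtx (IntroVertex u t) ` B" for e
      using sub[of e] x(1) by (metis subsetD)
    then show ?thesis using True legal(2) by (auto simp: adjacent_labels_def x(3,4))
  next
    case False
    then have "vtx (IntroVertex u t) ` B = vtx t ` B" by (intro image_cong) (auto simp: x(5))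
    then show ?thesis using False by (auto simp: adjacent_labels_def x(3,4))
  qed
  ultimately show ?case
    unfolding mult.states.simps IntroVertex.IH[OF legal(1)] unfolding mult_introv_def by auto
next
  case (ForgetVertex u t)
  have "B \<in> adjacent_labels (ForgetVertex u t) \<longleftrightarrow> B \<in> adjacent_labels t \<and> u \<notin> B" for B
  proof (cases "u \<in> B")
    case False
    then have "vtx (ForgetVertex u t) ` B = vtx t ` B"
      by (intro image_cong refl vtx_ForgetVertex) blast
    then show ?thesis using False by (simp add: adjacent_labels_def subset_Diff_insert)
  qed (auto simp: adjacent_labels_def)
  then have "adjacent_labels (ForgetVertex u t) = {B \<in> adjacent_labels t. u \<notin> B}" by blast
  moreover have "legal k t" using ForgetVertex.prems by simp
  ultimately show ?case
    unfolding mult.states.simps ForgetVertex.IH[OF \<open>legal k t\<close>] by (simp add: mult_forgetv_def)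
next
  case (IntroEdge u v t)
  have legal: "legal k t" "u \<in> bag t" "v \<in> bag t" using IntroEdge.prems by auto
  obtain e where e: "e \<notin> edges (graph_of t)"
    "verts (graph_of (IntroEdge u v t)) = verts (graph_of t)"
    "edges (graph_of (IntroEdge u v t)) = insert e (edges (graph_of t))"
    "endpoints (graph_of (IntroEdge u v t)) = (endpoints (graph_of t))(e := {vtx t u, vtx t v})"
    "vtx (IntroEdge u v t) = vtx t"
    using graph_of_IntroEdge[OF IntroEdge.prems] by metis
  \<comment> \<open>Distinct bag labels name distinct vertices, so the new edge accounts for the
    pair \<open>{u, v}\<close> and no other.\<close>
  have eq: "{vtx t u, vtx t v} = vtx t ` B \<longleftrightarrow> B = {u, v}" if "B \<subseteq> bag t" for B
    using inj_on_image_eq_iff[OF inj_on_vtx[OF legal(1)], of "{u, v}" B] that legal by auto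
  have "adjacent_labels (IntroEdge u v t) = insert {u, v} (adjacent_labels t)"
  proof (rule set_eqI)
    fix B
    have "(\<exists>f \<in> edges (graph_of (IntroEdge u v t)). endpoints (graph_of (IntroEdge u v t)) f = vtx t ` B)
        \<longleftrightarrow> {vtx t u, vtx t v} = vtx t ` B \<or> (\<exists>f \<in> edges (graph_of t). endpoints (graph_of t) f = vtx t ` B)"
      unfolding e(3,4) using e(1) by auto
    then show "B \<in> adjacent_labels (IntroEdge u v t) \<longleftrightarrow> B \<in> insert {u, v} (adjacent_labels t)"
      using eq[of B] legal by (auto simp: adjacent_labels_def e(5))
  qed
  moreover have "has_multiple_edge (graph_of (IntroEdge u v t)) \<longleftrightarrow>
      has_multiple_edge (graph_of t) \<or> {u, v} \<in> adjacent_labels t"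
  proof -
    have "{u, v} \<in> adjacent_labels t \<longleftrightarrow>
        (\<exists>f \<in> edges (graph_of t). endpoints (graph_of t) f = {vtx t u, vtx t v})"
      using legal by (simp add: adjacent_labels_def)
    then show ?thesis unfolding has_multiple_edge_def e(3,4) using e(1) by auto
  qed
  ultimately show ?case
    unfolding mult.states.simps IntroEdge.IH[OF legal(1)] by (simp add: mult_introe_def)
next
  case (Join s t)
  have legal: "legal k s" "legal k t" "bag t = bag s" using Join.prems by auto
  obtain i h j l where inj: "inj i" "inj h" "inj j" "inj l" "range j \<inter> range l = {}"
    and J: "verts (graph_of (Join s t)) = i ` verts (graph_of s) \<union> h ` verts (graph_of t)"
      "edges (graph_of (Join s t)) = j ` edges (graph_of s) \<union> l ` edges (graph_of t)"
      "\<And>e. endpoints (graph_of (Join s t)) (j e) = i ` endpoints (graph_of s) e"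
      "\<And>e. endpoints (graph_of (Join s t)) (l e) = h ` endpoints (graph_of t) e"
      "\<And>u. u \<in> bag s \<Longrightarrow> vtx (Join s t) u = i (vtx s u)"
      "\<And>u. u \<in> bag s \<Longrightarrow> h (vtx t u) = i (vtx s u)"
      "\<And>x y. i x = h y \<Longrightarrow> \<exists>u \<in> bag s. x = vtx s u \<and> y = vtx t u"
    by (rule graph_of_Join[OF Join.prems]) (rule that; assumption)
  have img: "vtx (Join s t) ` B = i ` vtx s ` B" "i ` vtx s ` B = h ` vtx t ` B" if "B \<subseteq> bag s" for B
    using that J(5,6) by (auto simp: image_image subset_iff intro!: image_cong)
  \<comment> \<open>Sets from different sides have the same image only if both are named by one and
    the same set of bag labels, as the copies overlap in shared vertices alone.\<close>
  have common: "i ` A = h ` A' \<longleftrightarrow> (\<exists>B \<subseteq> bag s. A = vtx s ` B \<and> A' = vtx t ` B)" for A A'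
  proof
    assume eq: "i ` A = h ` A'"
    define B where "B = {u \<in> bag s. vtx s u \<in> A}"
    have "A = vtx s ` B"
    proof (intro equalityI subsetI)
      fix x assume x: "x \<in> A"
      then obtain y where "i x = h y" using eq by (metis imageE imageI)
      then obtain u where "u \<in> bag s" "x = vtx s u" using J(7) by metis
      then show "x \<in> vtx s ` B" using x by (auto simp: B_def)
    qed (auto simp: B_def)
    moreover have "B \<subseteq> bag s" by (auto simp: B_def)
    moreover have "h ` A' = h ` vtx t ` B" using eq calculation img(2) by metis
    ultimately show "\<exists>B \<subseteq> bag s. A = vtx s ` B \<and> A' = vtx t ` B"
      using inj_image_eq_iff[OF inj(2)] by metis
  next
    assume "\<exists>B \<subseteq> bag s. A = vtx s ` B \<and> A' = vtx t ` B"
    then show "i ` A = h ` A'" using img(2) by metis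
  qed
  have "adjacent_labels (Join s t) = adjacent_labels s \<union> adjacent_labels t"
  proof (rule set_eqI)
    fix B
    show "B \<in> adjacent_labels (Join s t) \<longleftrightarrow> B \<in> adjacent_labels s \<union> adjacent_labels t"
    proof (cases "B \<subseteq> bag s")
      case True
      have "(\<exists>e \<in> edges (graph_of (Join s t)). endpoints (graph_of (Join s t)) e = vtx (Join s t) ` B)
        \<longleftrightarrow> (\<exists>e \<in> edges (graph_of s). i ` endpoints (graph_of s) e = i ` vtx s ` B) \<or>
            (\<exists>e \<in> edges (graph_of t). h ` endpoints (graph_of t) e = h ` vtx t ` B)"
        unfolding J(2) bex_Un bex_simps(7) J(3,4) img(1)[OF True] img(2)[OF True] ..
      then show ?thesis
        using True legal(3) by (simp add: adjacent_labels_def inj_image_eq_iff inj)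
    qed (use legal(3) in \<open>simp add: adjacent_labels_def\<close>)
  qed
  moreover have "has_multiple_edge (graph_of (Join s t)) \<longleftrightarrow>
      has_multiple_edge (graph_of s) \<or> has_multiple_edge (graph_of t) \<or>
      adjacent_labels s \<inter> adjacent_labels t \<noteq> {}"
  proof -
    have neq: "j e \<noteq> l e'" "l e' \<noteq> j e" for e e' using inj(5) by (metis disjoint_iff rangeI)+
    have int: "adjacent_labels s \<inter> adjacent_labels t \<noteq> {} \<longleftrightarrow>
        (\<exists>e \<in> edges (graph_of s). \<exists>e' \<in> edges (graph_of t).
          i ` endpoints (graph_of s) e = h ` endpoints (graph_of t) e')"
    proof
      assume "adjacent_labels s \<inter> adjacent_labels t \<noteq> {}"
      then obtain B where "B \<in> adjacent_labels s" "B \<in> adjacent_labels t" by blast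
      then obtain e e' where e: "e \<in> edges (graph_of s)" "endpoints (graph_of s) e = vtx s ` B"
        "e' \<in> edges (graph_of t)" "endpoints (graph_of t) e' = vtx t ` B" and B: "B \<subseteq> bag s"
        by (auto simp: adjacent_labels_def)
      have "i ` endpoints (graph_of s) e = h ` endpoints (graph_of t) e'"
        unfolding e by (rule img(2)[OF B])
      with e show "\<exists>e \<in> edges (graph_of s). \<exists>e' \<in> edges (graph_of t).
          i ` endpoints (graph_of s) e = h ` endpoints (graph_of t) e'" by blast
    next
      assume "\<exists>e \<in> edges (graph_of s). \<exists>e' \<in> edges (graph_of t).
          i ` endpoints (graph_of s) e = h ` endpoints (graph_of t) e'"
      then obtain e e' where e: "e \<in> edges (graph_of s)" "e' \<in> edges (graph_of t)"
        "i ` endpoints (graph_of s) e = h ` endpoints (graph_of t) e'" by (elim bexE)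
      from e(3)[unfolded common] obtain B where "B \<subseteq> bag s"
        "endpoints (graph_of s) e = vtx s ` B" "endpoints (graph_of t) e' = vtx t ` B"
        by (elim exE conjE)
      then have "B \<in> adjacent_labels s" "B \<in> adjacent_labels t"
        using e legal(3) by (auto simp: adjacent_labels_def)
      then show "adjacent_labels s \<inter> adjacent_labels t \<noteq> {}" by blast
    qed
    \<comment> \<open>A parallel pair lies on the left, on the right, or across. Cross pairs are
      distinct automatically because the edge embeddings have disjoint ranges.\<close>
    have "has_multiple_edge (graph_of (Join s t)) \<longleftrightarrow>
        (\<exists>e \<in> edges (graph_of s). \<exists>e' \<in> edges (graph_of s). j e \<noteq> j e' \<and>
          i ` endpoints (graph_of s) e = i ` endpoints (graph_of s) e') \<or>
        (\<exists>e \<in> edges (graph_of t). \<exists>e' \<in> edges (graph_of t). l e \<noteq> l e' \<and>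
          h ` endpoints (graph_of t) e = h ` endpoints (graph_of t) e') \<or>
        (\<exists>e \<in> edges (graph_of s). \<exists>e' \<in> edges (graph_of t).
          i ` endpoints (graph_of s) e = h ` endpoints (graph_of t) e')"
    proof -
      \<comment> \<open>Cross pairs arise in both orders; orienting the equation lets
        \<open>regroup\<close> merge them.\<close>
      have comm: "h ` A = i ` A' \<longleftrightarrow> i ` A' = h ` A" for A A' by (rule eq_commute)
      have regroup: "(\<exists>x \<in> S. (\<exists>y \<in> S. P x y) \<or> (\<exists>y \<in> T. Q x y)) \<or>
          (\<exists>x \<in> T. (\<exists>y \<in> S. Q y x) \<or> (\<exists>y \<in> T. R x y)) \<longleftrightarrow>
          (\<exists>x \<in> S. \<exists>y \<in> S. P x y) \<or> (\<exists>x \<in> T. \<exists>y \<in> T. R x y) \<or> (\<exists>x \<in> S. \<exists>y \<in> T. Q x y)"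
        for S T :: "nat set" and P Q R by blast
      show ?thesis
        unfolding has_multiple_edge_def J(2) bex_Un bex_simps(7) J(3,4) comm
        by (simp only: neq not_False_eq_True simp_thms regroup)
    qed
    then show ?thesis
      unfolding int inj_image_eq_iff[OF inj(1)] inj_image_eq_iff[OF inj(2)]
        inj_eq[OF inj(3)] inj_eq[OF inj(4)] has_multiple_edge_def .
  qed
  ultimately show ?case
    unfolding mult.states.simps Join.IH(1)[OF legal(1)] Join.IH(2)[OF legal(2)]
    by (simp add: mult_join_def)
qed

lemma accepts_mult:
  "legal k t \<Longrightarrow> accepts (mult.core k) t \<longleftrightarrow> has_multiple_edge (graph_of t)"
  by (simp add: mult.accepts_core states_mult)

text \<open>One bit per pair of labels, of which there are \<open>(k + 1) choose 2\<close>, plus one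
  for the flag and one for rounding.\<close>

lemma bit_length_mult: "bit_length_le mult.core (\<lambda>k. 8 * (real k)\<^sup>2)"
proof (rule mult.bit_length_core)
  fix k :: nat assume k: "k \<ge> 1"
  have "card {B. B \<subseteq> {1..k+1} \<and> card B = 2} = (k + 1) choose 2"
    using n_subsets[of "{1..k+1}" 2] by simp
  also have "\<dots> \<le> (k + 1) * k" by (simp add: choose_two)
  finally have "card (mult_states k) \<le> 2 ^ ((k + 1) * k) * 2"
    by (simp add: mult_states_def card_cartesian_product card_Pow del: mult_Suc)
  then have "log 2 (real (card (mult_states k))) \<le> log 2 (real (2 ^ ((k + 1) * k + 1)))"
    using mult.leaf_X[of k] mult.finite_X by (intro log_card_le) (auto simp: mult.commute)
  also have "\<dots> = log 2 (2 ^ ((k + 1) * k + 1))" by (simp only: of_nat_power of_nat_numeral)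
  also have "\<dots> = real ((k + 1) * k + 1)" by (subst log_nat_power) simp_all
  finally have "log 2 (real (card (mult_states k))) + 1 \<le> real k * real k + real k + 2"
    by (simp add: algebra_simps)
  moreover have "real k * real k \<ge> real k" "real k * real k \<ge> 1"
    using k mult_mono[of 1 "real k" 1 "real k"] mult_right_mono[of 1 "real k" "real k"] by auto
  ultimately show "log 2 (real (card (mult_states k))) + 1 \<le> 8 * (real k)\<^sup>2"
    unfolding power2_eq_square by linarith
qed

theorem theorem8:
  shows "\<exists>c::real. \<forall>d r \<omega> :: nat. d \<ge> 1 \<longrightarrow> r \<ge> 1 \<longrightarrow> \<omega> \<ge> 2 \<longrightarrow>
    (\<exists>MaxDeg Chrom SimpleClique HasMultipleEdges :: dp_core.
       (\<forall>D \<in> {MaxDeg, Chrom, SimpleClique, HasMultipleEdges}.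
          is_dp_core D \<and> finite_core D \<and> interface_respecting D \<and> has_witness_actions D) \<and>
       (bit_length_le MaxDeg (\<lambda>k. c * (real k * log 2 (real d + 1))) \<and>
        core_property MaxDeg = {G. is_graph G \<and> max_degree G \<ge> d}) \<and>
       (bit_length_le Chrom (\<lambda>k. c * (real k * log 2 (real r + 1))) \<and>
        core_property Chrom = {G. is_graph G \<and> colorable r G}) \<and>
       (bit_length_le SimpleClique (\<lambda>k. c * (real k * log 2 (real \<omega>))) \<and>
        core_property SimpleClique \<inter> simple_graphs =
          {G. is_graph G \<and> has_clique \<omega> G} \<inter> simple_graphs) \<and>
       (bit_length_le HasMultipleEdges (\<lambda>k. c * (real k)\<^sup>2) \<and>
        core_property HasMultipleEdges = {G. is_graph G \<and> has_multiple_edge G}) \<and>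
       coherent MaxDeg \<and> coherent Chrom \<and> coherent HasMultipleEdges)"
\<comment> \<open>The constant is fixed before \<open>d\<close>, \<open>r\<close> and
  \<open>\<omega>\<close>, so it is uniform in them. The largest factor among the four estimates is
  the \<open>7\<close> of the clique core.\<close>
proof (intro exI[of _ 8] allI impI)
  fix d r \<omega> :: nat assume d: "d \<ge> 1" and r: "r \<ge> 1" and \<omega>: "\<omega> \<ge> 2"
  note deg = accepts_deg[OF d] iso_closed_max_degree[OF d]
  have simple: "iso_closed (\<lambda>G. \<not> has_multiple_edge G)"
    using iso_closed_iff[OF iso_closed_has_multiple_edge] unfolding iso_closed_def by blast
  have clique: "core_property (clique.core \<omega>) \<inter> simple_graphs =
      {G. is_graph G \<and> has_clique \<omega> G} \<inter> simple_graphs"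
    unfolding simple_graphs_def
    by (rule core_property_eq[OF accepts_clique iso_closed_has_clique simple])
  show "\<exists>MaxDeg Chrom SimpleClique HasMultipleEdges :: dp_core.
       (\<forall>D \<in> {MaxDeg, Chrom, SimpleClique, HasMultipleEdges}.
          is_dp_core D \<and> finite_core D \<and> interface_respecting D \<and> has_witness_actions D) \<and>
       (bit_length_le MaxDeg (\<lambda>k. 8 * (real k * log 2 (real d + 1))) \<and>
        core_property MaxDeg = {G. is_graph G \<and> max_degree G \<ge> d}) \<and>
       (bit_length_le Chrom (\<lambda>k. 8 * (real k * log 2 (real r + 1))) \<and>
        core_property Chrom = {G. is_graph G \<and> colorable r G}) \<and>
       (bit_length_le SimpleClique (\<lambda>k. 8 * (real k * log 2 (real \<omega>))) \<and>
        core_property SimpleClique \<inter> simple_graphs =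
          {G. is_graph G \<and> has_clique \<omega> G} \<inter> simple_graphs) \<and>
       (bit_length_le HasMultipleEdges (\<lambda>k. 8 * (real k)\<^sup>2) \<and>
        core_property HasMultipleEdges = {G. is_graph G \<and> has_multiple_edge G}) \<and>
       coherent MaxDeg \<and> coherent Chrom \<and> coherent HasMultipleEdges"
  proof (rule exI[of _ "deg.core d"], rule exI[of _ "col.core r"], rule exI[of _ "clique.core \<omega>"],
      rule exI[of _ mult.core], intro conjI)
    show "\<forall>D \<in> {deg.core d, col.core r, clique.core \<omega>, mult.core}.
        is_dp_core D \<and> finite_core D \<and> interface_respecting D \<and> has_witness_actions D"
      by (simp only: ball_simps deg.is_dp_core_core deg.finite_core_core
          deg.interface_respecting_core deg.has_witness_actions_core
          col.is_dp_core_core col.finite_core_core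
          col.interface_respecting_core col.has_witness_actions_core
          clique.is_dp_core_core clique.finite_core_core
          clique.interface_respecting_core clique.has_witness_actions_core
          mult.is_dp_core_core mult.finite_core_core
          mult.interface_respecting_core mult.has_witness_actions_core simp_thms)
    show "bit_length_le (deg.core d) (\<lambda>k. 8 * (real k * log 2 (real d + 1)))"
      by (rule bit_length_deg[OF d])
    show "core_property (deg.core d) = {G. is_graph G \<and> max_degree G \<ge> d}" "coherent (deg.core d)"
      by (rule core_property_eq'[OF deg] coherentI[OF deg]; assumption)+
    show "bit_length_le (col.core r) (\<lambda>k. 8 * (real k * log 2 (real r + 1)))"
      by (rule bit_length_col[OF r])
    show "core_property (col.core r) = {G. is_graph G \<and> colorable r G}" "coherent (col.core r)"
      by (rule core_property_eq'[OF accepts_col iso_closed_colorable]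
          coherentI[OF accepts_col iso_closed_colorable]; assumption)+
    show "bit_length_le (clique.core \<omega>) (\<lambda>k. 8 * (real k * log 2 (real \<omega>)))"
      by (rule bit_length_clique[OF \<omega>])
    show "core_property (clique.core \<omega>) \<inter> simple_graphs =
        {G. is_graph G \<and> has_clique \<omega> G} \<inter> simple_graphs" by (rule clique)
    show "bit_length_le mult.core (\<lambda>k. 8 * (real k)\<^sup>2)" by (rule bit_length_mult)
    show "core_property mult.core = {G. is_graph G \<and> has_multiple_edge G}" "coherent mult.core"
      by (rule core_property_eq'[OF accepts_mult iso_closed_has_multiple_edge]
          coherentI[OF accepts_mult iso_closed_has_multiple_edge]; assumption)+
  qed
qed

end
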